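(* Let $1\leq p<2$. Let $\Lambda$ be a multiplier on $\mathcal{S}_{p}(\mathcal{X})$ with symbol $\kappa(z)$ satisfying $\kappa(z)\neq 0$ for all $z\in S_{p}$. Suppose that $\{T_{-k}\}_{k\in\mathbb{Z}_{+}}$ is an infinite sequence of $L^{p}$-tempered distributions on $\mathcal{X}$ satisfying the following conditions: (i) $\Lambda T_{-k}=A\,T_{-k+1}$ for some $A\in\mathbb{C}\setminus\{0\}$ and for all $k\in\mathbb{N}=\{1,2,\ldots\}$. (ii) For a fixed semi-norm $\nu_{p,m}(\cdot)$ of $\mathcal{S}_{p}(\mathcal{X})$ (with $m\in\mathbb{Z}_+$ independent of $k$) and a constant $M>0$, $|\langle T_{-k},\phi\rangle|\leq M\nu_{p,m}(\phi)$ for all $k\in\mathbb{Z}_+$ and all $\phi\in\mathcal{S}_{p}(\mathcal{X})$. Then the following assertions hold: (a) If $|A|=\max\{|\kappa(z)|:z\in S_{p}\}$ and if the range $\kappa(S_p)$ intersects $\{w\in\mathbb{C}:|w|=|A|\}$ at finitely many distinct points $A_{1},\ldots,A_{j}$, then $T_{0}$ can be uniquely written as $T_{0}=T_{0,1}+T_{0,2}+\cdots+T_{0,j}$ for some $L^{p}$-tempered distributions $T_{0,i}$ on $\mathcal{X}$ satisfying $\Lambda T_{0,i}=A_{i}T_{0,i}$ for all $i=1,\ldots,j$. (b) If $|A|>\max\{|\kappa(z)|:z\in S_{p}\}$, then $T_{0}=0$.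
   Context: Let $q\geq 2$ be an integer and let $\mathcal{X}$ be the homogeneous tree of degree $q+1$ (the connected graph without cycles in which every vertex has $q+1$ neighbours), identified with its set of vertices, with graph distance $d$, counting measure, a fixed reference vertex $o$, and $|x|=d(o,x)$. A function on $\mathcal{X}$ is radial if its value at $x$ depends only on $|x|$; for radial $k$ we write $k(n)$ for its value at vertices with $|x|=n$. For $k$ radial, $f\ast k(x)=\sum_{y\in\mathcal{X}}f(y)k(d(x,y))$. $\mathbb{Z}_+$ is the set of nonnegative integers. For $p\in(1,\infty)$ put $\delta_p=\frac1p-\frac12$; $\delta_1=\frac12$. For $1\le p<2$, $S_p=\{z\in\mathbb{C}:|\Im z|\le|\delta_p|\}$. Boundary and spherical functions: $\Omega$ is the set of infinite geodesic rays $\omega=\{\omega_0,\omega_1,\dots\}$ starting at $\omega_0=o$; for $x\in\mathcal{X}$, $c(x,\omega)$ is the last vertex of the geodesic path from $o$ to $x$ that lies on $\omega$. $\nu$ is the Borel probability measure on $\Omega$ giving mass $(q+1)^{-1}q^{-n+1}$ to each set $\{\omega:|c(x,\omega)|=|x|\}$ with $|x|=n\ge1$ (these sets, for $x\in\mathcal X$, form a basis of the topology). The Poisson kernel is $p(x,\omega)=q^{2|c(x,\omega)|-|x|}$, and the elementary spherical function is $\phi_z(x)=\int_\Omega p^{1/2+iz}(x,\omega)\,d\nu(\omega)$, $z\in\mathbb{C}$ (a radial function). For a radial function $k$, its spherical Fourier transform is $\widehat{k}(z)=\sum_{x\in\mathcal{X}}k(x)\phi_z(x)$. For $1\le p<2$,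 $\mathcal{S}_p(\mathcal{X})$ is the Fréchet space of functions $\phi$ on $\mathcal{X}$ with $\nu_{p,m}(\phi)=\sup_{x\in\mathcal{X}}(1+|x|)^m q^{|x|/p}|\phi(x)|<\infty$ for all $m\in\mathbb{Z}_+$, topologized by these seminorms. An $L^p$-tempered distribution is a continuous linear functional $T:\mathcal{S}_p(\mathcal{X})\to\mathbb{C}$, with action written $\langle T,\phi\rangle$. A multiplier on $\mathcal{S}_p(\mathcal{X})$ with symbol $\kappa$ is an operator $\Lambda\phi=\phi\ast k$ from $\mathcal{S}_p(\mathcal{X})$ to itself, where $k$ is a radial function such that for every $m\in\mathbb{Z}_+$ there is $C_m>0$ with $\nu_{p,m}(\phi\ast k)\le C_m\nu_{p,m}(\phi)$ for all $\phi\in\mathcal{S}_p(\mathcal{X})$; its symbol is $\kappa(z)=\widehat{k}(z)$, $z\in S_p$ (such $k$ lies in $\mathcal S_p(\mathcal X)$, so the series converges on $S_p$). It acts on $L^p$-tempered distributions by $\langle\Lambda T,\phi\rangle=\langle T,\Lambda\phi\rangle$. *)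

theory Defs
  imports "HOL-Analysis.Analysis"
begin

section \<open>The homogeneous tree\<close>

text \<open>A simple graph is given by its adjacency relation \<open>E\<close>; the vertices are all the
  elements of the type \<open>'v\<close>.\<close>

definition cycle :: "('v \<Rightarrow> 'v \<Rightarrow> bool) \<Rightarrow> 'v list \<Rightarrow> bool" where
  "cycle E xs \<longleftrightarrow> 3 \<le> length xs \<and> distinct xs \<and> successively E xs \<and> E (last xs) (hd xs)"

definition homogeneous_tree :: "('v \<Rightarrow> 'v \<Rightarrow> bool) \<Rightarrow> nat \<Rightarrow> bool" where
  "homogeneous_tree E q \<longleftrightarrow>
     symp E \<and> irreflp E \<and>
     (\<forall>x y. E\<^sup>*\<^sup>* x y) \<and>
     (\<nexists>xs. cycle E xs) \<and>
     (\<forall>x. card {y. E x y} = q + 1)"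

definition tree_dist :: "('v \<Rightarrow> 'v \<Rightarrow> bool) \<Rightarrow> 'v \<Rightarrow> 'v \<Rightarrow> nat" where
  "tree_dist E x y = (LEAST n. (E ^^ n) x y)"

definition geodesic :: "('v \<Rightarrow> 'v \<Rightarrow> bool) \<Rightarrow> 'v \<Rightarrow> 'v \<Rightarrow> 'v list" where
  "geodesic E x y =
     (THE xs. xs \<noteq> [] \<and> hd xs = x \<and> last xs = y \<and> successively E xs \<and>
              length xs = tree_dist E x y + 1)"

section \<open>Radial functions and convolution\<close>

text \<open>Throughout, \<open>r\<close> is the fixed reference vertex (the vertex \<open>o\<close> of the literature).\<close>

definition radial :: "('v \<Rightarrow> 'v \<Rightarrow> bool) \<Rightarrow> 'v \<Rightarrow> ('v \<Rightarrow> complex) \<Rightarrow> bool" where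
  "radial E r k \<longleftrightarrow> (\<forall>x y. tree_dist E r x = tree_dist E r y \<longrightarrow> k x = k y)"

definition radial_value :: "('v \<Rightarrow> 'v \<Rightarrow> bool) \<Rightarrow> 'v \<Rightarrow> ('v \<Rightarrow> complex) \<Rightarrow> nat \<Rightarrow> complex" where
  "radial_value E r k n = (THE c. \<forall>x. tree_dist E r x = n \<longrightarrow> k x = c)"

definition conv :: "('v \<Rightarrow> 'v \<Rightarrow> bool) \<Rightarrow> 'v \<Rightarrow> ('v \<Rightarrow> complex) \<Rightarrow> ('v \<Rightarrow> complex) \<Rightarrow> 'v \<Rightarrow> complex" where
  "conv E r f k x = (\<Sum>\<^sub>\<infinity>y. f y * radial_value E r k (tree_dist E x y))"

section \<open>Boundary and spherical functions\<close>

definition boundary :: "('v \<Rightarrow> 'v \<Rightarrow> bool) \<Rightarrow> 'v \<Rightarrow> (nat \<Rightarrow> 'v) set" where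
  "boundary E r = {\<omega>. \<omega> 0 = r \<and> (\<forall>i j. i \<le> j \<longrightarrow> tree_dist E (\<omega> i) (\<omega> j) = j - i)}"

definition confluent :: "('v \<Rightarrow> 'v \<Rightarrow> bool) \<Rightarrow> 'v \<Rightarrow> 'v \<Rightarrow> (nat \<Rightarrow> 'v) \<Rightarrow> 'v" where
  "confluent E r x \<omega> = last (filter (\<lambda>v. v \<in> range \<omega>) (geodesic E r x))"

definition boundary_arc :: "('v \<Rightarrow> 'v \<Rightarrow> bool) \<Rightarrow> 'v \<Rightarrow> 'v \<Rightarrow> (nat \<Rightarrow> 'v) set" where
  "boundary_arc E r x =
     {\<omega> \<in> boundary E r. tree_dist E r (confluent E r x \<omega>) = tree_dist E r x}"

text \<open>The arcs form a countable basis of the topology of the boundary (the arc of \<open>r\<close> being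
  the whole boundary), so that its Borel sets are the sigma-algebra generated by the arcs
  of the vertices other than \<open>r\<close>.\<close>

definition boundary_measure :: "('v \<Rightarrow> 'v \<Rightarrow> bool) \<Rightarrow> nat \<Rightarrow> 'v \<Rightarrow> (nat \<Rightarrow> 'v) measure" where
  "boundary_measure E q r =
     extend_measure (boundary E r) (- {r}) (boundary_arc E r)
       (\<lambda>x. ennreal (inverse (real (q + 1)) * real q powi (1 - int (tree_dist E r x))))"

definition poisson_kernel :: "('v \<Rightarrow> 'v \<Rightarrow> bool) \<Rightarrow> nat \<Rightarrow> 'v \<Rightarrow> 'v \<Rightarrow> (nat \<Rightarrow> 'v) \<Rightarrow> real" where
  "poisson_kernel E q r x \<omega> =
     real q powi (2 * int (tree_dist E r (confluent E r x \<omega>)) - int (tree_dist E r x))"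

definition spherical :: "('v \<Rightarrow> 'v \<Rightarrow> bool) \<Rightarrow> nat \<Rightarrow> 'v \<Rightarrow> complex \<Rightarrow> 'v \<Rightarrow> complex" where
  "spherical E q r z x =
     (LINT \<omega>|boundary_measure E q r.
        complex_of_real (poisson_kernel E q r x \<omega>) powr (1 / 2 + \<i> * z))"

definition spherical_transform ::
    "('v \<Rightarrow> 'v \<Rightarrow> bool) \<Rightarrow> nat \<Rightarrow> 'v \<Rightarrow> ('v \<Rightarrow> complex) \<Rightarrow> complex \<Rightarrow> complex" where
  "spherical_transform E q r k z = (\<Sum>\<^sub>\<infinity>x. k x * spherical E q r z x)"

definition strip :: "real \<Rightarrow> complex set" where
  "strip p = {z. \<bar>Im z\<bar> \<le> \<bar>1 / p - 1 / 2\<bar>}"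

section \<open>Schwartz spaces, tempered distributions and multipliers\<close>

definition schwartz_weight ::
    "('v \<Rightarrow> 'v \<Rightarrow> bool) \<Rightarrow> nat \<Rightarrow> 'v \<Rightarrow> real \<Rightarrow> nat \<Rightarrow> 'v \<Rightarrow> real" where
  "schwartz_weight E q r p m x =
     (1 + real (tree_dist E r x)) ^ m * real q powr (real (tree_dist E r x) / p)"

definition schwartz :: "('v \<Rightarrow> 'v \<Rightarrow> bool) \<Rightarrow> nat \<Rightarrow> 'v \<Rightarrow> real \<Rightarrow> ('v \<Rightarrow> complex) set" where
  "schwartz E q r p =
     {\<phi>. \<forall>m. bdd_above (range (\<lambda>x. schwartz_weight E q r p m x * cmod (\<phi> x)))}"

text \<open>The value is meaningful only where the supremum is finite, hence on \<open>schwartz E q r p\<close>.\<close>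

definition schwartz_seminorm ::
    "('v \<Rightarrow> 'v \<Rightarrow> bool) \<Rightarrow> nat \<Rightarrow> 'v \<Rightarrow> real \<Rightarrow> nat \<Rightarrow> ('v \<Rightarrow> complex) \<Rightarrow> real" where
  "schwartz_seminorm E q r p m \<phi> = (SUP x. schwartz_weight E q r p m x * cmod (\<phi> x))"

definition schwartz_topology ::
    "('v \<Rightarrow> 'v \<Rightarrow> bool) \<Rightarrow> nat \<Rightarrow> 'v \<Rightarrow> real \<Rightarrow> ('v \<Rightarrow> complex) topology" where
  "schwartz_topology E q r p =
     topology_generated_by
       {{\<psi> \<in> schwartz E q r p. schwartz_seminorm E q r p m (\<lambda>x. \<psi> x - \<phi> x) < e} |m \<phi> e.
          \<phi> \<in> schwartz E q r p \<and> 0 < e}"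

text \<open>Functionals are made extensional, so that equality of distributions in HOL is
  equality on the Schwartz space.\<close>

definition tempered :: "('v \<Rightarrow> 'v \<Rightarrow> bool) \<Rightarrow> nat \<Rightarrow> 'v \<Rightarrow> real \<Rightarrow> (('v \<Rightarrow> complex) \<Rightarrow> complex) set" where
  "tempered E q r p =
     {T \<in> extensional (schwartz E q r p).
        (\<forall>\<phi>\<in>schwartz E q r p. \<forall>\<psi>\<in>schwartz E q r p. T (\<lambda>x. \<phi> x + \<psi> x) = T \<phi> + T \<psi>) \<and>
        (\<forall>c. \<forall>\<phi>\<in>schwartz E q r p. T (\<lambda>x. c * \<phi> x) = c * T \<phi>) \<and>
        continuous_map (schwartz_topology E q r p) euclidean T}"

definition multiplier ::
    "('v \<Rightarrow> 'v \<Rightarrow> bool) \<Rightarrow> nat \<Rightarrow> 'v \<Rightarrow> real \<Rightarrow>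
     (('v \<Rightarrow> complex) \<Rightarrow> ('v \<Rightarrow> complex)) \<Rightarrow> (complex \<Rightarrow> complex) \<Rightarrow> bool" where
  "multiplier E q r p L \<kappa> \<longleftrightarrow>
     (\<exists>k. radial E r k \<and>
        (\<forall>\<phi>\<in>schwartz E q r p. L \<phi> = conv E r \<phi> k \<and> conv E r \<phi> k \<in> schwartz E q r p) \<and>
        (\<forall>m. \<exists>C>0. \<forall>\<phi>\<in>schwartz E q r p.
           schwartz_seminorm E q r p m (conv E r \<phi> k) \<le> C * schwartz_seminorm E q r p m \<phi>) \<and>
        (\<forall>z\<in>strip p. \<kappa> z = spherical_transform E q r k z))"

end

theory Submission
  imports Defs "HOL-Complex_Analysis.Complex_Analysis" "HOL-Probability.Infinite_Product_Measure"
    "HOL-Real_Asymp.Real_Asymp"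
begin

text \<open>Write \<open>w = z * ln q\<close> for the rescaled spectral parameter. The spherical functions have period
\<open>2 * pi\<close> in \<open>w\<close>, and \<open>strip p\<close> becomes the strip of half-width \<open>\<eta> = (1 / p - 1 / 2) * ln q\<close>.

Let \<open>E j\<close> be the Chebyshev polynomial of the first kind of degree \<open>\<bar>j\<bar>\<close>, evaluated at the nearest
neighbour sum divided by \<open>2 * sqrt q\<close> (\<open>chebyshev\<close>). The sum over the sphere of radius \<open>n\<close> is a fixed combination of the operators \<open>E j\<close>
(\<open>sphere_sum_chebyshev\<close>), and the total of a spherical function over the sphere of radius \<open>n\<close>
about the root is the same combination of the exponentials \<open>exp (i j w)\<close>
(\<open>spherical_sphere_total\<close>). Hence a multiplier is a series \<open>\<Lambda> = \<Sum>j. a j * E j\<close> whose symbol is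
\<open>\<Sum>j. a j * exp (i j w)\<close>, with \<open>a\<close> even and decreasing faster than \<open>exp (- \<eta> * \<bar>j\<bar>)\<close> divided by any
power of \<open>j\<close> (\<open>multiplier_series\<close>).

Fix a Schwartz function \<open>\<phi>\<close>. A functional \<open>T\<close> dominated by the seminorm of index \<open>m\<close> becomes the
sequence \<open>t j = T (E j \<phi>)\<close> on the integers, which grows at most like
\<open>exp (\<eta> * \<bar>j\<bar>) * (1 + \<bar>j\<bar>) ^ (m + 2)\<close>. By the product formula \<open>2 * E i * E j = E (i + j) + E (i - j)\<close>,
replacing \<open>T\<close> by \<open>T \<circ> \<Lambda>\<close> applies \<open>shift_operator a\<close> to this sequence
(\<open>shift_operator_functional\<close>). The tree has disappeared: the sequences \<open>t n\<close> obtained from the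
given distributions share one growth bound and satisfy \<open>shift_operator a (t (n + 1)) = A * t n\<close>.
Dividing \<open>a\<close> by \<open>A\<close> reduces the problem to \<open>A = 1\<close> and \<open>\<bar>symbol a\<bar> \<le> 1\<close> on the closed strip.

Such a sequence can be paired, through Fourier coefficients, with functions holomorphic on the
open strip that have enough bounded derivatives. Pairing \<open>t 0\<close> with \<open>1 / (symbol a - \<mu>)\<close> gives the
Carleman transform \<open>G \<mu>\<close>, which is holomorphic off the range of the symbol. Under the pairing the
shift operator is multiplication by the symbol (\<open>pairing_symbol_mult\<close>), so that \<open>G \<mu>\<close> is the power
series \<open>\<Sum>n. t (n + 1) 0 * \<mu> ^ n\<close> at every \<open>\<mu>\<close> outside that range with \<open>\<bar>\<mu>\<bar> < 1\<close>
(\<open>resolvent_pairing_power_series\<close>). Therefore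
\<open>G\<close> extends to the whole disc, and only the points \<open>c\<close> where the range meets the unit circle remain
as possible singularities. There are finitely many of them; \<open>G\<close> is \<open>O(1 / (1 - \<bar>\<mu>\<bar>))\<close> inside the circle
and grows polynomially in \<open>1 / (\<bar>\<mu>\<bar> - 1)\<close> outside, and this forces the singularities to be at most
simple poles (\<open>at_most_simple_pole\<close>). Applying \<open>shift_operator a - c\<close> for each such \<open>c\<close> multiplies \<open>G\<close>
by \<open>\<Prod>c. (\<mu> - c)\<close>, up to an entire function. The result is entire and vanishes at infinity, so it is
zero by Liouville's theorem, and the sequence so obtained vanishes at \<open>0\<close>
(\<open>shift_product_annihilates\<close>).

Since \<open>E 0\<close> is the identity and \<open>\<phi>\<close> is arbitrary, this says that the product of the operators
\<open>\<Lambda> - A i\<close> annihilates \<open>T 0\<close> (\<open>roe_annihilation\<close>). If the symbol stays below \<open>\<bar>A\<bar>\<close>, the product is empty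
and \<open>T 0 = 0\<close>. Otherwise partial fractions split \<open>T 0\<close> into eigenfunctionals
(\<open>eigenfunctional_decomposition\<close>), and eigenfunctionals with different eigenvalues are linearly
independent, which gives uniqueness (\<open>eigenfunctionals_independent\<close>).\<close>

section \<open>Fourier coefficients of periodic functions on a strip\<close>

definition open_strip :: "real \<Rightarrow> complex set" where
  "open_strip \<eta> = {z. \<bar>Im z\<bar> < \<eta>}"

definition closed_strip :: "real \<Rightarrow> complex set" where
  "closed_strip \<eta> = {z. \<bar>Im z\<bar> \<le> \<eta>}"

definition expi :: "int \<Rightarrow> complex \<Rightarrow> complex" where
  "expi j z = exp (\<i> * of_int j * z)"

definition weight :: "real \<Rightarrow> nat \<Rightarrow> int \<Rightarrow> real" where
  "weight \<eta> s j = exp (\<eta> * \<bar>real_of_int j\<bar>) * (1 + \<bar>real_of_int j\<bar>) ^ s"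

text \<open>No boundary values are assumed; a bound on the derivatives that is uniform up to the edge of the
strip is enough for the Fourier coefficients to decay at the rate that belongs to the closed strip.\<close>

definition strip_bounded :: "real \<Rightarrow> nat \<Rightarrow> real \<Rightarrow> (complex \<Rightarrow> complex) \<Rightarrow> bool" where
  "strip_bounded \<eta> N B h \<longleftrightarrow>
     h holomorphic_on open_strip \<eta> \<and>
     (\<forall>z\<in>open_strip \<eta>. h (z + 2 * of_real pi) = h z) \<and>
     (\<forall>l\<le>N. \<forall>z\<in>open_strip \<eta>. cmod ((deriv ^^ l) h z) \<le> B)"

definition mean :: "(complex \<Rightarrow> complex) \<Rightarrow> complex" where
  "mean h = contour_integral (linepath 0 (2 * of_real pi)) h / (2 * of_real pi)"

definition fourier_coeff :: "(complex \<Rightarrow> complex) \<Rightarrow> int \<Rightarrow> complex" where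
  "fourier_coeff h j = mean (\<lambda>z. h z * expi (- j) z)"

lemma open_open_strip [simp]: "open (open_strip \<eta>)"
  unfolding open_strip_def by (intro open_Collect_less continuous_intros)

lemma convex_open_strip [simp]: "convex (open_strip \<eta>)"
proof -
  have "open_strip \<eta> = {z. Im z < \<eta>} \<inter> {z. Im z > - \<eta>}"
    by (auto simp: open_strip_def)
  then show ?thesis
    by (simp add: convex_Int convex_halfspace_Im_lt convex_halfspace_Im_gt)
qed

lemma open_strip_subset: "open_strip \<eta> \<subseteq> closed_strip \<eta>"
  by (auto simp: open_strip_def closed_strip_def)

lemma open_strip_shift [simp]: "z + 2 * of_real pi \<in> open_strip \<eta> \<longleftrightarrow> z \<in> open_strip \<eta>"
  by (simp add: open_strip_def)

lemma horizontal_segment_in_open_strip: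
  "\<bar>y\<bar> < \<eta> \<Longrightarrow> closed_segment (\<i> * of_real y) (\<i> * of_real y + 2 * of_real pi) \<subseteq> open_strip \<eta>"
  by (intro closed_segment_subset convex_open_strip) (auto simp: open_strip_def)

lemma Im_horizontal_segment:
  assumes "z \<in> closed_segment (\<i> * of_real y) (\<i> * of_real y + 2 * of_real pi)"
  shows "Im z = y"
proof -
  have "Im z \<in> closed_segment (Im (\<i> * of_real y)) (Im (\<i> * of_real y + 2 * of_real pi))"
    using assms by (rule in_closed_segment_imp_Im_in_closed_segment)
  then show ?thesis by simp
qed

lemma holomorphic_expi [holomorphic_intros]: "expi j holomorphic_on S"
  unfolding expi_def by (intro holomorphic_intros)

lemma continuous_on_expi [continuous_intros]: "continuous_on S (expi j)"
  by (intro holomorphic_on_imp_continuous_on holomorphic_intros)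

lemma expi_add: "expi (i + j) z = expi i z * expi j z"
  by (simp add: expi_def exp_add [symmetric] algebra_simps)

lemma expi_0 [simp]: "expi 0 z = 1"
  by (simp add: expi_def)

lemma norm_expi: "cmod (expi j z) = exp (- real_of_int j * Im z)"
  by (simp add: expi_def)

lemma expi_shift: "expi j (z + 2 * of_real pi) = expi j z"
  using exp_integer_2pi[of "of_int j"] by (simp add: expi_def exp_add algebra_simps)

lemma norm_expi_le:
  assumes "z \<in> closed_strip \<eta>" shows "cmod (expi j z) \<le> exp (\<eta> * \<bar>real_of_int j\<bar>)"
proof -
  have "- real_of_int j * Im z \<le> \<bar>real_of_int j\<bar> * \<bar>Im z\<bar>"
    by (metis abs_ge_self abs_minus_cancel abs_mult)
  also have "\<dots> \<le> \<bar>real_of_int j\<bar> * \<eta>"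
    using assms by (intro mult_left_mono) (auto simp: closed_strip_def)
  finally show ?thesis by (simp add: norm_expi mult.commute)
qed

text \<open>The contour can be moved to any height in the strip. A primitive \<open>H\<close> of \<open>h\<close> exists on the convex
strip, and by periodicity of \<open>h\<close> the increment \<open>H (z + 2 * pi) - H z\<close> has derivative zero.\<close>

lemma mean_height:
  assumes "h holomorphic_on open_strip \<eta>" and "\<And>z. z \<in> open_strip \<eta> \<Longrightarrow> h (z + 2 * of_real pi) = h z"
    and "\<bar>y\<bar> < \<eta>"
  shows "(h has_contour_integral (2 * of_real pi * mean h))
           (linepath (\<i> * of_real y) (\<i> * of_real y + 2 * of_real pi))"
proof -
  define S where "S = open_strip \<eta>"
  have S: "open S" "convex S" by (auto simp: S_def)
  obtain H where H: "\<And>x. x \<in> S \<Longrightarrow> (H has_field_derivative h x) (at x)"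
    using holomorphic_convex_primitive'[of S h] S assms(1) at_within_open
    unfolding S_def by metis
  have ci: "(h has_contour_integral H (\<i> * of_real y + 2 * of_real pi) - H (\<i> * of_real y))
           (linepath (\<i> * of_real y) (\<i> * of_real y + 2 * of_real pi))" if "\<bar>y\<bar> < \<eta>" for y
  proof -
    have "(h has_contour_integral (H (pathfinish (linepath (\<i> * of_real y) (\<i> * of_real y + 2 * of_real pi))) -
             H (pathstart (linepath (\<i> * of_real y) (\<i> * of_real y + 2 * of_real pi)))))
           (linepath (\<i> * of_real y) (\<i> * of_real y + 2 * of_real pi))"
      by (rule contour_integral_primitive[of S])
        (use H horizontal_segment_in_open_strip[OF that] in \<open>auto simp: S_def intro: has_field_derivative_at_within\<close>)
    then show ?thesis by simp
  qed
  define D where "D = (\<lambda>z. H (z + 2 * of_real pi) - H z)"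
  have "(D has_field_derivative 0) (at z within S)" if "z \<in> S" for z
  proof -
    have "((\<lambda>w. H (w + 2 * of_real pi)) has_field_derivative h (z + 2 * of_real pi)) (at z)"
      using H[of "z + 2 * of_real pi"] that
      by (simp add: S_def DERIV_shift)
    then have "(D has_field_derivative (h (z + 2 * of_real pi) - h z)) (at z)"
      unfolding D_def using H[OF that] by (intro derivative_intros) auto
    then show ?thesis using assms(2) that
      by (auto simp: S_def intro: has_field_derivative_at_within)
  qed
  then obtain c where c: "\<And>z. z \<in> S \<Longrightarrow> D z = c"
    using has_field_derivative_zero_constant[OF S(2), of D] by auto
  have "0 < \<eta>" using assms(3) by simp
  then have "D 0 = c" "D (\<i> * of_real y) = c"
    using c assms(3) by (auto simp: S_def open_strip_def)
  moreover have "contour_integral (linepath 0 (2 * of_real pi)) h = D 0"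
    using ci[of 0] \<open>0 < \<eta>\<close> by (simp add: D_def contour_integral_unique)
  ultimately show ?thesis
    using ci[OF assms(3)] by (simp add: mean_def D_def)
qed

lemma mean_bound:
  assumes "h holomorphic_on open_strip \<eta>" and "\<And>z. z \<in> open_strip \<eta> \<Longrightarrow> h (z + 2 * of_real pi) = h z"
    and "\<bar>y\<bar> < \<eta>" and "\<And>z. Im z = y \<Longrightarrow> cmod (h z) \<le> B"
  shows "cmod (mean h) \<le> B"
proof -
  have "0 \<le> B" using assms(4)[of "\<i> * of_real y"] norm_ge_zero
    by (metis Im_i_times Re_complex_of_real order_trans)
  then have "cmod (2 * of_real pi * mean h) \<le> B * cmod (\<i> * of_real y + 2 * of_real pi - \<i> * of_real y)"
    by (intro has_contour_integral_bound_linepath[OF mean_height[OF assms(1-3)]] assms(4) Im_horizontal_segment)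
  then show ?thesis by (simp add: norm_mult)
qed

lemma mean_lincomb:
  assumes "continuous_on (open_strip \<eta>) f" "continuous_on (open_strip \<eta>) g" and "0 < \<eta>"
  shows "mean (\<lambda>z. c * f z + d * g z) = c * mean f + d * mean g"
proof -
  have seg: "closed_segment 0 (2 * of_real pi) \<subseteq> open_strip \<eta>"
    using horizontal_segment_in_open_strip[of 0 \<eta>] assms(3) by simp
  have "f contour_integrable_on linepath 0 (2 * of_real pi)" "g contour_integrable_on linepath 0 (2 * of_real pi)"
    using assms seg by (auto intro!: contour_integrable_continuous_linepath intro: continuous_on_subset)
  then show ?thesis
    by (simp add: mean_def contour_integral_add contour_integral_lmul contour_integrable_lmul add_divide_distrib)
qed

lemma mean_uniform_limit:
  assumes "uniform_limit (closed_segment 0 (2 * of_real pi)) f g F" "F \<noteq> bot"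
    and "\<And>n. continuous_on (closed_segment 0 (2 * of_real pi)) (f n)"
  shows "((\<lambda>n. mean (f n)) \<longlongrightarrow> mean g) F"
proof -
  have u: "uniform_limit (path_image (linepath 0 (2 * of_real pi))) f g F" using assms(1) by simp
  have c: "continuous_on (path_image (linepath 0 (2 * of_real pi))) (f n)" for n
    using assms(3) by simp
  obtain I J where I: "\<And>n. (f n has_contour_integral I n) (linepath 0 (2 * of_real pi))"
    and J: "(g has_contour_integral J) (linepath 0 (2 * of_real pi))" and "(I \<longlongrightarrow> J) F"
    using uniform_limit_contour_integral_linepath[OF u c assms(2)] by blast
  then show ?thesis
    unfolding mean_def contour_integral_unique[OF I] contour_integral_unique[OF J]
    by (intro tendsto_intros) auto
qed

lemma mean_deriv:
  assumes "h holomorphic_on open_strip \<eta>" and "\<And>z. z \<in> open_strip \<eta> \<Longrightarrow> h (z + 2 * of_real pi) = h z"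
    and "0 < \<eta>" and "\<And>z. z \<in> open_strip \<eta> \<Longrightarrow> (h has_field_derivative h' z) (at z)"
  shows "mean h' = 0"
proof -
  have "(h' has_contour_integral (h (pathfinish (linepath 0 (2 * of_real pi))) - h (pathstart (linepath 0 (2 * of_real pi)))))
          (linepath 0 (2 * of_real pi))"
    using assms horizontal_segment_in_open_strip[of 0 \<eta>]
    by (intro contour_integral_primitive[of "open_strip \<eta>"] valid_path_linepath)
      (auto intro: has_field_derivative_at_within simp del: linepath_0)
  moreover have "h (2 * of_real pi) = h 0"
    using assms(2)[of 0] assms(3) by (simp add: open_strip_def)
  ultimately show ?thesis by (simp add: mean_def contour_integral_unique)
qed

lemma deriv_periodic:
  assumes "h holomorphic_on open_strip \<eta>" and "\<And>z. z \<in> open_strip \<eta> \<Longrightarrow> h (z + 2 * of_real pi) = h z"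
    and z: "z \<in> open_strip \<eta>"
  shows "deriv h (z + 2 * of_real pi) = deriv h z"
proof -
  have "(h has_field_derivative deriv h (z + 2 * of_real pi)) (at (z + 2 * of_real pi))"
    using assms by (intro holomorphic_derivI[of _ "open_strip \<eta>"]) auto
  then have "((\<lambda>w. h (w + 2 * of_real pi)) has_field_derivative deriv h (z + 2 * of_real pi)) (at z)"
    by (simp add: DERIV_shift)
  then have "(h has_field_derivative deriv h (z + 2 * of_real pi)) (at z)"
    by (rule has_field_derivative_transform_within_open[of _ _ _ "open_strip \<eta>"]) (use assms in auto)
  then show ?thesis by (rule DERIV_imp_deriv [symmetric])
qed

lemma strip_bounded_deriv:
  assumes "strip_bounded \<eta> (Suc N) B h" shows "strip_bounded \<eta> N B (deriv h)"
  unfolding strip_bounded_def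
proof (intro conjI ballI allI impI)
  show "deriv h holomorphic_on open_strip \<eta>"
    using assms by (auto simp: strip_bounded_def intro: holomorphic_deriv)
  show "deriv h (z + 2 * of_real pi) = deriv h z" if "z \<in> open_strip \<eta>" for z
    using assms that by (intro deriv_periodic) (auto simp: strip_bounded_def)
  show "cmod ((deriv ^^ l) (deriv h) z) \<le> B" if "l \<le> N" "z \<in> open_strip \<eta>" for l z
    using assms that unfolding strip_bounded_def
    by (metis Suc_le_mono comp_apply funpow_Suc_right)
qed

lemma fourier_coeff_deriv:
  assumes "h holomorphic_on open_strip \<eta>" and "\<And>z. z \<in> open_strip \<eta> \<Longrightarrow> h (z + 2 * of_real pi) = h z"
    and "0 < \<eta>"
  shows "fourier_coeff (deriv h) j = \<i> * of_int j * fourier_coeff h j"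
proof -
  let ?g = "\<lambda>z. h z * expi (- j) z"
  let ?g' = "\<lambda>z. 1 * (deriv h z * expi (- j) z) + (- \<i> * of_int j) * (h z * expi (- j) z)"
  have "(?g has_field_derivative ?g' z) (at z)" if "z \<in> open_strip \<eta>" for z
  proof -
    have "(h has_field_derivative deriv h z) (at z)"
      using assms that by (intro holomorphic_derivI[of _ "open_strip \<eta>"]) auto
    moreover have "(expi (- j) has_field_derivative (- \<i> * of_int j) * expi (- j) z) (at z)"
      unfolding expi_def by (auto intro!: derivative_eq_intros)
    ultimately show ?thesis by (auto intro!: derivative_eq_intros simp: algebra_simps)
  qed
  then have "mean ?g' = 0"
    using assms by (intro mean_deriv[of ?g \<eta>]) (auto intro!: holomorphic_intros simp: expi_shift)
  moreover have "mean ?g' = 1 * mean (\<lambda>z. deriv h z * expi (- j) z) + (- \<i> * of_int j) * mean ?g"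
    using assms by (intro mean_lincomb[of \<eta>] holomorphic_on_imp_continuous_on holomorphic_intros) auto
  ultimately show ?thesis by (simp add: fourier_coeff_def)
qed

text \<open>The mean is taken at a height \<open>- sgn j * y\<close>, where the factor \<open>expi (- j)\<close> is small; then \<open>y\<close> tends
to \<open>\<eta>\<close>.\<close>

lemma fourier_coeff_le:
  assumes "strip_bounded \<eta> N B h" "0 < \<eta>"
  shows "cmod (fourier_coeff h j) * exp (\<eta> * \<bar>real_of_int j\<bar>) \<le> B"
proof -
  let ?y = "\<lambda>y. - sgn (real_of_int j) * y"
  have *: "cmod (fourier_coeff h j) \<le> B * exp (- (y * \<bar>real_of_int j\<bar>))" if y: "0 \<le> y" "y < \<eta>" for y
    unfolding fourier_coeff_def
  proof (rule mean_bound[of _ \<eta> "?y y"])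
    show "\<bar>?y y\<bar> < \<eta>" using y assms(2) by (auto simp: abs_mult abs_sgn_eq)
    show "cmod (h z * expi (- j) z) \<le> B * exp (- (y * \<bar>real_of_int j\<bar>))" if "Im z = ?y y" for z
    proof -
      have z: "z \<in> open_strip \<eta>" using that \<open>\<bar>?y y\<bar> < \<eta>\<close> by (simp add: open_strip_def)
      then have "cmod ((deriv ^^ 0) h z) \<le> B" using assms(1) unfolding strip_bounded_def by blast
      moreover have "cmod (expi (- j) z) = exp (- (y * \<bar>real_of_int j\<bar>))"
        unfolding norm_expi that by (simp add: abs_sgn mult.commute)
      ultimately show ?thesis by (simp add: norm_mult)
    qed
  qed (use assms in \<open>auto simp: strip_bounded_def expi_shift intro!: holomorphic_intros\<close>)
  have "((\<lambda>y. B * exp (- (y * \<bar>real_of_int j\<bar>))) \<longlongrightarrow> B * exp (- (\<eta> * \<bar>real_of_int j\<bar>))) (at_left \<eta>)"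
    by (intro tendsto_intros)
  moreover have "eventually (\<lambda>y. cmod (fourier_coeff h j) \<le> B * exp (- (y * \<bar>real_of_int j\<bar>))) (at_left \<eta>)"
    using * eventually_at_left_real[OF assms(2)] by (auto elim!: eventually_mono)
  ultimately have "cmod (fourier_coeff h j) \<le> B * exp (- (\<eta> * \<bar>real_of_int j\<bar>))"
    by (intro tendsto_lowerbound) auto
  then show ?thesis by (simp add: exp_minus field_simps)
qed

lemma fourier_coeff_decay_power:
  assumes "strip_bounded \<eta> N B h" "0 < \<eta>"
  shows "cmod (fourier_coeff h j) * \<bar>real_of_int j\<bar> ^ N * exp (\<eta> * \<bar>real_of_int j\<bar>) \<le> B"
  using assms(1)
proof (induction N arbitrary: h)
  case 0
  then show ?case using fourier_coeff_le[OF 0 assms(2)] by simp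
next
  case (Suc N)
  have "fourier_coeff (deriv h) j = \<i> * of_int j * fourier_coeff h j"
    using Suc.prems assms(2) by (intro fourier_coeff_deriv) (auto simp: strip_bounded_def)
  then have "cmod (fourier_coeff (deriv h) j) = \<bar>real_of_int j\<bar> * cmod (fourier_coeff h j)"
    by (simp add: norm_mult)
  then show ?case using Suc.IH[OF strip_bounded_deriv[OF Suc.prems]] by (simp add: mult_ac)
qed

text \<open>Each derivative multiplies the coefficient of index \<open>j\<close> by \<open>\<i> * j\<close>, so \<open>N\<close> bounded derivatives give
\<open>N\<close> powers of \<open>j\<close>. The factor \<open>2 ^ N\<close> pays for replacing \<open>\<bar>j\<bar>\<close> by \<open>1 + \<bar>j\<bar>\<close>, and for \<open>j = 0\<close> the plain
bound suffices.\<close>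

lemma fourier_coeff_decay:
  assumes "strip_bounded \<eta> N B h" "0 < \<eta>"
  shows "cmod (fourier_coeff h j) * weight \<eta> N j \<le> 2 ^ N * B"
proof (cases "j = 0")
  case True
  have "0 \<le> cmod (fourier_coeff h j) * exp (\<eta> * \<bar>real_of_int j\<bar>)" by simp
  then have "0 \<le> B" using fourier_coeff_le[OF assms, of j] by linarith
  then have "B \<le> 2 ^ N * B" by (simp add: mult_le_cancel_right1)
  then show ?thesis using fourier_coeff_le[OF assms, of j] True by (simp add: weight_def)
next
  case False
  then have "1 \<le> \<bar>real_of_int j\<bar>"
    using False by linarith
  then have "(1 + \<bar>real_of_int j\<bar>) ^ N \<le> (2 * \<bar>real_of_int j\<bar>) ^ N"
    by (intro power_mono) auto
  then have "cmod (fourier_coeff h j) * weight \<eta> N j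
      \<le> cmod (fourier_coeff h j) * (exp (\<eta> * \<bar>real_of_int j\<bar>) * (2 ^ N * \<bar>real_of_int j\<bar> ^ N))"
    unfolding weight_def by (intro mult_left_mono) (auto simp: power_mult_distrib)
  also have "\<dots> = 2 ^ N * (cmod (fourier_coeff h j) * \<bar>real_of_int j\<bar> ^ N * exp (\<eta> * \<bar>real_of_int j\<bar>))"
    by simp
  also have "\<dots> \<le> 2 ^ N * B"
    by (intro mult_left_mono fourier_coeff_decay_power assms) auto
  finally show ?thesis .
qed

section \<open>Pairing sequences with functions on the strip\<close>

text \<open>A sequence \<open>t\<close> is regarded as the functional with value \<open>t j\<close> at the exponential \<open>expi j\<close>, extended to
other functions along their Fourier series.\<close>

definition pairing :: "(int \<Rightarrow> complex) \<Rightarrow> (complex \<Rightarrow> complex) \<Rightarrow> complex" where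
  "pairing t h = (\<Sum>\<^sub>\<infinity>j. t j * fourier_coeff h j)"

definition symbol :: "(int \<Rightarrow> complex) \<Rightarrow> complex \<Rightarrow> complex" where
  "symbol a z = (\<Sum>\<^sub>\<infinity>j. a j * expi j z)"

text \<open>The transpose, under the pairing, of multiplication by \<open>symbol a\<close>.\<close>

definition shift_operator :: "(int \<Rightarrow> complex) \<Rightarrow> (int \<Rightarrow> complex) \<Rightarrow> int \<Rightarrow> complex" where
  "shift_operator a t j = (\<Sum>\<^sub>\<infinity>i. a i * t (i + j))"

definition rapid :: "real \<Rightarrow> (int \<Rightarrow> complex) \<Rightarrow> bool" where
  "rapid \<eta> a \<longleftrightarrow> (\<forall>s. (\<lambda>j. cmod (a j) * weight \<eta> s j) summable_on UNIV)"

lemma weight_pos [simp]: "0 < weight \<eta> s j"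
  unfolding weight_def by (intro mult_pos_pos zero_less_power) auto

lemma weight_ge_0 [simp]: "0 \<le> weight \<eta> s j"
  by (rule less_imp_le) simp

lemma weight_0 [simp]: "weight \<eta> s 0 = 1"
  by (simp add: weight_def)

lemma weight_add_le:
  assumes "0 \<le> \<eta>" shows "weight \<eta> s (i + j) \<le> weight \<eta> s i * weight \<eta> s j"
proof -
  have "exp (\<eta> * \<bar>real_of_int (i + j)\<bar>) \<le> exp (\<eta> * \<bar>real_of_int i\<bar>) * exp (\<eta> * \<bar>real_of_int j\<bar>)"
    unfolding exp_add [symmetric] exp_le_cancel_iff distrib_left [symmetric]
    using assms by (intro mult_left_mono) auto
  moreover have "(1 + \<bar>real_of_int (i + j)\<bar>) ^ s \<le> ((1 + \<bar>real_of_int i\<bar>) * (1 + \<bar>real_of_int j\<bar>)) ^ s"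
  proof (rule power_mono)
    have "1 + \<bar>real_of_int (i + j)\<bar> \<le> 1 + \<bar>real_of_int i\<bar> + \<bar>real_of_int j\<bar>" by simp
    also have "\<dots> \<le> (1 + \<bar>real_of_int i\<bar>) * (1 + \<bar>real_of_int j\<bar>)" by (simp add: algebra_simps)
    finally show "1 + \<bar>real_of_int (i + j)\<bar> \<le> (1 + \<bar>real_of_int i\<bar>) * (1 + \<bar>real_of_int j\<bar>)" .
  qed simp
  ultimately have "weight \<eta> s (i + j) \<le> (exp (\<eta> * \<bar>real_of_int i\<bar>) * exp (\<eta> * \<bar>real_of_int j\<bar>)) *
      ((1 + \<bar>real_of_int i\<bar>) * (1 + \<bar>real_of_int j\<bar>)) ^ s"
    unfolding weight_def by (intro mult_mono) auto
  then show ?thesis by (simp add: weight_def power_mult_distrib mult_ac)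
qed

lemma exp_le_weight: "exp (\<eta> * \<bar>real_of_int j\<bar>) \<le> weight \<eta> s j"
  unfolding weight_def by (simp add: mult_le_cancel_left1)

lemma weight_Suc: "weight \<eta> (s + n) j = weight \<eta> s j * (1 + \<bar>real_of_int j\<bar>) ^ n"
  by (simp add: weight_def power_add)

lemma summable_inverse_square_int: "(\<lambda>j::int. 1 / (1 + \<bar>real_of_int j\<bar>) ^ 2) summable_on UNIV"
proof -
  have "summable (\<lambda>n. inverse (real (Suc n) ^ 2))"
    by (subst summable_Suc_iff[of "\<lambda>n. inverse (real n ^ 2)"]) (rule inverse_power_summable, simp)
  then have "(\<lambda>n. 1 / (1 + real n) ^ 2) summable_on UNIV"
    by (intro norm_summable_imp_summable_on) (simp add: field_simps)
  then have nat: "((\<lambda>j. 1 / (1 + \<bar>real_of_int j\<bar>) ^ 2) \<circ> int) summable_on UNIV"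
      "((\<lambda>j. 1 / (1 + \<bar>real_of_int j\<bar>) ^ 2) \<circ> (\<lambda>n. - int n)) summable_on UNIV"
    by (simp_all add: o_def)
  have "(\<lambda>j::int. 1 / (1 + \<bar>real_of_int j\<bar>) ^ 2) summable_on (range int)"
    using nat(1) by (subst summable_on_reindex) auto
  moreover have "(\<lambda>j::int. 1 / (1 + \<bar>real_of_int j\<bar>) ^ 2) summable_on (range (\<lambda>n. - int n))"
    using nat(2) by (subst summable_on_reindex) (auto simp: inj_on_def)
  moreover have "range int \<union> range (\<lambda>n. - int n) = UNIV"
  proof -
    have "j \<in> range int \<union> range (\<lambda>n. - int n)" for j :: int
      by (cases j rule: int_cases2) (blast intro: rangeI)+
    then show ?thesis by blast
  qed
  ultimately show ?thesis using summable_on_union[of _ "range int" "range (\<lambda>n. - int n)"] by simp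
qed

definition inverse_square_total :: real where
  "inverse_square_total = (\<Sum>\<^sub>\<infinity>j::int. 1 / (1 + \<bar>real_of_int j\<bar>) ^ 2)"

lemma inverse_square_total_ge_0: "0 \<le> inverse_square_total"
  unfolding inverse_square_total_def by (rule infsum_nonneg) auto

text \<open>Two derivatives beyond those consumed by the growth of \<open>t\<close> leave a summable factor. This is where
the order \<open>s + 2\<close> in the estimates below comes from.\<close>

lemma pairing_term_le:
  assumes "\<And>j. cmod (t j) \<le> C * weight \<eta> s j" and "strip_bounded \<eta> (s + 2) B h" and "0 < \<eta>"
  shows "cmod (t j * fourier_coeff h j) \<le> C * 2 ^ (s + 2) * B * (1 / (1 + \<bar>real_of_int j\<bar>) ^ 2)"
proof -
  have C: "0 \<le> C" using assms(1)[of 0] norm_ge_zero[of "t 0"] by (simp del: norm_ge_zero)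
  have "cmod (t j * fourier_coeff h j) \<le> C * weight \<eta> s j * cmod (fourier_coeff h j)"
    using assms(1) by (simp add: norm_mult mult_right_mono)
  also have "\<dots> = C * (cmod (fourier_coeff h j) * weight \<eta> (s + 2) j) * (1 / (1 + \<bar>real_of_int j\<bar>) ^ 2)"
    unfolding weight_Suc[of \<eta> s 2] by (simp add: field_simps add_nonneg_eq_0_iff)
  also have "\<dots> \<le> C * (2 ^ (s + 2) * B) * (1 / (1 + \<bar>real_of_int j\<bar>) ^ 2)"
    using C assms by (intro mult_right_mono mult_left_mono fourier_coeff_decay) auto
  finally show ?thesis by (simp add: mult_ac)
qed

lemma pairing_abs_summable:
  assumes "\<And>j. cmod (t j) \<le> C * weight \<eta> s j" and "strip_bounded \<eta> (s + 2) B h" and "0 < \<eta>"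
  shows "(\<lambda>j. cmod (t j * fourier_coeff h j)) summable_on UNIV"
  by (rule Infinite_Sum.abs_summable_on_comparison_test'
        [OF summable_on_cmult_right[OF summable_inverse_square_int] pairing_term_le[OF assms]])

lemma pairing_bound:
  assumes "\<And>j. cmod (t j) \<le> C * weight \<eta> s j" and "strip_bounded \<eta> (s + 2) B h" and "0 < \<eta>"
  shows "cmod (pairing t h) \<le> C * 2 ^ (s + 2) * B * inverse_square_total"
proof -
  have "cmod (pairing t h) \<le> (\<Sum>\<^sub>\<infinity>j::int. C * 2 ^ (s + 2) * B * (1 / (1 + \<bar>real_of_int j\<bar>) ^ 2))"
    unfolding pairing_def
    by (rule norm_infsum_le[OF has_sum_infsum[OF abs_summable_summable[OF pairing_abs_summable[OF assms]]]
          has_sum_infsum[OF summable_on_cmult_right[OF summable_inverse_square_int]] pairing_term_le[OF assms]])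
  then show ?thesis
    by (simp only: infsum_cmult_right' inverse_square_total_def)
qed

lemma strip_bounded_continuous: "strip_bounded \<eta> N B h \<Longrightarrow> continuous_on (open_strip \<eta>) h"
  by (auto simp: strip_bounded_def intro: holomorphic_on_imp_continuous_on)

lemma fourier_coeff_lincomb:
  assumes "strip_bounded \<eta> N B f" "strip_bounded \<eta> N' B' g" "0 < \<eta>"
  shows "fourier_coeff (\<lambda>z. c * f z + d * g z) j = c * fourier_coeff f j + d * fourier_coeff g j"
proof -
  have "mean (\<lambda>z. c * (f z * expi (- j) z) + d * (g z * expi (- j) z)) =
      c * mean (\<lambda>z. f z * expi (- j) z) + d * mean (\<lambda>z. g z * expi (- j) z)"
    by (intro mean_lincomb[of \<eta>] continuous_on_mult continuous_on_expi
        strip_bounded_continuous[OF assms(1)] strip_bounded_continuous[OF assms(2)] assms(3))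
  then show ?thesis by (simp add: fourier_coeff_def algebra_simps)
qed

lemma pairing_lincomb:
  assumes "\<And>j. cmod (t j) \<le> C * weight \<eta> s j" "0 < \<eta>"
    and "strip_bounded \<eta> (s + 2) B f" "strip_bounded \<eta> (s + 2) B' g" 
  shows "pairing t (\<lambda>z. c * f z + d * g z) = c * pairing t f + d * pairing t g"
proof -
  have "pairing t (\<lambda>z. c * f z + d * g z) =
      (\<Sum>\<^sub>\<infinity>j. c * (t j * fourier_coeff f j) + d * (t j * fourier_coeff g j))"
    unfolding pairing_def fourier_coeff_lincomb[OF assms(3,4,2)] by (simp add: algebra_simps)
  also have "\<dots> = (\<Sum>\<^sub>\<infinity>j. c * (t j * fourier_coeff f j)) + (\<Sum>\<^sub>\<infinity>j. d * (t j * fourier_coeff g j))"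
    by (intro infsum_add summable_on_cmult_right abs_summable_summable[OF pairing_abs_summable[OF assms(1,3,2)]]
        abs_summable_summable[OF pairing_abs_summable[OF assms(1,4,2)]])
  finally show ?thesis by (simp only: pairing_def infsum_cmult_right')
qed

lemma higher_deriv_constant: "(deriv ^^ n) (\<lambda>_. c) = (\<lambda>_::complex. if n = 0 then c else 0)"
  by (induction n) auto

lemma strip_bounded_const: "strip_bounded \<eta> N (cmod c) (\<lambda>_. c)"
  by (auto simp: strip_bounded_def higher_deriv_constant)

lemma mean_const: "mean (\<lambda>_. c) = c"
  using contour_integral_unique[OF has_contour_integral_const_linepath[of c "2 * of_real pi" 0]]
  by (simp add: mean_def)

lemma fourier_coeff_const: "fourier_coeff (\<lambda>_. c) j = (if j = 0 then c else 0)"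
proof (cases "j = 0")
  case True
  then show ?thesis by (simp add: fourier_coeff_def mean_const)
next
  case False
  have "fourier_coeff (deriv (\<lambda>_. c)) j = \<i> * of_int j * fourier_coeff (\<lambda>_. c) j"
    by (rule fourier_coeff_deriv[of _ 1]) auto
  moreover have "deriv (\<lambda>_. c) = (\<lambda>_::complex. 0)" by auto
  ultimately show ?thesis using False by (simp add: fourier_coeff_def mean_const)
qed

lemma pairing_const: "pairing t (\<lambda>_. c) = c * t 0"
proof -
  have "pairing t (\<lambda>_. c) = (\<Sum>\<^sub>\<infinity>j\<in>{0}. t j * fourier_coeff (\<lambda>_. c) j)"
    unfolding pairing_def by (rule infsum_cong_neutral) (auto simp: fourier_coeff_const)
  then show ?thesis by (simp add: fourier_coeff_const)
qed

lemma strip_bounded_nonneg: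
  assumes "strip_bounded \<eta> N B h" "0 < \<eta>" shows "0 \<le> B"
proof -
  have "cmod ((deriv ^^ 0) h 0) \<le> B"
    using assms unfolding strip_bounded_def open_strip_def by force
  then show ?thesis using norm_ge_zero order_trans by blast
qed

text \<open>Leibniz's rule; the binomial coefficients of order \<open>l \<le> N\<close> add up to at most \<open>2 ^ N\<close>.\<close>

lemma strip_bounded_mult:
  assumes f: "strip_bounded \<eta> N A f" and g: "strip_bounded \<eta> N B g" and "0 < \<eta>"
  shows "strip_bounded \<eta> N (2 ^ N * (A * B)) (\<lambda>z. f z * g z)"
  unfolding strip_bounded_def
proof (intro conjI ballI allI impI)
  have A: "0 \<le> A" and B: "0 \<le> B"
    using strip_bounded_nonneg[OF f \<open>0 < \<eta>\<close>] strip_bounded_nonneg[OF g \<open>0 < \<eta>\<close>] .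
  show "(\<lambda>z. f z * g z) holomorphic_on open_strip \<eta>"
    using f g by (auto simp: strip_bounded_def intro: holomorphic_intros)
  show "f (z + 2 * of_real pi) * g (z + 2 * of_real pi) = f z * g z" if "z \<in> open_strip \<eta>" for z
    using that f g by (auto simp: strip_bounded_def)
  show "cmod ((deriv ^^ l) (\<lambda>z. f z * g z) z) \<le> 2 ^ N * (A * B)" if "l \<le> N" "z \<in> open_strip \<eta>" for l z
  proof -
    have "(deriv ^^ l) (\<lambda>z. f z * g z) z =
        (\<Sum>i = 0..l. of_nat (l choose i) * (deriv ^^ i) f z * (deriv ^^ (l - i)) g z)"
      using f g that by (intro higher_deriv_mult[of _ "open_strip \<eta>"]) (auto simp: strip_bounded_def)
    also have "cmod \<dots> \<le> (\<Sum>i = 0..l. real (l choose i) * (A * B))"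
    proof (rule sum_norm_le)
      fix i assume "i \<in> {0..l}"
      then have "cmod ((deriv ^^ i) f z) \<le> A" "cmod ((deriv ^^ (l - i)) g z) \<le> B"
        using f g that by (auto simp: strip_bounded_def)
      then show "cmod (of_nat (l choose i) * (deriv ^^ i) f z * (deriv ^^ (l - i)) g z) \<le> real (l choose i) * (A * B)"
        using A by (simp add: norm_mult mult.assoc mult_left_mono mult_mono)
    qed
    also have "\<dots> = 2 ^ l * (A * B)"
    proof -
      have "(\<Sum>i = 0..l. real (l choose i)) = real (\<Sum>i\<le>l. l choose i)"
        by (simp add: atLeast0AtMost)
      then show ?thesis
        unfolding sum_distrib_right [symmetric] choose_row_sum by simp
    qed
    also have "\<dots> \<le> 2 ^ N * (A * B)"
      using A B that by (intro mult_right_mono power_increasing) auto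
    finally show ?thesis .
  qed
qed

section \<open>Resolvents and symbols\<close>

text \<open>By Leibniz's rule, differentiating \<open>(f - \<mu>) * (1 / (f - \<mu>)) = 1\<close> expresses the highest derivative of
the resolvent through the lower ones, at the cost of one more factor \<open>1 / d\<close>. It matters that \<open>C\<close> is
the same for all \<open>\<mu>\<close>: the resulting polynomial growth in \<open>1 / d\<close> bounds the order of the singularities
of the Carleman transform.\<close>

lemma strip_bounded_inverse_diff:
  assumes f: "strip_bounded \<eta> N B f" and "0 < \<eta>"
  obtains C where "0 \<le> C"
    "\<And>\<mu> d. 0 < d \<Longrightarrow> (\<And>z. z \<in> open_strip \<eta> \<Longrightarrow> d \<le> cmod (f z - \<mu>)) \<Longrightarrow>
       strip_bounded \<eta> N (C * (1 / d) * (1 + 1 / d) ^ N) (\<lambda>z. 1 / (f z - \<mu>))"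
proof -
  have B: "0 \<le> B" using strip_bounded_nonneg[OF assms] .
  have "\<exists>C\<ge>0. \<forall>\<mu> d. 0 < d \<longrightarrow> (\<forall>z\<in>open_strip \<eta>. d \<le> cmod (f z - \<mu>)) \<longrightarrow>
       (\<forall>l\<le>n. \<forall>z\<in>open_strip \<eta>. cmod ((deriv ^^ l) (\<lambda>z. 1 / (f z - \<mu>)) z) \<le> C * (1 / d) * (1 + 1 / d) ^ n)"
    if "n \<le> N" for n
    using that
  proof (induction n)
    case 0
    have "cmod (1 / (f z - \<mu>)) \<le> 1 / d" if "0 < d" "d \<le> cmod (f z - \<mu>)" for d \<mu> z
      using that by (simp add: norm_divide frac_le)
    then show ?case by (intro exI[of _ 1]) auto
  next
    case (Suc n)
    obtain C where C: "C \<ge> 0" and "\<forall>\<mu> d. 0 < d \<longrightarrow> (\<forall>z\<in>open_strip \<eta>. d \<le> cmod (f z - \<mu>)) \<longrightarrow>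
       (\<forall>l\<le>n. \<forall>z\<in>open_strip \<eta>. cmod ((deriv ^^ l) (\<lambda>z. 1 / (f z - \<mu>)) z) \<le> C * (1 / d) * (1 + 1 / d) ^ n)"
      using Suc.IH[OF Suc_leD[OF Suc.prems]] by blast
    note bd = this(2)[rule_format]
    define D where "D = max C (2 ^ Suc n * B * C)"
    have D: "C \<le> D" "2 ^ Suc n * B * C \<le> D" "0 \<le> D" using C by (auto simp: D_def)
    show ?case
    proof (intro exI[of _ D] conjI allI impI ballI)
      show "D \<ge> 0" by fact
      fix \<mu> d l z assume d: "0 < (d::real)" and far: "\<forall>z\<in>open_strip \<eta>. d \<le> cmod (f z - \<mu>)"
        and l: "l \<le> Suc n" and z: "z \<in> open_strip \<eta>"
      let ?g = "\<lambda>z. 1 / (f z - \<mu>)" and ?Q = "(1 / d) * (1 + 1 / d) ^ n"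
      have Q: "0 \<le> ?Q" "0 \<le> 1 / d" using d by auto
      have nz: "f w - \<mu> \<noteq> 0" if "w \<in> open_strip \<eta>" for w using far d that by force
      have fhol: "f holomorphic_on open_strip \<eta>" using f by (simp add: strip_bounded_def)
      have ghol: "?g holomorphic_on open_strip \<eta>" using nz fhol by (auto intro!: holomorphic_intros)
      show "cmod ((deriv ^^ l) ?g z) \<le> D * (1 / d) * (1 + 1 / d) ^ Suc n"
      proof (cases "l \<le> n")
        case True
        then have "cmod ((deriv ^^ l) ?g z) \<le> C * ?Q" using bd[OF d _ True z] far by simp
        also have "\<dots> \<le> D * (?Q * (1 + 1 / d))"
          using C D(1,3) Q mult_left_mono[of 1 "1 + 1 / d" ?Q] by (intro mult_mono[of C D]) simp_all
        finally show ?thesis by (simp add: mult_ac)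
      next
        case False
        then have l: "l = Suc n" using l by simp
        have "(deriv ^^ Suc n) (\<lambda>z. (f z - \<mu>) * ?g z) z = (deriv ^^ Suc n) (\<lambda>_. 1) z"
          using nz by (intro higher_deriv_cong_ev eventually_mono[OF eventually_nhds_in_open[OF open_open_strip z]]) auto
        then have "0 = (deriv ^^ Suc n) (\<lambda>z. (f z - \<mu>) * ?g z) z"
          by (simp only: higher_deriv_constant) simp
        also have "\<dots> = (\<Sum>i = 0..Suc n. of_nat (Suc n choose i) * (deriv ^^ i) (\<lambda>z. f z - \<mu>) z * (deriv ^^ (Suc n - i)) ?g z)"
          using fhol ghol z by (intro higher_deriv_mult[of _ "open_strip \<eta>"]) (auto intro!: holomorphic_intros)
        also have "\<dots> = (f z - \<mu>) * (deriv ^^ Suc n) ?g z +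
            (\<Sum>i = 1..Suc n. of_nat (Suc n choose i) * (deriv ^^ i) (\<lambda>z. f z - \<mu>) z * (deriv ^^ (Suc n - i)) ?g z)"
          by (subst sum.atLeast_Suc_atMost) auto
        finally have "(f z - \<mu>) * (deriv ^^ Suc n) ?g z =
            - (\<Sum>i = 1..Suc n. of_nat (Suc n choose i) * (deriv ^^ i) (\<lambda>z. f z - \<mu>) z * (deriv ^^ (Suc n - i)) ?g z)"
          by (simp only: eq_neg_iff_add_eq_0)
        then have "cmod (f z - \<mu>) * cmod ((deriv ^^ Suc n) ?g z) =
            cmod (\<Sum>i = 1..Suc n. of_nat (Suc n choose i) * (deriv ^^ i) (\<lambda>z. f z - \<mu>) z * (deriv ^^ (Suc n - i)) ?g z)"
          by (simp only: norm_mult [symmetric] norm_minus_cancel)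
        also have "\<dots> \<le> (\<Sum>i = 1..Suc n. real (Suc n choose i) * (B * (C * ?Q)))"
        proof (rule sum_norm_le)
          fix i assume i: "i \<in> {1..Suc n}"
          have "(deriv ^^ i) (\<lambda>z. f z - \<mu>) z = (deriv ^^ i) f z - (deriv ^^ i) (\<lambda>_. \<mu>) z"
            using fhol z by (intro higher_deriv_diff[of _ "open_strip \<eta>"]) auto
          then have "(deriv ^^ i) (\<lambda>z. f z - \<mu>) z = (deriv ^^ i) f z"
            using i by (simp add: higher_deriv_constant)
          then have "cmod ((deriv ^^ i) (\<lambda>z. f z - \<mu>) z) \<le> B"
            using f i z Suc.prems by (auto simp: strip_bounded_def)
          moreover have le: "Suc n - i \<le> n" using i by auto
          have "cmod ((deriv ^^ (Suc n - i)) ?g z) \<le> C * ?Q"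
            using bd[OF d bspec[OF far] le z] by (simp only: mult.assoc)
          ultimately show "cmod (of_nat (Suc n choose i) * (deriv ^^ i) (\<lambda>z. f z - \<mu>) z * (deriv ^^ (Suc n - i)) ?g z)
              \<le> real (Suc n choose i) * (B * (C * ?Q))"
            using B unfolding norm_mult mult.assoc norm_of_nat by (intro mult_left_mono mult_mono) auto
        qed
        also have "\<dots> \<le> (\<Sum>i\<le>Suc n. real (Suc n choose i)) * (B * (C * ?Q))"
          unfolding sum_distrib_right by (intro sum_mono2 mult_nonneg_nonneg[OF _ mult_nonneg_nonneg[OF B mult_nonneg_nonneg[OF C Q(1)]]]) auto
        also have "(\<Sum>i\<le>Suc n. real (Suc n choose i)) = 2 ^ Suc n"
          using choose_row_sum[of "Suc n"] by (metis of_nat_numeral of_nat_power of_nat_sum)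
        finally have *: "cmod (f z - \<mu>) * cmod ((deriv ^^ Suc n) ?g z) \<le> 2 ^ Suc n * (B * (C * ?Q))" .
        have "d * cmod ((deriv ^^ Suc n) ?g z) \<le> cmod (f z - \<mu>) * cmod ((deriv ^^ Suc n) ?g z)"
          using far z by (intro mult_right_mono) auto
        also note *
        also have "2 ^ Suc n * (B * (C * ?Q)) \<le> D * ?Q"
          using mult_right_mono[OF D(2) Q(1)] by (simp only: mult_ac)
        finally have "cmod ((deriv ^^ Suc n) ?g z) \<le> (1 / d) * (D * ?Q)"
          using d by (simp add: field_simps)
        also have "\<dots> \<le> (1 + 1 / d) * (D * ?Q)"
          using D Q by (intro mult_right_mono) auto
        finally show ?thesis unfolding l by (simp add: mult_ac)
      qed
    qed
  qed
  then obtain C where C: "C \<ge> 0" "\<forall>\<mu> d. 0 < d \<longrightarrow> (\<forall>z\<in>open_strip \<eta>. d \<le> cmod (f z - \<mu>)) \<longrightarrow>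
       (\<forall>l\<le>N. \<forall>z\<in>open_strip \<eta>. cmod ((deriv ^^ l) (\<lambda>z. 1 / (f z - \<mu>)) z) \<le> C * (1 / d) * (1 + 1 / d) ^ N)"
    by blast
  show thesis
  proof (rule that[OF C(1)])
    fix \<mu> d assume d: "0 < (d::real)" and far: "\<And>z. z \<in> open_strip \<eta> \<Longrightarrow> d \<le> cmod (f z - \<mu>)"
    have "f w - \<mu> \<noteq> 0" if "w \<in> open_strip \<eta>" for w using far[OF that] d by force
    then have "(\<lambda>z. 1 / (f z - \<mu>)) holomorphic_on open_strip \<eta>"
      using f by (auto intro!: holomorphic_intros simp: strip_bounded_def)
    then show "strip_bounded \<eta> N (C * (1 / d) * (1 + 1 / d) ^ N) (\<lambda>z. 1 / (f z - \<mu>))"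
      using C(2)[rule_format, OF d far] f unfolding strip_bounded_def by simp
  qed
qed

lemma summable_on_norm_comparison:
  fixes f :: "'a \<Rightarrow> 'b::banach"
  assumes "g summable_on A" "\<And>x. x \<in> A \<Longrightarrow> norm (f x) \<le> g x"
  shows "f summable_on A"
  by (rule abs_summable_summable[OF Infinite_Sum.abs_summable_on_comparison_test'[OF assms]])

lemma summable_on_product_nonneg:
  fixes f :: "'a \<Rightarrow> real" and g :: "'b \<Rightarrow> real"
  assumes "f summable_on A" "g summable_on B" "\<And>x. x \<in> A \<Longrightarrow> 0 \<le> f x" "\<And>y. y \<in> B \<Longrightarrow> 0 \<le> g y"
  shows "(\<lambda>(x, y). f x * g y) summable_on A \<times> B"
proof (rule summable_on_SigmaI)
  show "((\<lambda>y. case (x, y) of (x, y) \<Rightarrow> f x * g y) has_sum f x * infsum g B) B" if "x \<in> A" for x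
    using has_sum_cmult_right[OF has_sum_infsum[OF assms(2)], of "f x"] by simp
  show "(\<lambda>x. f x * infsum g B) summable_on A"
    by (rule summable_on_cmult_left[OF assms(1)])
  show "0 \<le> (case (x, y) of (x, y) \<Rightarrow> f x * g y)" if "x \<in> A" "y \<in> B" for x y
    using assms(3,4) that by simp
qed

lemma symbol_term_le:
  assumes "z \<in> closed_strip \<eta>"
  shows "cmod (a j * expi j z) \<le> cmod (a j) * weight \<eta> s j"
  unfolding norm_mult
  by (intro mult_left_mono order_trans[OF norm_expi_le[OF assms] exp_le_weight]) auto

lemma symbol_uniform_limit:
  assumes "rapid \<eta> a"
  shows "uniform_limit (closed_strip \<eta>) (\<lambda>F z. \<Sum>j\<in>F. a j * expi j z) (symbol a) (finite_subsets_at_top UNIV)"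
  unfolding symbol_def [abs_def]
  by (rule Weierstrass_m_test_general[OF symbol_term_le[where s = 0]])
    (use assms in \<open>auto simp: rapid_def\<close>)

lemma symbol_has_sum:
  assumes "rapid \<eta> a" "z \<in> closed_strip \<eta>"
  shows "((\<lambda>j. a j * expi j z) has_sum symbol a z) UNIV"
  unfolding has_sum_def using tendsto_uniform_limitI[OF symbol_uniform_limit] assms by blast

lemma continuous_on_symbol:
  assumes "rapid \<eta> a" shows "continuous_on (closed_strip \<eta>) (symbol a)"
  by (rule uniform_limit_theorem[OF _ symbol_uniform_limit[OF assms]])
    (auto intro!: always_eventually continuous_intros)

lemma symbol_periodic: "symbol a (z + 2 * of_real pi) = symbol a z"
  by (simp add: symbol_def expi_shift)

lemma higher_deriv_trigonometric_polynomial: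
  "(deriv ^^ l) (\<lambda>z. \<Sum>j\<in>F. a j * expi j z) = (\<lambda>z. \<Sum>j\<in>F. a j * (\<i> * of_int j) ^ l * expi j z)"
proof (induction l arbitrary: a)
  case 0
  then show ?case by simp
next
  case (Suc l)
  have "deriv (\<lambda>z. \<Sum>j\<in>F. a j * expi j z) = (\<lambda>z. \<Sum>j\<in>F. (a j * (\<i> * of_int j)) * expi j z)"
  proof
    fix z
    have "((\<lambda>z. \<Sum>j\<in>F. a j * expi j z) has_field_derivative (\<Sum>j\<in>F. (a j * (\<i> * of_int j)) * expi j z)) (at z)"
      unfolding expi_def by (auto intro!: derivative_eq_intros simp: mult_ac)
    then show "deriv (\<lambda>z. \<Sum>j\<in>F. a j * expi j z) z = (\<Sum>j\<in>F. (a j * (\<i> * of_int j)) * expi j z)"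
      by (rule DERIV_imp_deriv)
  qed
  then have "(deriv ^^ Suc l) (\<lambda>z. \<Sum>j\<in>F. a j * expi j z) =
      (deriv ^^ l) (\<lambda>z. \<Sum>j\<in>F. (a j * (\<i> * of_int j)) * expi j z)"
    by (simp only: funpow_Suc_right comp_apply)
  then show ?case
    unfolding Suc.IH by (simp only: power_Suc mult.assoc)
qed

text \<open>The series of the symbol converges uniformly on the closed strip, so it can be differentiated term
by term inside; each derivative costs a factor \<open>\<bar>j\<bar>\<close>, which the weight absorbs.\<close>

lemma symbol_strip_bounded:
  assumes "rapid \<eta> a"
  shows "strip_bounded \<eta> N (\<Sum>\<^sub>\<infinity>j. cmod (a j) * weight \<eta> N j) (symbol a)"
  unfolding strip_bounded_def
proof (intro conjI ballI allI impI)
  have ul: "uniform_limit A (\<lambda>F z. \<Sum>j\<in>F. a j * expi j z) (symbol a) (finite_subsets_at_top UNIV)"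
    if "A \<subseteq> open_strip \<eta>" for A
    using uniform_limit_on_subset[OF symbol_uniform_limit[OF assms]] that open_strip_subset by blast
  have "\<exists>r>0. ball z r \<subseteq> open_strip \<eta> \<and> symbol a holomorphic_on ball z r" if z: "z \<in> open_strip \<eta>" for z
  proof -
    obtain r where r: "r > 0" "cball z r \<subseteq> open_strip \<eta>"
      using z open_contains_cball open_open_strip by blast
    have "symbol a holomorphic_on ball z r"
      by (rule holomorphic_uniform_limit[OF _ ul[OF r(2)]])
        (auto intro!: always_eventually continuous_intros holomorphic_intros)
    then show ?thesis using r ball_subset_cball by blast
  qed
  then show "symbol a holomorphic_on open_strip \<eta>"
    by (meson analytic_imp_holomorphic analytic_on_def)
  show "symbol a (z + 2 * of_real pi) = symbol a z" for z
    by (rule symbol_periodic)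
  show "cmod ((deriv ^^ l) (symbol a) z) \<le> (\<Sum>\<^sub>\<infinity>j. cmod (a j) * weight \<eta> N j)"
    if l: "l \<le> N" and z: "z \<in> open_strip \<eta>" for l z
  proof -
    have "((\<lambda>F. (deriv ^^ l) (\<lambda>z. \<Sum>j\<in>F. a j * expi j z) z) \<longlongrightarrow> (deriv ^^ l) (symbol a) z) (finite_subsets_at_top UNIV)"
      by (rule higher_deriv_complex_uniform_limit[OF ul[OF order_refl] _ _ open_open_strip z])
        (auto intro!: always_eventually holomorphic_intros)
    then have "((\<lambda>j. a j * (\<i> * of_int j) ^ l * expi j z) has_sum (deriv ^^ l) (symbol a) z) UNIV"
      unfolding higher_deriv_trigonometric_polynomial has_sum_def .
    moreover have "((\<lambda>j. cmod (a j) * weight \<eta> N j) has_sum (\<Sum>\<^sub>\<infinity>j. cmod (a j) * weight \<eta> N j)) UNIV"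
      using assms by (auto simp: rapid_def)
    moreover have "cmod (a j * (\<i> * of_int j) ^ l * expi j z) \<le> cmod (a j) * weight \<eta> N j" for j
    proof -
      have "\<bar>real_of_int j\<bar> ^ l \<le> (1 + \<bar>real_of_int j\<bar>) ^ l" by (intro power_mono) auto
      also have "\<dots> \<le> (1 + \<bar>real_of_int j\<bar>) ^ N" using l by (intro power_increasing) auto
      finally have "\<bar>real_of_int j\<bar> ^ l * cmod (expi j z) \<le> (1 + \<bar>real_of_int j\<bar>) ^ N * exp (\<eta> * \<bar>real_of_int j\<bar>)"
        by (intro mult_mono norm_expi_le subsetD[OF open_strip_subset z]) auto
      then show ?thesis
        by (simp add: norm_mult norm_power weight_def mult.assoc mult_left_mono mult.commute[of "exp _"])
    qed
    ultimately show ?thesis by (rule norm_infsum_le)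
  qed
qed

lemma strip_bounded_continuous_on_period:
  assumes "strip_bounded \<eta> N B h" "0 < \<eta>"
  shows "continuous_on (closed_segment 0 (2 * of_real pi)) h"
  using continuous_on_subset[OF strip_bounded_continuous[OF assms(1)]]
    horizontal_segment_in_open_strip[of 0 \<eta>] assms(2) by simp

lemma mean_sum:
  assumes "finite F" "\<And>i. i \<in> F \<Longrightarrow> continuous_on (closed_segment 0 (2 * of_real pi)) (f i)"
  shows "mean (\<lambda>z. \<Sum>i\<in>F. f i z) = (\<Sum>i\<in>F. mean (f i))"
  using assms unfolding mean_def sum_divide_distrib [symmetric]
  by (subst contour_integral_sum) (auto intro: contour_integrable_continuous_linepath)

lemma mean_cmult:
  assumes "continuous_on (closed_segment 0 (2 * of_real pi)) f"
  shows "mean (\<lambda>z. c * f z) = c * mean f"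
  using assms unfolding mean_def
  by (subst contour_integral_lmul) (auto intro: contour_integrable_continuous_linepath)

text \<open>The convolution theorem: the series of the symbol converges uniformly on the real axis and can be
integrated term by term.\<close>

lemma fourier_coeff_symbol_mult:
  assumes a: "rapid \<eta> a" and h: "strip_bounded \<eta> N B h" and \<eta>: "0 < \<eta>"
  shows "((\<lambda>i. a i * fourier_coeff h (j - i)) has_sum fourier_coeff (\<lambda>z. symbol a z * h z) j) UNIV"
proof -
  let ?S = "closed_segment 0 (2 * complex_of_real pi)"
  have S: "z \<in> open_strip \<eta>" "Im z = 0" if "z \<in> ?S" for z
    using that horizontal_segment_in_open_strip[of 0 \<eta>] Im_horizontal_segment[of z 0] \<eta> by auto
  have cont: "continuous_on ?S (\<lambda>z. h z * expi k z)" for k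
    by (intro continuous_intros strip_bounded_continuous_on_period[OF h \<eta>])
  have bound: "cmod (a i * expi i z * (h z * expi (- j) z)) \<le> cmod (a i) * weight \<eta> 0 i * B" if "z \<in> ?S" for i z
  proof -
    have "cmod ((deriv ^^ 0) h z) \<le> B"
      using h S(1)[OF that] unfolding strip_bounded_def by blast
    then have "cmod (h z * expi (- j) z) \<le> B"
      using S(2)[OF that] by (simp add: norm_mult norm_expi)
    moreover have "cmod (a i * expi i z) \<le> cmod (a i) * weight \<eta> 0 i"
      using S(1)[OF that] open_strip_subset by (intro symbol_term_le) auto
    ultimately show ?thesis
      unfolding norm_mult[of "a i * expi i z"] by (intro mult_mono) auto
  qed
  have "uniform_limit ?S (\<lambda>F z. \<Sum>i\<in>F. a i * expi i z * (h z * expi (- j) z))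
      (\<lambda>z. symbol a z * h z * expi (- j) z) (finite_subsets_at_top UNIV)"
  proof (rule Weierstrass_m_test_general'[OF bound])
    show "((\<lambda>i. a i * expi i z * (h z * expi (- j) z)) has_sum symbol a z * h z * expi (- j) z) UNIV" if "z \<in> ?S" for z
      using has_sum_cmult_left[OF symbol_has_sum[OF a], of z "h z * expi (- j) z"] S(1)[OF that] open_strip_subset
      by (auto simp: mult.assoc)
    show "(\<lambda>i. cmod (a i) * weight \<eta> 0 i * B) summable_on UNIV"
      using a by (intro summable_on_cmult_left) (auto simp: rapid_def)
  qed
  then have "((\<lambda>F. mean (\<lambda>z. \<Sum>i\<in>F. a i * expi i z * (h z * expi (- j) z))) \<longlongrightarrow>
      mean (\<lambda>z. symbol a z * h z * expi (- j) z)) (finite_subsets_at_top UNIV)"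
    by (rule mean_uniform_limit)
      (auto intro!: continuous_intros strip_bounded_continuous_on_period[OF h \<eta>])
  moreover have "mean (\<lambda>z. \<Sum>i\<in>F. a i * expi i z * (h z * expi (- j) z)) =
      (\<Sum>i\<in>F. a i * fourier_coeff h (j - i))" if "finite F" for F
  proof -
    have "mean (\<lambda>z. \<Sum>i\<in>F. a i * expi i z * (h z * expi (- j) z)) =
        mean (\<lambda>z. \<Sum>i\<in>F. a i * (h z * expi (i + - j) z))"
      unfolding expi_add by (simp add: mult_ac)
    also have "\<dots> = (\<Sum>i\<in>F. mean (\<lambda>z. a i * (h z * expi (i + - j) z)))"
      by (intro mean_sum continuous_on_mult_const continuous_on_mult_left cont that)
    also have "\<dots> = (\<Sum>i\<in>F. a i * mean (\<lambda>z. h z * expi (i + - j) z))"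
      by (intro sum.cong refl mean_cmult cont)
    finally show ?thesis by (simp add: fourier_coeff_def)
  qed
  ultimately show ?thesis
    unfolding has_sum_def fourier_coeff_def[of "\<lambda>z. symbol a z * h z"]
    by (elim Lim_transform_eventually)
      (auto intro!: eventually_finite_subsets_at_top_weakI)
qed

text \<open>The convolution on the side of the Fourier coefficients is moved over to \<open>t\<close> by exchanging the order
of summation. The double series converges absolutely because the weights are submultiplicative.\<close>

lemma pairing_symbol_mult:
  assumes a: "rapid \<eta> a" and t: "\<And>j. cmod (t j) \<le> C * weight \<eta> s j" and \<eta>: "0 < \<eta>"
    and h: "strip_bounded \<eta> (s + 2) B h"
  shows "pairing t (\<lambda>z. symbol a z * h z) = pairing (shift_operator a t) h"
proof -
  define c where "c = fourier_coeff h"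
  define g where "g = (\<lambda>m i. a i * t (i + m) * c m)"
  have "(\<lambda>(m, i). (C * 2 ^ (s + 2) * B * (1 / (1 + \<bar>real_of_int m\<bar>) ^ 2)) * (cmod (a i) * weight \<eta> s i)) summable_on UNIV \<times> UNIV"
  proof (rule summable_on_product_nonneg)
    have "0 \<le> C" using t[of 0] norm_ge_zero[of "t 0"] by (simp del: norm_ge_zero)
    then show "0 \<le> C * 2 ^ (s + 2) * B * (1 / (1 + \<bar>real_of_int m\<bar>) ^ 2)" for m
      using strip_bounded_nonneg[OF h \<eta>] by simp
  qed (use a in \<open>auto simp: rapid_def intro!: summable_on_cmult_right summable_inverse_square_int simp del: times_divide_eq_right\<close>)
  then have sum: "(\<lambda>(m, i). g m i) summable_on UNIV \<times> UNIV"
  proof (rule summable_on_norm_comparison)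
    fix x :: "int \<times> int"
    obtain m i where x: "x = (m, i)" by (cases x)
    have C: "0 \<le> C" using t[of 0] norm_ge_zero[of "t 0"] by (simp del: norm_ge_zero)
    have "cmod (t (i + m)) \<le> C * (weight \<eta> s i * weight \<eta> s m)"
      using order_trans[OF t mult_left_mono[OF weight_add_le C]] \<eta> by simp
    then have "cmod (g m i) \<le> cmod (a i) * (C * (weight \<eta> s i * weight \<eta> s m)) * cmod (c m)"
      unfolding g_def norm_mult by (intro mult_right_mono mult_left_mono) auto
    also have "\<dots> = (cmod (a i) * weight \<eta> s i) * cmod (of_real (C * weight \<eta> s m) * c m)"
      using C by (simp add: norm_mult)
    also have "\<dots> \<le> (cmod (a i) * weight \<eta> s i) * (C * 2 ^ (s + 2) * B * (1 / (1 + \<bar>real_of_int m\<bar>) ^ 2))"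
      unfolding c_def using C
      by (intro mult_left_mono pairing_term_le[where t = "\<lambda>m. of_real (C * weight \<eta> s m)", OF _ h \<eta>]) (auto simp: norm_mult)
    finally show "cmod (case x of (m, i) \<Rightarrow> g m i) \<le>
        (case x of (m, i) \<Rightarrow> (C * 2 ^ (s + 2) * B * (1 / (1 + \<bar>real_of_int m\<bar>) ^ 2)) * (cmod (a i) * weight \<eta> s i))"
      by (simp add: x mult.commute)
  qed
  have bij: "bij_betw (\<lambda>(m, i). (m + i, i)) (UNIV \<times> UNIV :: (int \<times> int) set) (UNIV \<times> UNIV)"
    by (rule bij_betwI[where g = "\<lambda>(j, i). (j - i, i)"]) auto
  have eq: "(\<lambda>(m, i). g m i) = (\<lambda>x. (\<lambda>(j, i). t j * (a i * c (j - i))) ((\<lambda>(m, i). (m + i, i)) x))"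
    by (auto simp: g_def fun_eq_iff add.commute mult_ac)
  have sum': "(\<lambda>(j, i). t j * (a i * c (j - i))) summable_on UNIV \<times> UNIV"
    using sum unfolding eq by (subst (asm) summable_on_reindex_bij_betw[OF bij])
  have "pairing t (\<lambda>z. symbol a z * h z) = (\<Sum>\<^sub>\<infinity>j. t j * (\<Sum>\<^sub>\<infinity>i. a i * c (j - i)))"
    unfolding pairing_def c_def using infsumI[OF fourier_coeff_symbol_mult[OF a h \<eta>]] by simp
  also have "\<dots> = (\<Sum>\<^sub>\<infinity>j. \<Sum>\<^sub>\<infinity>i. t j * (a i * c (j - i)))"
    by (simp only: infsum_cmult_right')
  also have "\<dots> = infsum (\<lambda>(j, i). t j * (a i * c (j - i))) (UNIV \<times> UNIV)"
    by (rule infsum_Sigma'_banach[OF sum'])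
  also have "\<dots> = infsum (\<lambda>(m, i). g m i) (UNIV \<times> UNIV)"
    unfolding eq by (rule infsum_reindex_bij_betw[OF bij, symmetric])
  also have "\<dots> = (\<Sum>\<^sub>\<infinity>m. \<Sum>\<^sub>\<infinity>i. g m i)"
    by (rule infsum_Sigma'_banach[OF sum, symmetric])
  also have "\<dots> = pairing (shift_operator a t) h"
    unfolding pairing_def shift_operator_def g_def c_def by (simp only: infsum_cmult_left')
  finally show ?thesis .
qed

lemma shift_operator_bound:
  assumes a: "rapid \<eta> a" and t: "\<And>j. cmod (t j) \<le> C * weight \<eta> s j" and \<eta>: "0 \<le> \<eta>"
  shows "cmod (shift_operator a t j) \<le> (\<Sum>\<^sub>\<infinity>i. cmod (a i) * weight \<eta> s i) * (C * weight \<eta> s j)"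
proof -
  have C: "0 \<le> C" using t[of 0] norm_ge_zero[of "t 0"] by (simp del: norm_ge_zero)
  have le: "cmod (a i * t (i + j)) \<le> cmod (a i) * weight \<eta> s i * (C * weight \<eta> s j)" for i
  proof -
    have "cmod (t (i + j)) \<le> C * (weight \<eta> s i * weight \<eta> s j)"
      using order_trans[OF t mult_left_mono[OF weight_add_le C]] \<eta> by simp
    then have "cmod (a i * t (i + j)) \<le> cmod (a i) * (C * (weight \<eta> s i * weight \<eta> s j))"
      unfolding norm_mult by (intro mult_left_mono) auto
    then show ?thesis by (simp add: mult_ac)
  qed
  have sum: "(\<lambda>i. cmod (a i) * weight \<eta> s i * (C * weight \<eta> s j)) summable_on UNIV"
    using a by (intro summable_on_cmult_left) (auto simp: rapid_def)
  have "cmod (shift_operator a t j) \<le> (\<Sum>\<^sub>\<infinity>i. cmod (a i) * weight \<eta> s i * (C * weight \<eta> s j))"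
    unfolding shift_operator_def
    by (rule norm_infsum_le[OF has_sum_infsum[OF summable_on_norm_comparison[OF sum le]] has_sum_infsum[OF sum] le])
  then show ?thesis by (simp only: infsum_cmult_left')
qed

section \<open>Isolated singularities on the unit circle\<close>

text \<open>The hypothesis is void on the arc \<open>\<bar>1 + w\<bar> = 1\<close>, and on a circle about \<open>0\<close> this arc cannot be avoided.
For small \<open>\<rho> > 0\<close> consider the polynomial \<open>w ^ 2 + \<rho> ^ 2 * w + \<rho> ^ 2\<close>. On the circle \<open>\<bar>w\<bar> = \<rho>\<close> it vanishes
exactly where the bound breaks down, and its modulus is at most \<open>3 * \<bar>1 - \<bar>1 + w\<bar>\<bar>\<close>; so its \<open>K\<close>-th
power compensates the growth of \<open>g\<close> there with a constant independent of \<open>\<rho>\<close>. The maximum principle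
on the annulus between this circle and a fixed one extends the estimate inwards, and \<open>\<rho> \<rightarrow> 0\<close> turns
the polynomial into \<open>w ^ 2\<close>.\<close>

lemma annulus_bound:
  fixes g :: "complex \<Rightarrow> complex"
  assumes hol: "g holomorphic_on ball 0 R - {0}" and R: "0 < R" "R \<le> 1" and C: "0 \<le> C" and K: "0 < K"
    and bound: "\<And>w. w \<in> ball 0 R \<Longrightarrow> cmod (1 + w) \<noteq> 1 \<Longrightarrow> cmod (g w) \<le> C / \<bar>1 - cmod (1 + w)\<bar> ^ K"
  shows "(\<lambda>w. w ^ (2 * K) * g w) \<in> O[at 0](\<lambda>_. 1)"
proof -
  define R1 where "R1 = R / 2"
  have R1: "0 < R1" "R1 < R" "R1 \<le> 1" using R by (auto simp: R1_def)
  have "compact (g ` sphere 0 R1)"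
    using R1 by (intro compact_continuous_image continuous_on_subset[OF holomorphic_on_imp_continuous_on[OF hol]]) auto
  then have "bounded (g ` sphere 0 R1)" by (rule compact_imp_bounded)
  then obtain M where "\<forall>y\<in>g ` sphere 0 R1. cmod y \<le> M"
    unfolding bounded_iff by blast
  then have M: "cmod (g w) \<le> M" if "cmod w = R1" for w
    using that by auto
  define B where "B = max (3 ^ K * C) (M * 3 ^ K)"
  have main: "cmod (g w * (w ^ 2 + of_real (\<rho> ^ 2) * w + of_real (\<rho> ^ 2)) ^ K) \<le> B"
    if \<rho>: "0 < \<rho>" "\<rho> < R1" and w: "\<rho> \<le> cmod w" "cmod w \<le> R1" for \<rho> w
  proof -
    define S where "S = cball (0::complex) R1 - ball 0 \<rho>"
    define F where "F = (\<lambda>w. g w * (w ^ 2 + of_real (\<rho> ^ 2) * w + of_real (\<rho> ^ 2)) ^ K)"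
    have sub: "S \<subseteq> ball 0 R - {0}" using \<rho> R1 by (auto simp: S_def)
    have cl: "closed S" by (auto simp: S_def)
    have holF: "F holomorphic_on S"
      unfolding F_def by (intro holomorphic_intros holomorphic_on_subset[OF hol sub])
    have fr: "cmod u = R1 \<or> cmod u = \<rho>" if "u \<in> frontier S" for u
    proof (rule ccontr)
      assume "\<not> ?thesis"
      moreover have "u \<in> S" using that cl by (simp add: frontier_def)
      ultimately have "u \<in> ball 0 R1 - cball 0 \<rho>" by (auto simp: S_def)
      moreover have "ball 0 R1 - cball 0 \<rho> \<subseteq> interior S"
        by (rule interior_maximal) (auto simp: S_def)
      ultimately show False using that by (auto simp: frontier_def)
    qed
    have "cmod (F w) \<le> B"
    proof (rule maximum_modulus_frontier[of F S])
      show "F holomorphic_on interior S"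
        using holF interior_subset holomorphic_on_subset by blast
      show "continuous_on (closure S) F"
        using holF cl by (simp add: holomorphic_on_imp_continuous_on)
      show "bounded S" unfolding S_def by (intro bounded_diff bounded_cball)
      show "w \<in> S" using w by (auto simp: S_def)
      fix u assume u: "u \<in> frontier S"
      then have uS: "u \<in> S" using cl by (simp add: frontier_def)
      consider "cmod u = \<rho>" | "cmod u = R1" using fr[OF u] by blast
      then show "cmod (F u) \<le> B"
      proof cases
        case 1
        \<comment> \<open>on this circle \<open>\<rho>\<^sup>2 = u * cnj u\<close>, so that the quadratic factor is \<open>u * (\<bar>1 + u\<bar>\<^sup>2 - 1)\<close>\<close>
        have uu: "of_real (\<rho> ^ 2) = u * cnj u"
          using complex_norm_square[of u] 1 by simp
        have "of_real (cmod (1 + u) ^ 2) = (1 + u) * cnj (1 + u)"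
          using complex_norm_square[of "1 + u"] by simp
        then have "u * of_real (cmod (1 + u) ^ 2 - 1) = u ^ 2 + of_real (\<rho> ^ 2) * u + of_real (\<rho> ^ 2)"
          unfolding uu by (simp add: algebra_simps power2_eq_square)
        then have "cmod (u ^ 2 + of_real (\<rho> ^ 2) * u + of_real (\<rho> ^ 2)) = \<rho> * \<bar>cmod (1 + u) ^ 2 - 1\<bar>"
          using 1 by (metis norm_mult norm_of_real)
        also have "\<dots> = \<rho> * (\<bar>1 - cmod (1 + u)\<bar> * (1 + cmod (1 + u)))"
        proof -
          have "cmod (1 + u) ^ 2 - 1 = (cmod (1 + u) - 1) * (1 + cmod (1 + u))"
            by (simp add: algebra_simps power2_eq_square)
          then show ?thesis by (simp add: abs_mult abs_minus_commute)
        qed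
        also have "\<dots> \<le> 1 * (\<bar>1 - cmod (1 + u)\<bar> * 3)"
          using \<rho> R1 1 norm_triangle_ineq[of 1 u] by (intro mult_mono) auto
        finally have q: "cmod (u ^ 2 + of_real (\<rho> ^ 2) * u + of_real (\<rho> ^ 2)) \<le> 3 * \<bar>1 - cmod (1 + u)\<bar>"
          by simp
        have "cmod (F u) \<le> 3 ^ K * C"
        proof (cases "cmod (1 + u) = 1")
          case True
          then have "u ^ 2 + of_real (\<rho> ^ 2) * u + of_real (\<rho> ^ 2) = 0" using q by simp
          then have "F u = 0" using K by (simp add: F_def)
          then show ?thesis using C by simp
        next
          case False
          have "cmod (g u) * cmod (u ^ 2 + of_real (\<rho> ^ 2) * u + of_real (\<rho> ^ 2)) ^ K
              \<le> cmod (g u) * (3 * \<bar>1 - cmod (1 + u)\<bar>) ^ K"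
            using q by (intro mult_left_mono power_mono) auto
          also have "\<dots> \<le> 3 ^ K * C"
          proof -
            have "u \<in> ball 0 R" using sub uS by auto
            then have "cmod (g u) \<le> C / \<bar>1 - cmod (1 + u)\<bar> ^ K" using bound False by blast
            then have "cmod (g u) * \<bar>1 - cmod (1 + u)\<bar> ^ K \<le> C"
              using False by (simp add: pos_le_divide_eq)
            then show ?thesis by (simp add: power_mult_distrib mult_ac)
          qed
          finally show ?thesis by (simp add: F_def norm_mult norm_power)
        qed
        then show ?thesis by (simp add: B_def)
      next
        case 2
        have "\<rho> ^ 2 \<le> 1" using \<rho> R1 by (intro power_le_one) auto
        have "cmod (u ^ 2 + of_real (\<rho> ^ 2) * u + of_real (\<rho> ^ 2)) \<le> cmod (u ^ 2) + cmod (of_real (\<rho> ^ 2) * u) + cmod (of_real (\<rho> ^ 2) :: complex)"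
          by (intro order_trans[OF norm_triangle_ineq] add_right_mono norm_triangle_ineq)
        also have "\<dots> \<le> 1 + 1 * 1 + 1"
          unfolding norm_mult norm_power norm_of_real
          using 2 R1 \<open>\<rho> ^ 2 \<le> 1\<close> by (intro add_mono mult_mono power_le_one) auto
        finally have "cmod (F u) \<le> M * 3 ^ K"
          unfolding F_def norm_mult norm_power
          using M[OF 2] order_trans[OF norm_ge_zero M[OF 2]] by (intro mult_mono power_mono) auto
        then show ?thesis by (simp add: B_def)
      qed
    qed
    then show ?thesis by (simp add: F_def)
  qed
  have lim: "cmod (w ^ (2 * K) * g w) \<le> B" if "0 < cmod w" "cmod w < R1" for w
  proof -
    have "((\<lambda>\<rho>. cmod (g w * (w ^ 2 + of_real (\<rho> ^ 2) * w + of_real (\<rho> ^ 2)) ^ K)) \<longlongrightarrow>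
        cmod (g w * (w ^ 2 + of_real (0 ^ 2) * w + of_real (0 ^ 2)) ^ K)) (at_right 0)"
      by (intro tendsto_intros)
    moreover have "eventually (\<lambda>\<rho>. cmod (g w * (w ^ 2 + of_real (\<rho> ^ 2) * w + of_real (\<rho> ^ 2)) ^ K) \<le> B) (at_right 0)"
      using eventually_at_right_real[OF that(1)] by (rule eventually_mono) (use main that in auto)
    ultimately have "cmod (g w * (w ^ 2 + of_real (0 ^ 2) * w + of_real (0 ^ 2)) ^ K) \<le> B"
      by (rule tendsto_upperbound) auto
    then show ?thesis by (simp add: power_mult [symmetric] mult.commute)
  qed
  have "eventually (\<lambda>w. w \<in> ball 0 R1 - {0}) (at (0::complex))"
    using R1 by (intro eventually_at_in_open) auto
  then have "eventually (\<lambda>w. cmod (w ^ (2 * K) * g w) \<le> B * cmod 1) (at 0)"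
    by (rule eventually_mono) (use lim in auto)
  then show ?thesis by (rule bigoI)
qed

text \<open>The function \<open>w ^ (j + 2) * g w\<close> extends holomorphically to \<open>0\<close>. The radial bound forces its value
there to be zero, so that one factor \<open>w\<close> can be divided out.\<close>

lemma pole_order_descent:
  fixes g :: "complex \<Rightarrow> complex"
  assumes hol: "g holomorphic_on ball 0 R - {0}" and R: "0 < R"
    and ray: "\<And>x. 0 < x \<Longrightarrow> x < R \<Longrightarrow> cmod (g (- of_real x)) \<le> C / x"
    and big: "(\<lambda>w. w ^ (j + 2) * g w) \<in> O[at 0](\<lambda>_. 1)"
  shows "(\<lambda>w. w ^ (j + 1) * g w) \<in> O[at 0](\<lambda>_. 1)"
proof -
  have "(\<lambda>w. w ^ (j + 2) * g w) holomorphic_on ball 0 R - {0}"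
    by (intro holomorphic_intros hol)
  from holomorphic_on_extend[OF this _ big] R obtain H where H: "H holomorphic_on ball 0 R"
      and eq: "\<And>w. w \<in> ball 0 R - {0} \<Longrightarrow> H w = w ^ (j + 2) * g w"
    by (auto simp: interior_open)
  have H': "(H has_field_derivative deriv H 0) (at 0)"
    using H R by (intro holomorphic_derivI[of _ "ball 0 R"]) auto
  have "H 0 = 0"
  proof -
    have "((\<lambda>x. H (- of_real x)) \<longlongrightarrow> H (- of_real 0)) (at_right 0)"
      using DERIV_isCont[OF H'] by (intro isCont_tendsto_compose[of _ H] tendsto_intros) auto
    moreover have "((\<lambda>x. H (- of_real x)) \<longlongrightarrow> 0) (at_right 0)"
    proof (rule Lim_null_comparison)
      have "((\<lambda>x. x ^ (j + 1) * C) \<longlongrightarrow> 0 ^ (j + 1) * C) (at_right (0::real))" by (intro tendsto_intros)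
      then show "((\<lambda>x. x ^ (j + 1) * C) \<longlongrightarrow> 0) (at_right (0::real))" by simp
      have "cmod (H (- of_real x)) \<le> x ^ (j + 1) * C" if x: "x \<in> {0<..<R}" for x
      proof -
        have "cmod (H (- of_real x)) = x ^ (j + 2) * cmod (g (- of_real x))"
          using eq[of "- of_real x"] x by (simp add: norm_mult norm_power)
        also have "\<dots> \<le> x ^ (j + 2) * (C / x)"
          using ray x by (intro mult_left_mono) auto
        finally show ?thesis using x by simp
      qed
      then show "eventually (\<lambda>x. cmod (H (- of_real x)) \<le> x ^ (j + 1) * C) (at_right 0)"
        by (intro eventually_mono[OF eventually_at_right_real[OF R]])
    qed
    ultimately show ?thesis by (auto dest: tendsto_unique[rotated 1])
  qed
  have "((\<lambda>w. (H w - H 0) / (w - 0)) \<longlongrightarrow> deriv H 0) (at 0)"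
    using H' by (simp add: has_field_derivative_iff)
  moreover have "eventually (\<lambda>w. (H w - H 0) / (w - 0) = w ^ (j + 1) * g w) (at 0)"
  proof (rule eventually_mono[OF eventually_at_in_open[of "ball 0 R" 0]])
    show "(H w - H 0) / (w - 0) = w ^ (j + 1) * g w" if "w \<in> ball 0 R - {0}" for w
      using eq[OF that] that \<open>H 0 = 0\<close> by simp
  qed (use R in auto)
  ultimately have "((\<lambda>w. w ^ (j + 1) * g w) \<longlongrightarrow> deriv H 0) (at 0)"
    by (rule Lim_transform_eventually)
  then have "((\<lambda>w. w ^ (j + 1) * g w / 1) \<longlongrightarrow> deriv H 0) (at 0)" by simp
  then show ?thesis by (rule bigoI_tendsto) simp
qed

text \<open>The bounds from both sides show that \<open>\<zeta>\<close> is a pole of some order; the first order bound along the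
radius inside the disc then lowers this order to one. The substitution \<open>z = \<zeta> * (1 + w)\<close> moves \<open>\<zeta>\<close> to
the origin and that radius to the negative real axis.\<close>

lemma at_most_simple_pole:
  fixes f :: "complex \<Rightarrow> complex"
  assumes hol: "f holomorphic_on ball \<zeta> R - {\<zeta>}" and R: "0 < R" "R \<le> 1" and \<zeta>: "cmod \<zeta> = 1" and C: "0 \<le> C"
    and inside: "\<And>z. z \<in> ball \<zeta> R \<Longrightarrow> cmod z < 1 \<Longrightarrow> cmod (f z) \<le> C / (1 - cmod z)"
    and outside: "\<And>z. z \<in> ball \<zeta> R \<Longrightarrow> 1 < cmod z \<Longrightarrow> cmod (f z) \<le> C / (cmod z - 1) ^ K"
  shows "(\<lambda>z. (z - \<zeta>) * f z) \<in> O[at \<zeta>](\<lambda>_. 1)"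
proof -
  define g where "g = (\<lambda>w. f (\<zeta> * (1 + w)))"
  have \<zeta>0: "\<zeta> \<noteq> 0" using \<zeta> by auto
  have ball: "\<zeta> * (1 + w) \<in> ball \<zeta> R" if "w \<in> ball 0 R" for w
  proof -
    have "\<zeta> - \<zeta> * (1 + w) = - (\<zeta> * w)" by (simp add: algebra_simps)
    then show ?thesis using that \<zeta> by (simp add: dist_norm norm_mult)
  qed
  have holg: "g holomorphic_on ball 0 R - {0}"
  proof -
    have "f \<circ> (\<lambda>w. \<zeta> * (1 + w)) holomorphic_on ball 0 R - {0}"
      by (rule holomorphic_on_compose_gen[OF _ hol]) (use ball \<zeta>0 in \<open>auto intro!: holomorphic_intros\<close>)
    then show ?thesis by (simp add: g_def o_def)
  qed
  have ng: "cmod (\<zeta> * (1 + w)) = cmod (1 + w)" for w using \<zeta> by (simp add: norm_mult)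
  have bound: "cmod (g w) \<le> C / \<bar>1 - cmod (1 + w)\<bar> ^ Suc K" if w: "w \<in> ball 0 R" "cmod (1 + w) \<noteq> 1" for w
  proof -
    define d where "d = \<bar>1 - cmod (1 + w)\<bar>"
    have d: "0 < d" "d \<le> 1"
      using w R norm_triangle_ineq3[of 1 "1 + w"] unfolding d_def by auto
    have "C / d \<le> C / d ^ Suc K"
      using d C power_decreasing[of 1 "Suc K" d] by (intro divide_left_mono) auto
    moreover have "C / d ^ K \<le> C / d ^ Suc K"
      using d C by (intro divide_left_mono power_decreasing) auto
    moreover have "cmod (g w) \<le> C / d \<or> cmod (g w) \<le> C / d ^ K"
      using inside[OF ball[OF w(1)]] outside[OF ball[OF w(1)]] w(2) unfolding ng g_def d_def
      by (cases "cmod (1 + w) < 1") auto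
    ultimately show ?thesis unfolding d_def by linarith
  qed
  have ray: "cmod (g (- of_real x)) \<le> C / x" if x: "0 < x" "x < R" for x
  proof -
    have "cmod (1 + - of_real x) = 1 - x"
      using x R norm_of_real[of "1 - x", where ?'a = complex] by simp
    then show ?thesis
      using inside[OF ball, of "- of_real x"] x unfolding ng g_def by simp
  qed
  have "(\<lambda>w. w ^ (j + 1) * g w) \<in> O[at 0](\<lambda>_. 1) \<Longrightarrow> (\<lambda>w. w ^ 1 * g w) \<in> O[at 0](\<lambda>_. 1)" for j
  proof (induction j)
    case (Suc j)
    then show ?case
      using pole_order_descent[OF holg R(1) ray, of j] by simp
  qed simp
  from this[of "2 * K + 1"] annulus_bound[OF holg R C _ bound]
  have "(\<lambda>w. w * g w) \<in> O[at 0](\<lambda>_. 1)" by simp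
  then obtain B where "eventually (\<lambda>w. cmod (w * g w) \<le> B) (at 0)"
    by (auto elim!: landau_o.bigE)
  then obtain r where r: "0 < r" "\<And>w. w \<noteq> 0 \<Longrightarrow> cmod w < r \<Longrightarrow> cmod (w * g w) \<le> B"
    unfolding eventually_at by (auto simp: dist_norm)
  have "eventually (\<lambda>z. cmod ((z - \<zeta>) * f z) \<le> B * cmod 1) (at \<zeta>)"
    unfolding eventually_at
  proof (intro exI conjI ballI impI)
    fix z assume z: "z \<noteq> \<zeta> \<and> dist z \<zeta> < r"
    let ?w = "z / \<zeta> - 1"
    have "?w = (z - \<zeta>) / \<zeta>" using \<zeta>0 by (simp add: field_simps)
    then have nw: "cmod ?w = cmod (z - \<zeta>)" using \<zeta> by (simp add: norm_divide)
    then have "cmod (?w * g ?w) \<le> B"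
      using r(2)[of ?w] z by (auto simp: dist_norm)
    moreover have "g ?w = f z" using \<zeta>0 by (simp add: g_def)
    ultimately show "cmod ((z - \<zeta>) * f z) \<le> B * cmod 1"
      using nw by (simp add: norm_mult)
  qed (use r in auto)
  then show ?thesis by (rule bigoI)
qed

section \<open>The Carleman transform\<close>

text \<open>The Carleman transform of \<open>t\<close>: formally, the value at \<open>0\<close> of the sequence
\<open>(shift_operator a - \<mu>)^ (- 1) t\<close>.\<close>

definition resolvent_pairing :: "(int \<Rightarrow> complex) \<Rightarrow> (int \<Rightarrow> complex) \<Rightarrow> complex \<Rightarrow> complex" where
  "resolvent_pairing a t \<mu> = pairing t (\<lambda>z. 1 / (symbol a z - \<mu>))"

lemma fourier_coeff_cong:
  assumes "\<And>z. z \<in> open_strip \<eta> \<Longrightarrow> f z = g z" "0 < \<eta>"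
  shows "fourier_coeff f j = fourier_coeff g j"
proof -
  have "contour_integral (linepath 0 (2 * of_real pi)) (\<lambda>z. f z * expi (- j) z) =
        contour_integral (linepath 0 (2 * of_real pi)) (\<lambda>z. g z * expi (- j) z)"
    using assms horizontal_segment_in_open_strip[of 0 \<eta>]
    by (intro contour_integral_eq) auto
  then show ?thesis by (simp add: fourier_coeff_def mean_def)
qed

lemma pairing_cong:
  assumes "\<And>z. z \<in> open_strip \<eta> \<Longrightarrow> f z = g z" "0 < \<eta>"
  shows "pairing t f = pairing t g"
  unfolding pairing_def using fourier_coeff_cong[OF assms] by simp

lemma pairing_lincomb_left:
  assumes "\<And>j. cmod (t j) \<le> C * weight \<eta> s j" "\<And>j. cmod (u j) \<le> C' * weight \<eta> s j" "0 < \<eta>"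
    and h: "strip_bounded \<eta> (s + 2) B h"
  shows "pairing (\<lambda>j. t j - c * u j) h = pairing t h - c * pairing u h"
proof -
  have sums: "(\<lambda>j. t j * fourier_coeff h j) summable_on UNIV" "(\<lambda>j. u j * fourier_coeff h j) summable_on UNIV"
    using abs_summable_summable[OF pairing_abs_summable[OF assms(1,4,3)]]
      abs_summable_summable[OF pairing_abs_summable[OF assms(2,4,3)]] by auto
  have "pairing (\<lambda>j. t j - c * u j) h =
      (\<Sum>\<^sub>\<infinity>j. t j * fourier_coeff h j + (- c) * (u j * fourier_coeff h j))"
    unfolding pairing_def by (simp add: algebra_simps)
  also have "\<dots> = (\<Sum>\<^sub>\<infinity>j. t j * fourier_coeff h j) + (\<Sum>\<^sub>\<infinity>j. (- c) * (u j * fourier_coeff h j))"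
    by (intro infsum_add summable_on_cmult_right sums)
  finally show ?thesis by (simp only: pairing_def infsum_cmult_right') simp
qed

text \<open>Periodicity reduces the strip to a compact rectangle.\<close>

lemma compact_symbol_image:
  assumes "rapid \<eta> a" shows "compact (symbol a ` closed_strip \<eta>)"
proof -
  define Q where "Q = cbox (Complex 0 (- \<eta>)) (Complex (2 * pi) \<eta>)"
  have Q: "Q \<subseteq> closed_strip \<eta>"
    by (auto simp: Q_def in_cbox_complex_iff closed_strip_def)
  have "symbol a z \<in> symbol a ` Q" if z: "z \<in> closed_strip \<eta>" for z
  proof -
    define n where "n = \<lfloor>Re z / (2 * pi)\<rfloor>"
    have per: "symbol a (w + of_int m * (2 * of_real pi)) = symbol a w" for w m
    proof -
      have "expi j (w + of_int m * (2 * of_real pi)) = expi j w" for j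
      proof -
        have "expi j (w + of_int m * (2 * of_real pi)) = expi j w * exp (2 * of_int (j * m) * of_real pi * \<i>)"
          by (simp add: expi_def exp_add [symmetric] algebra_simps)
        also have "exp (2 * of_int (j * m) * of_real pi * \<i>) = 1"
          using exp_integer_2pi[of "of_int (j * m)"] by (simp add: mult_ac)
        finally show ?thesis by simp
      qed
      then show ?thesis by (simp add: symbol_def)
    qed
    have "of_int n \<le> Re z / (2 * pi)" "Re z / (2 * pi) \<le> of_int n + 1"
      unfolding n_def by linarith+
    then have "of_int n * (2 * pi) \<le> Re z" "Re z \<le> of_int n * (2 * pi) + 2 * pi"
      by (simp_all add: field_simps)
    then have "z + of_int (- n) * (2 * of_real pi) \<in> Q"
      using z by (auto simp: Q_def in_cbox_complex_iff closed_strip_def algebra_simps)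
    then show ?thesis by (metis imageI per)
  qed
  then have "symbol a ` closed_strip \<eta> = symbol a ` Q" using Q by auto
  moreover have "compact (symbol a ` Q)"
    unfolding Q_def using Q continuous_on_subset[OF continuous_on_symbol[OF assms]]
    by (intro compact_continuous_image) (auto simp: Q_def)
  ultimately show ?thesis by simp
qed

lemma far_from_symbol:
  assumes "rapid \<eta> a" "\<mu> \<notin> symbol a ` closed_strip \<eta>"
  obtains d where "0 < d" "\<And>\<nu> z. \<nu> \<in> ball \<mu> d \<Longrightarrow> z \<in> open_strip \<eta> \<Longrightarrow> d \<le> cmod (symbol a z - \<nu>)"
proof -
  have "open (- (symbol a ` closed_strip \<eta>))"
    using compact_symbol_image[OF assms(1)] by (simp add: compact_imp_closed open_Compl)
  then obtain e where e: "e > 0" "ball \<mu> e \<subseteq> - (symbol a ` closed_strip \<eta>)"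
    using assms(2) open_contains_ball by (metis ComplI)
  show thesis
  proof (rule that[of "e / 2"])
    fix \<nu> z assume "\<nu> \<in> ball \<mu> (e / 2)" and z: "z \<in> open_strip \<eta>"
    moreover have "symbol a z \<notin> ball \<mu> e" using e z open_strip_subset by blast
    ultimately show "e / 2 \<le> cmod (symbol a z - \<nu>)"
      using dist_triangle[of \<mu> "symbol a z" \<nu>] by (simp add: dist_norm norm_minus_commute)
  qed (use e in simp)
qed

lemma resolvent_pairing_bound:
  assumes "rapid \<eta> a" "\<And>j. cmod (t j) \<le> C * weight \<eta> s j" "0 < \<eta>"
  obtains K where "0 \<le> K" "\<And>\<mu> d. 0 < d \<Longrightarrow> (\<And>z. z \<in> open_strip \<eta> \<Longrightarrow> d \<le> cmod (symbol a z - \<mu>)) \<Longrightarrow>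
     cmod (resolvent_pairing a t \<mu>) \<le> K * (1 / d) * (1 + 1 / d) ^ (s + 2)"
proof -
  have C: "0 \<le> C" using assms(2)[of 0] norm_ge_zero[of "t 0"] by (simp del: norm_ge_zero)
  from strip_bounded_inverse_diff[OF symbol_strip_bounded[OF assms(1)] assms(3), of "s + 2"]
  obtain D where D: "0 \<le> D" "\<And>\<mu> d. 0 < d \<Longrightarrow> (\<And>z. z \<in> open_strip \<eta> \<Longrightarrow> d \<le> cmod (symbol a z - \<mu>)) \<Longrightarrow>
     strip_bounded \<eta> (s + 2) (D * (1 / d) * (1 + 1 / d) ^ (s + 2)) (\<lambda>z. 1 / (symbol a z - \<mu>))" by blast
  show thesis
  proof (rule that[of "C * 2 ^ (s + 2) * D * inverse_square_total"])
    show "0 \<le> C * 2 ^ (s + 2) * D * inverse_square_total"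
      using C D(1) inverse_square_total_ge_0 by simp
    fix \<mu> d assume "0 < (d::real)" "\<And>z. z \<in> open_strip \<eta> \<Longrightarrow> d \<le> cmod (symbol a z - \<mu>)"
    from pairing_bound[OF assms(2) D(2)[OF this] assms(3)]
    show "cmod (resolvent_pairing a t \<mu>) \<le> C * 2 ^ (s + 2) * D * inverse_square_total * (1 / d) * (1 + 1 / d) ^ (s + 2)"
      by (simp only: resolvent_pairing_def mult_ac)
  qed
qed

text \<open>With \<open>\<kappa> = symbol a\<close> and \<open>h = \<nu> - \<mu>\<close>, the exact expansion
\<open>1 / (\<kappa> - \<nu>) = 1 / (\<kappa> - \<mu>) + h / (\<kappa> - \<mu>) ^ 2 + h ^ 2 / ((\<kappa> - \<mu>) ^ 2 * (\<kappa> - \<nu>))\<close> can be paired with \<open>t\<close> term by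
term, and the last pairing stays bounded as \<open>\<nu>\<close> tends to \<open>\<mu>\<close>.\<close>

lemma resolvent_pairing_holomorphic:
  assumes a: "rapid \<eta> a" and t: "\<And>j. cmod (t j) \<le> C * weight \<eta> s j" and \<eta>: "0 < \<eta>"
  shows "resolvent_pairing a t holomorphic_on - (symbol a ` closed_strip \<eta>)"
proof -
  define \<kappa> where "\<kappa> = symbol a"
  let ?X = "symbol a ` closed_strip \<eta>"
  have open_X: "open (- ?X)"
    using compact_symbol_image[OF assms(1)] by (simp add: compact_imp_closed open_Compl)
  from strip_bounded_inverse_diff[OF symbol_strip_bounded[OF a] \<eta>, of "s + 2"]
  obtain D where D: "\<And>\<mu> d. 0 < d \<Longrightarrow> (\<And>z. z \<in> open_strip \<eta> \<Longrightarrow> d \<le> cmod (\<kappa> z - \<mu>)) \<Longrightarrow>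
     strip_bounded \<eta> (s + 2) (D * (1 / d) * (1 + 1 / d) ^ (s + 2)) (\<lambda>z. 1 / (\<kappa> z - \<mu>))"
    unfolding \<kappa>_def by blast
  have "resolvent_pairing a t field_differentiable at \<mu>" if \<mu>: "\<mu> \<notin> ?X" for \<mu>
  proof -
    obtain d where d: "0 < d" "\<And>\<nu> z. \<nu> \<in> ball \<mu> d \<Longrightarrow> z \<in> open_strip \<eta> \<Longrightarrow> d \<le> cmod (\<kappa> z - \<nu>)"
      using far_from_symbol[OF a \<mu>] unfolding \<kappa>_def by blast
    define B where "B = D * (1 / d) * (1 + 1 / d) ^ (s + 2)"
    define g where "g = (\<lambda>\<nu> z. 1 / (\<kappa> z - \<nu>))"
    have g: "strip_bounded \<eta> (s + 2) B (g \<nu>)" if "\<nu> \<in> ball \<mu> d" for \<nu>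
      unfolding B_def g_def using D[OF d(1) d(2)[OF that]] by blast
    define B2 where "B2 = 2 ^ (s + 2) * (B * B)"
    define B3 where "B3 = 2 ^ (s + 2) * (B2 * B)"
    have \<mu>d: "\<mu> \<in> ball \<mu> d" using d(1) by simp
    have g2: "strip_bounded \<eta> (s + 2) B2 (\<lambda>z. g \<mu> z * g \<mu> z)"
      unfolding B2_def by (rule strip_bounded_mult[OF g[OF \<mu>d] g[OF \<mu>d] \<eta>])
    have g3: "strip_bounded \<eta> (s + 2) B3 (\<lambda>z. g \<mu> z * g \<mu> z * g \<nu> z)" if "\<nu> \<in> ball \<mu> d" for \<nu>
      unfolding B3_def by (rule strip_bounded_mult[OF g2 g[OF that] \<eta>])
    define Dq where "Dq = pairing t (\<lambda>z. g \<mu> z * g \<mu> z)"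
    define E where "E = C * 2 ^ (s + 2) * B3 * inverse_square_total"
    have step: "cmod ((resolvent_pairing a t \<nu> - resolvent_pairing a t \<mu>) / (\<nu> - \<mu>) - Dq) \<le> cmod (\<nu> - \<mu>) * E"
      if \<nu>: "\<nu> \<in> ball \<mu> d" "\<nu> \<noteq> \<mu>" for \<nu>
    proof -
      define w where "w = \<nu> - \<mu>"
            have "pairing t (\<lambda>z. 1 * g \<nu> z + (- 1) * g \<mu> z) =
          pairing t (\<lambda>z. w * (g \<mu> z * g \<mu> z) + (w * w) * (g \<mu> z * g \<mu> z * g \<nu> z))"
      proof (rule pairing_cong[OF _ \<eta>])
        fix z assume z: "z \<in> open_strip \<eta>"
        have "\<kappa> z - \<nu> \<noteq> 0" "\<kappa> z - \<mu> \<noteq> 0"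
          using d(2)[OF \<nu>(1) z] d(2)[OF \<mu>d z] d(1) by auto
        moreover have "w = (\<kappa> z - \<mu>) - (\<kappa> z - \<nu>)" by (simp add: w_def)
        moreover have "1 * (1 / y) + - 1 * (1 / x) = (x - y) * (1 / x * (1 / x)) + (x - y) * (x - y) * (1 / x * (1 / x) * (1 / y))"
          if "x \<noteq> 0" "y \<noteq> 0" for x y :: complex
          using that by (simp add: divide_simps) (simp add: algebra_simps)
        ultimately show "1 * g \<nu> z + (- 1) * g \<mu> z = w * (g \<mu> z * g \<mu> z) + (w * w) * (g \<mu> z * g \<mu> z * g \<nu> z)"
          unfolding g_def by blast
      qed
      moreover have "pairing t (\<lambda>z. 1 * g \<nu> z + (- 1) * g \<mu> z) = 1 * pairing t (g \<nu>) + (- 1) * pairing t (g \<mu>)"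
        by (rule pairing_lincomb[OF t \<eta> g[OF \<nu>(1)] g[OF \<mu>d]])
      moreover have "pairing t (\<lambda>z. w * (g \<mu> z * g \<mu> z) + (w * w) * (g \<mu> z * g \<mu> z * g \<nu> z)) =
          w * Dq + (w * w) * pairing t (\<lambda>z. g \<mu> z * g \<mu> z * g \<nu> z)"
        unfolding Dq_def by (rule pairing_lincomb[OF t \<eta> g2 g3[OF \<nu>(1)]])
      ultimately have "resolvent_pairing a t \<nu> - resolvent_pairing a t \<mu> =
          w * Dq + (w * w) * pairing t (\<lambda>z. g \<mu> z * g \<mu> z * g \<nu> z)"
        by (simp add: resolvent_pairing_def g_def \<kappa>_def)
      then have "(resolvent_pairing a t \<nu> - resolvent_pairing a t \<mu>) / (\<nu> - \<mu>) - Dq =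
          w * pairing t (\<lambda>z. g \<mu> z * g \<mu> z * g \<nu> z)"
        using \<nu>(2) by (simp add: w_def [symmetric] add_divide_distrib) (simp add: w_def)
      moreover have "cmod (pairing t (\<lambda>z. g \<mu> z * g \<mu> z * g \<nu> z)) \<le> E"
        unfolding E_def by (rule pairing_bound[OF t g3[OF \<nu>(1)] \<eta>])
      ultimately show ?thesis by (simp add: norm_mult w_def mult_left_mono)
    qed
    have "((\<lambda>\<nu>. (resolvent_pairing a t \<nu> - resolvent_pairing a t \<mu>) / (\<nu> - \<mu>)) \<longlongrightarrow> Dq) (at \<mu>)"
    proof (rule Lim_null[THEN iffD2], rule Lim_null_comparison)
      show "eventually (\<lambda>\<nu>. cmod ((resolvent_pairing a t \<nu> - resolvent_pairing a t \<mu>) / (\<nu> - \<mu>) - Dq) \<le> cmod (\<nu> - \<mu>) * E) (at \<mu>)"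
        by (rule eventually_mono[OF eventually_at_in_open[OF open_ball \<mu>d]]) (use step in blast)
      have "((\<lambda>\<nu>. cmod (\<nu> - \<mu>) * E) \<longlongrightarrow> cmod (\<mu> - \<mu>) * E) (at \<mu>)" by (intro tendsto_intros)
      then show "((\<lambda>\<nu>. cmod (\<nu> - \<mu>) * E) \<longlongrightarrow> 0) (at \<mu>)" by simp
    qed
    then show ?thesis
      unfolding field_differentiable_def has_field_derivative_iff by blast
  qed
  then show ?thesis
    using open_X by (auto simp: holomorphic_on_open field_differentiable_def)
qed

lemma strip_bounded_resolvent:
  assumes "rapid \<eta> a" "0 < \<eta>" "\<mu> \<notin> symbol a ` closed_strip \<eta>"
  obtains B where "strip_bounded \<eta> N B (\<lambda>z. 1 / (symbol a z - \<mu>))"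
proof -
  obtain d where d: "0 < d" "\<And>\<nu> z. \<nu> \<in> ball \<mu> d \<Longrightarrow> z \<in> open_strip \<eta> \<Longrightarrow> d \<le> cmod (symbol a z - \<nu>)"
    using far_from_symbol[OF assms(1,3)] by blast
  from strip_bounded_inverse_diff[OF symbol_strip_bounded[OF assms(1)] assms(2), of N]
  obtain D where D: "\<And>\<mu> d. 0 < d \<Longrightarrow> (\<And>z. z \<in> open_strip \<eta> \<Longrightarrow> d \<le> cmod (symbol a z - \<mu>)) \<Longrightarrow>
     strip_bounded \<eta> N (D * (1 / d) * (1 + 1 / d) ^ N) (\<lambda>z. 1 / (symbol a z - \<mu>))" by blast
  show thesis
    by (rule that[OF D[OF d(1) d(2)]]) (use d(1) in auto)
qed

text \<open>Pair \<open>\<kappa> / (\<kappa> - \<mu>) = 1 + \<mu> / (\<kappa> - \<mu>)\<close> with \<open>t\<close>; the constant function \<open>1\<close> picks out \<open>t 0\<close>.\<close>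

lemma resolvent_pairing_shift:
  assumes a: "rapid \<eta> a" and t: "\<And>j. cmod (t j) \<le> C * weight \<eta> s j" and \<eta>: "0 < \<eta>"
    and \<mu>: "\<mu> \<notin> symbol a ` closed_strip \<eta>"
  shows "resolvent_pairing a (shift_operator a t) \<mu> = t 0 + \<mu> * resolvent_pairing a t \<mu>"
proof -
  obtain B where g: "strip_bounded \<eta> (s + 2) B (\<lambda>z. 1 / (symbol a z - \<mu>))"
    using strip_bounded_resolvent[OF a \<eta> \<mu>] by blast
  have "resolvent_pairing a (shift_operator a t) \<mu> = pairing t (\<lambda>z. symbol a z * (1 / (symbol a z - \<mu>)))"
    unfolding resolvent_pairing_def by (rule pairing_symbol_mult[OF a t \<eta> g, symmetric])
  also have "\<dots> = pairing t (\<lambda>z. 1 * 1 + \<mu> * (1 / (symbol a z - \<mu>)))"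
  proof (rule pairing_cong[OF _ \<eta>])
    fix z assume "z \<in> open_strip \<eta>"
    then have "symbol a z - \<mu> \<noteq> 0" using \<mu> open_strip_subset by auto
    then show "symbol a z * (1 / (symbol a z - \<mu>)) = 1 * 1 + \<mu> * (1 / (symbol a z - \<mu>))"
      by (simp add: field_simps)
  qed
  also have "\<dots> = 1 * pairing t (\<lambda>_. 1) + \<mu> * pairing t (\<lambda>z. 1 / (symbol a z - \<mu>))"
    by (rule pairing_lincomb[OF t \<eta> strip_bounded_const g])
  finally show ?thesis by (simp add: pairing_const resolvent_pairing_def)
qed

definition shift_minus :: "(int \<Rightarrow> complex) \<Rightarrow> complex \<Rightarrow> (int \<Rightarrow> complex) \<Rightarrow> int \<Rightarrow> complex" where
  "shift_minus a c t j = shift_operator a t j - c * t j"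

definition shift_product :: "(int \<Rightarrow> complex) \<Rightarrow> complex list \<Rightarrow> (int \<Rightarrow> complex) \<Rightarrow> int \<Rightarrow> complex" where
  "shift_product a cs = foldr (shift_minus a) cs"

lemma shift_product_simps [simp]:
  "shift_product a [] t = t"
  "shift_product a (c # cs) t = shift_minus a c (shift_product a cs t)"
  by (simp_all add: shift_product_def)

lemma shift_minus_bound:
  assumes a: "rapid \<eta> a" and t: "\<And>j. cmod (t j) \<le> C * weight \<eta> s j" and \<eta>: "0 < \<eta>"
  obtains C' where "\<And>j. cmod (shift_minus a c t j) \<le> C' * weight \<eta> s j"
proof (rule that)
  fix j
  have "cmod (shift_minus a c t j) \<le> cmod (shift_operator a t j) + cmod c * cmod (t j)"
    unfolding shift_minus_def norm_mult [symmetric] by (rule norm_triangle_ineq4)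
  also have "\<dots> \<le> (\<Sum>\<^sub>\<infinity>i. cmod (a i) * weight \<eta> s i) * (C * weight \<eta> s j) + cmod c * (C * weight \<eta> s j)"
    using \<eta> by (intro add_mono shift_operator_bound[OF a t] mult_left_mono t) auto
  finally show "cmod (shift_minus a c t j) \<le>
      ((\<Sum>\<^sub>\<infinity>i. cmod (a i) * weight \<eta> s i) * C + cmod c * C) * weight \<eta> s j"
    by (simp add: algebra_simps)
qed

lemma resolvent_pairing_shift_minus:
  assumes a: "rapid \<eta> a" and t: "\<And>j. cmod (t j) \<le> C * weight \<eta> s j" and \<eta>: "0 < \<eta>"
    and \<mu>: "\<mu> \<notin> symbol a ` closed_strip \<eta>"
  shows "resolvent_pairing a (shift_minus a c t) \<mu> = t 0 + (\<mu> - c) * resolvent_pairing a t \<mu>"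
proof -
  obtain B where g: "strip_bounded \<eta> (s + 2) B (\<lambda>z. 1 / (symbol a z - \<mu>))"
    using strip_bounded_resolvent[OF a \<eta> \<mu>] by blast
  have st: "cmod (shift_operator a t j) \<le> (\<Sum>\<^sub>\<infinity>i. cmod (a i) * weight \<eta> s i) * C * weight \<eta> s j" for j
    using shift_operator_bound[OF a t, of j] \<eta> by (simp add: mult.assoc)
  have "resolvent_pairing a (shift_minus a c t) \<mu> =
      resolvent_pairing a (shift_operator a t) \<mu> - c * resolvent_pairing a t \<mu>"
    unfolding resolvent_pairing_def shift_minus_def [abs_def]
    by (rule pairing_lincomb_left[OF st t \<eta> g])
  then show ?thesis
    unfolding resolvent_pairing_shift[OF assms] by (simp add: algebra_simps)
qed

lemma shift_product_bound:
  assumes a: "rapid \<eta> a" and t: "\<And>j. cmod (t j) \<le> C * weight \<eta> s j" and \<eta>: "0 < \<eta>"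
  shows "\<exists>C'. \<forall>j. cmod (shift_product a cs t j) \<le> C' * weight \<eta> s j"
proof (induction cs)
  case (Cons c cs)
  then obtain C' where "\<And>j. cmod (shift_product a cs t j) \<le> C' * weight \<eta> s j" by blast
  from shift_minus_bound[OF a this \<eta>] show ?case unfolding shift_product_simps by blast
qed (use t in auto)

text \<open>Each factor \<open>shift_operator a - c\<close> multiplies the transform by \<open>\<mu> - c\<close> and adds a constant.\<close>

lemma resolvent_pairing_shift_product:
  assumes a: "rapid \<eta> a" and t: "\<And>j. cmod (t j) \<le> C * weight \<eta> s j" and \<eta>: "0 < \<eta>"
  shows "\<exists>Q. Q holomorphic_on UNIV \<and> (\<forall>\<mu>. \<mu> \<notin> symbol a ` closed_strip \<eta> \<longrightarrow>
     resolvent_pairing a (shift_product a cs t) \<mu> = (\<Prod>c\<leftarrow>cs. \<mu> - c) * resolvent_pairing a t \<mu> + Q \<mu>)"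
proof (induction cs)
  case Nil
  show ?case by (rule exI[of _ "\<lambda>_. 0"]) auto
next
  case (Cons c cs)
  then obtain Q where Q: "Q holomorphic_on UNIV"
    "\<And>\<mu>. \<mu> \<notin> symbol a ` closed_strip \<eta> \<Longrightarrow>
      resolvent_pairing a (shift_product a cs t) \<mu> = (\<Prod>c\<leftarrow>cs. \<mu> - c) * resolvent_pairing a t \<mu> + Q \<mu>" by blast
  obtain C' where C': "\<And>j. cmod (shift_product a cs t j) \<le> C' * weight \<eta> s j"
    using shift_product_bound[OF a t \<eta>] by blast
  show ?case
  proof (intro exI[of _ "\<lambda>\<mu>. shift_product a cs t 0 + (\<mu> - c) * Q \<mu>"] conjI allI impI)
    show "(\<lambda>\<mu>. shift_product a cs t 0 + (\<mu> - c) * Q \<mu>) holomorphic_on UNIV"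
      by (intro holomorphic_intros Q(1))
    fix \<mu> assume \<mu>: "\<mu> \<notin> symbol a ` closed_strip \<eta>"
    show "resolvent_pairing a (shift_product a (c # cs) t) \<mu> =
        (\<Prod>c\<leftarrow>c # cs. \<mu> - c) * resolvent_pairing a t \<mu> + (shift_product a cs t 0 + (\<mu> - c) * Q \<mu>)"
      using resolvent_pairing_shift_minus[OF a C' \<eta> \<mu>, of c] Q(2)[OF \<mu>] by (simp add: algebra_simps)
  qed
qed

text \<open>Applying \<open>resolvent_pairing_shift\<close> along the chain \<open>t 1, t 2, \<dots>\<close> peels off one power of \<open>\<mu>\<close> at a time.
The remainder is \<open>\<mu> ^ N\<close> times the transform of \<open>t N\<close>, which is bounded because all \<open>t n\<close> obey the same
growth bound.\<close>

lemma resolvent_pairing_power_series: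
  assumes a: "rapid \<eta> a" and \<eta>: "0 < \<eta>"
    and t: "\<And>n j. cmod (t n j) \<le> C * weight \<eta> s j" and rec: "\<And>n. shift_operator a (t (Suc n)) = t n"
    and \<mu>: "\<mu> \<notin> symbol a ` closed_strip \<eta>" "cmod \<mu> < 1"
  shows "(\<lambda>n. t (Suc n) 0 * \<mu> ^ n) sums resolvent_pairing a (t 0) \<mu>"
proof -
  define x where "x = (\<lambda>n. resolvent_pairing a (t n) \<mu>)"
  have x: "x n = t (Suc n) 0 + \<mu> * x (Suc n)" for n
    using resolvent_pairing_shift[where t = "t (Suc n)", OF a t \<eta> \<mu>(1)] by (simp add: x_def rec)
  have part: "x 0 - (\<Sum>n<N. t (Suc n) 0 * \<mu> ^ n) = \<mu> ^ N * x N" for N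
  proof (induction N)
    case (Suc N)
    have "x 0 - (\<Sum>n<Suc N. t (Suc n) 0 * \<mu> ^ n) = \<mu> ^ N * x N - t (Suc N) 0 * \<mu> ^ N"
      using Suc by (simp add: algebra_simps)
    then show ?case using x[of N] by (simp add: algebra_simps)
  qed simp
  obtain B where g: "strip_bounded \<eta> (s + 2) B (\<lambda>z. 1 / (symbol a z - \<mu>))"
    using strip_bounded_resolvent[OF a \<eta> \<mu>(1)] by blast
  define D where "D = C * 2 ^ (s + 2) * B * inverse_square_total"
  have D: "cmod (x N) \<le> D" for N
    unfolding x_def D_def resolvent_pairing_def by (rule pairing_bound[where t = "t N", OF t g \<eta>])
  have "(\<lambda>N. cmod \<mu> ^ N * D) \<longlonglongrightarrow> 0 * D"
    using \<mu>(2) by (intro tendsto_intros LIMSEQ_realpow_zero) auto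
  then have lim: "(\<lambda>N. cmod \<mu> ^ N * D) \<longlonglongrightarrow> 0" by simp
  have "(\<lambda>N. \<mu> ^ N * x N) \<longlonglongrightarrow> 0"
    by (rule Lim_null_comparison[OF always_eventually lim])
      (simp add: norm_mult norm_power D mult_left_mono)
  then have "(\<lambda>N. x 0 - \<mu> ^ N * x N) \<longlonglongrightarrow> x 0 - 0"
    by (rule tendsto_diff[OF tendsto_const])
  moreover have "(\<Sum>n<N. t (Suc n) 0 * \<mu> ^ n) = x 0 - \<mu> ^ N * x N" for N
    unfolding part [symmetric] by simp
  ultimately show ?thesis by (simp add: sums_def x_def)
qed

text \<open>Let \<open>X\<close> be the range of the symbol, \<open>Z\<close> its intersection with the unit circle and \<open>G\<close> the transform of
\<open>t 0\<close>. The power series continues \<open>G\<close> across \<open>X\<close> to the open unit disc, so the continuation \<open>F\<close> is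
holomorphic off the finite set \<open>Z\<close>. Since all \<open>t n 0\<close> are bounded by \<open>C\<close>, comparison with a geometric
series gives the first order bound inside the disc; outside, the distance from \<open>\<mu>\<close> to the symbol is at
least \<open>\<bar>\<mu>\<bar> - 1\<close>. So \<open>F\<close> has at most simple poles, the polynomial \<open>P\<close> with zeros in \<open>cs\<close> cancels them, and
the transform of \<open>shift_product a cs (t 0)\<close> continues to an entire function that vanishes at infinity.\<close>

theorem shift_product_annihilates:
  assumes a: "rapid \<eta> a" and \<eta>: "0 < \<eta>"
    and t: "\<And>n j. cmod (t n j) \<le> C * weight \<eta> s j" and rec: "\<And>n. shift_operator a (t (Suc n)) = t n"
    and le: "\<And>z. z \<in> closed_strip \<eta> \<Longrightarrow> cmod (symbol a z) \<le> 1"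
    and cs: "\<And>z. z \<in> closed_strip \<eta> \<Longrightarrow> cmod (symbol a z) = 1 \<Longrightarrow> symbol a z \<in> set cs"
  shows "shift_product a cs (t 0) 0 = 0"
proof -
  define X where "X = symbol a ` closed_strip \<eta>"
  define Z where "Z = X \<inter> sphere 0 1"
  define G where "G = resolvent_pairing a (t 0)"
  define F where "F = (\<lambda>\<mu>. if cmod \<mu> < 1 then \<Sum>n. t (Suc n) 0 * \<mu> ^ n else G \<mu>)"
  have C: "0 \<le> C" using t[of 0 0] norm_ge_zero[of "t 0 0"] by (simp del: norm_ge_zero)
  have Zcs: "Z \<subseteq> set cs" using cs by (auto simp: Z_def X_def)
  then have finZ: "finite Z" using finite_subset by blast
  have Xle: "X \<subseteq> cball 0 1" using le by (auto simp: X_def)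
  have t0: "cmod (t n 0) \<le> C" for n using t[of n 0] by simp
  have series: "summable (\<lambda>n. t (Suc n) 0 * \<mu> ^ n)" "cmod (\<Sum>n. t (Suc n) 0 * \<mu> ^ n) \<le> C / (1 - cmod \<mu>)"
    if "cmod \<mu> < 1" for \<mu>
  proof -
    have geo: "(\<lambda>n. C * cmod \<mu> ^ n) sums (C * (1 / (1 - cmod \<mu>)))"
      using that by (intro sums_mult geometric_sums) simp
    have le': "cmod (t (Suc n) 0 * \<mu> ^ n) \<le> C * cmod \<mu> ^ n" for n
      by (simp add: norm_mult norm_power mult_right_mono t0)
    show "summable (\<lambda>n. t (Suc n) 0 * \<mu> ^ n)"
      by (rule summable_comparison_test'[OF sums_summable[OF geo]]) (use le' in auto)
    show "cmod (\<Sum>n. t (Suc n) 0 * \<mu> ^ n) \<le> C / (1 - cmod \<mu>)"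
      using norm_suminf_le[OF le' sums_summable[OF geo]] sums_unique[OF geo] by simp
  qed
  have FG: "F \<mu> = G \<mu>" if "\<mu> \<notin> X" for \<mu>
    using resolvent_pairing_power_series[where t = t, OF a \<eta> t rec that[unfolded X_def]]
    by (auto simp: F_def G_def sums_iff)
  have holF: "F holomorphic_on - Z"
  proof -
    have "F holomorphic_on - X"
      by (rule holomorphic_transform[OF resolvent_pairing_holomorphic[where t = "t 0", OF a t \<eta>, folded X_def]])
        (use FG in \<open>auto simp: G_def\<close>)
    moreover have "F holomorphic_on ball 0 1"
    proof -
      have "(\<lambda>\<mu>. \<Sum>n. t (Suc n) 0 * (\<mu> - 0) ^ n) holomorphic_on ball 0 1"
        by (rule power_series_holomorphic) (use series(1) in \<open>auto intro: summable_sums\<close>)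
      then show ?thesis
        by (rule holomorphic_transform) (auto simp: F_def)
    qed
    moreover have "open (- X)"
      using compact_symbol_image[OF a] by (simp add: X_def compact_imp_closed open_Compl)
    ultimately have "F holomorphic_on (- X \<union> ball 0 1)"
      by (intro holomorphic_on_Un) auto
    moreover have "- X \<union> ball 0 1 = - Z"
      using Xle by (auto simp: Z_def)
    ultimately show ?thesis by simp
  qed
  have outside_X: "\<mu> \<notin> X" if "1 < cmod \<mu>" for \<mu> using Xle that by auto
  have far: "cmod \<mu> - 1 \<le> cmod (symbol a z - \<mu>)" if "1 < cmod \<mu>" "z \<in> open_strip \<eta>" for \<mu> z
  proof -
    have "cmod (symbol a z) \<le> 1" using le that(2) open_strip_subset by blast
    moreover have "cmod \<mu> \<le> cmod (symbol a z) + cmod (symbol a z - \<mu>)"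
      using norm_triangle_sub[of \<mu> "symbol a z"] by (simp add: norm_minus_commute)
    ultimately show ?thesis by linarith
  qed
  obtain K where K: "0 \<le> K" "\<And>\<mu> d. 0 < d \<Longrightarrow> (\<And>z. z \<in> open_strip \<eta> \<Longrightarrow> d \<le> cmod (symbol a z - \<mu>)) \<Longrightarrow>
     cmod (G \<mu>) \<le> K * (1 / d) * (1 + 1 / d) ^ (s + 2)"
    using resolvent_pairing_bound[where t = "t 0", OF a t \<eta>] unfolding G_def by blast
  have simple: "(\<lambda>\<mu>. (\<mu> - \<zeta>) * F \<mu>) \<in> O[at \<zeta>](\<lambda>_. 1)" if \<zeta>: "\<zeta> \<in> Z" for \<zeta>
  proof -
    have "\<exists>R>0. R \<le> 1 \<and> ball \<zeta> R \<inter> Z \<subseteq> {\<zeta>}"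
    proof -
      have "open (- (Z - {\<zeta>}))" by (intro open_Compl finite_imp_closed finite_Diff finZ)
      moreover have "\<zeta> \<in> - (Z - {\<zeta>})" by simp
      ultimately obtain R where "R > 0" "ball \<zeta> R \<subseteq> - (Z - {\<zeta>})" by (meson open_contains_ball)
      then show ?thesis by (intro exI[of _ "min R 1"]) auto
    qed
    then obtain R where R: "0 < R" "R \<le> 1" "ball \<zeta> R \<inter> Z \<subseteq> {\<zeta>}" by blast
    have n\<zeta>: "cmod \<zeta> = 1" using \<zeta> by (simp add: Z_def)
    show ?thesis
    proof (rule at_most_simple_pole[where R = R and C = "max C (K * 2 ^ (s + 2))" and K = "s + 3"])
      show "F holomorphic_on ball \<zeta> R - {\<zeta>}"
        by (rule holomorphic_on_subset[OF holF]) (use R in auto)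
      show "0 \<le> max C (K * 2 ^ (s + 2))" using C by simp
      show "cmod (F z) \<le> max C (K * 2 ^ (s + 2)) / (1 - cmod z)" if "z \<in> ball \<zeta> R" "cmod z < 1" for z
        using order_trans[OF series(2)[OF that(2)] divide_right_mono[OF max.cobounded1]] that(2)
        by (simp add: F_def)
      show "cmod (F z) \<le> max C (K * 2 ^ (s + 2)) / (cmod z - 1) ^ (s + 3)" if z: "z \<in> ball \<zeta> R" "1 < cmod z" for z
      proof -
        define d where "d = cmod z - 1"
        have d: "0 < d" "d \<le> 1"
          using z R(2) n\<zeta> norm_triangle_ineq2[of z \<zeta>] by (auto simp: d_def dist_norm norm_minus_commute)
        have "cmod (F z) \<le> K * (1 / d) * (1 + 1 / d) ^ (s + 2)"
          using K(2)[OF d(1)] far[OF z(2)] FG[OF outside_X[OF z(2)]] by (simp add: d_def)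
        also have "\<dots> \<le> K * (1 / d) * (2 / d) ^ (s + 2)"
          using d K(1) by (intro mult_left_mono power_mono) (auto simp: field_simps)
        also have "\<dots> = K * 2 ^ (s + 2) / d ^ (s + 3)"
          using d by (simp add: power_divide numeral_eq_Suc)
        also have "\<dots> \<le> max C (K * 2 ^ (s + 2)) / d ^ (s + 3)"
          using d by (intro divide_right_mono) auto
        finally show ?thesis by (simp add: d_def)
      qed
    qed (use R n\<zeta> in auto)
  qed
  define t' where "t' = shift_product a cs (t 0)"
  obtain C' where t': "\<And>j. cmod (t' j) \<le> C' * weight \<eta> s j"
    using shift_product_bound[where t = "t 0", OF a t \<eta>] unfolding t'_def by blast
  define P where "P = (\<lambda>\<mu>. \<Prod>c\<leftarrow>cs. \<mu> - c)"
  obtain Q where Q: "Q holomorphic_on UNIV" "\<And>\<mu>. \<mu> \<notin> X \<Longrightarrow> resolvent_pairing a t' \<mu> = P \<mu> * G \<mu> + Q \<mu>"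
    using resolvent_pairing_shift_product[where t = "t 0", OF a t \<eta>] unfolding t'_def G_def X_def P_def by blast
  have holP: "P holomorphic_on S" for S
    unfolding P_def by (induction cs) (auto intro!: holomorphic_intros)
  define H0 where "H0 = (\<lambda>\<mu>. P \<mu> * F \<mu> + Q \<mu>)"
  have "\<exists>H. H holomorphic_on UNIV \<and> (\<forall>z\<in>UNIV - Z. H z = H0 z)"
  proof (rule removable_singularities[OF finZ])
    show "H0 holomorphic_on UNIV - Z"
      unfolding H0_def using holF by (intro holomorphic_intros holP holomorphic_on_subset[OF Q(1)]) (auto simp: Compl_eq_Diff_UNIV)
    fix \<zeta> assume \<zeta>: "\<zeta> \<in> Z"
    obtain xs ys where "cs = xs @ \<zeta> # ys" using \<zeta> Zcs by (metis split_list subsetD)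
    then have P: "P = (\<lambda>\<mu>. ((\<Prod>c\<leftarrow>xs. \<mu> - c) * (\<Prod>c\<leftarrow>ys. \<mu> - c)) * (\<mu> - \<zeta>))"
      by (simp add: P_def fun_eq_iff mult_ac)
    have cont: "((\<lambda>\<mu>. \<Prod>c\<leftarrow>us. \<mu> - c) \<longlongrightarrow> (\<Prod>c\<leftarrow>us. \<zeta> - c)) (at \<zeta>)" for us :: "complex list"
      by (induction us) (auto intro!: tendsto_intros)
    have bnd: "f \<in> O[at \<zeta>](\<lambda>_. 1)" if "(f \<longlongrightarrow> l) (at \<zeta>)" for f :: "complex \<Rightarrow> complex" and l
      by (rule bigoI_tendsto[where c = l]) (use that in auto)
    have "(\<lambda>\<mu>. ((\<Prod>c\<leftarrow>xs. \<mu> - c) * (\<Prod>c\<leftarrow>ys. \<mu> - c)) * ((\<mu> - \<zeta>) * F \<mu>)) \<in> O[at \<zeta>](\<lambda>_. 1 * 1)"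
      by (intro landau_o.big.mult simple[OF \<zeta>] bnd[OF tendsto_mult[OF cont cont]])
    then have "(\<lambda>\<mu>. P \<mu> * F \<mu>) \<in> O[at \<zeta>](\<lambda>_. 1)" by (simp add: P mult.assoc)
    moreover have "Q \<in> O[at \<zeta>](\<lambda>_. 1)"
    proof (rule bnd)
      have "isCont Q \<zeta>" using holomorphic_on_imp_continuous_on[OF Q(1)] by (simp add: continuous_on_eq_continuous_at)
      then show "(Q \<longlongrightarrow> Q \<zeta>) (at \<zeta>)" by (simp add: isCont_def)
    qed
    ultimately show "H0 \<in> O[at \<zeta>](\<lambda>_. 1)"
      unfolding H0_def by (rule sum_in_bigo)
  qed simp
  then obtain H where H: "H holomorphic_on UNIV" "\<And>z. z \<notin> Z \<Longrightarrow> H z = H0 z" by blast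
  have HG: "H \<mu> = resolvent_pairing a t' \<mu>" if "1 < cmod \<mu>" for \<mu>
    using H(2)[of \<mu>] outside_X[OF that] Q(2) FG by (auto simp: Z_def H0_def)
  have vanish: "((\<lambda>\<mu>. resolvent_pairing a u \<mu>) \<longlongrightarrow> 0) at_infinity"
    if u: "\<And>j. cmod (u j) \<le> D * weight \<eta> s j" for u D
  proof -
    obtain K where K: "0 \<le> K" "\<And>\<mu> d. 0 < d \<Longrightarrow> (\<And>z. z \<in> open_strip \<eta> \<Longrightarrow> d \<le> cmod (symbol a z - \<mu>)) \<Longrightarrow>
       cmod (resolvent_pairing a u \<mu>) \<le> K * (1 / d) * (1 + 1 / d) ^ (s + 2)"
      using resolvent_pairing_bound[OF a u \<eta>] by blast
    show ?thesis
    proof (rule Lim_null_comparison)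
      show "eventually (\<lambda>\<mu>. cmod (resolvent_pairing a u \<mu>) \<le> K * (1 / (cmod \<mu> - 1)) * (1 + 1 / (cmod \<mu> - 1)) ^ (s + 2)) at_infinity"
        unfolding eventually_at_infinity
        by (rule exI[of _ 2]) (use K(2) far in auto)
      have lim: "((\<lambda>x. K * (1 / (x - 1)) * (1 + 1 / (x - 1)) ^ (s + 2)) \<longlongrightarrow> K * 0 * (1 + 0) ^ (s + 2)) at_top"
      proof -
        have "((\<lambda>x::real. 1 / (x - 1)) \<longlongrightarrow> 0) at_top" by real_asymp
        then show ?thesis by (intro tendsto_intros)
      qed
      show "((\<lambda>\<mu>. K * (1 / (cmod \<mu> - 1)) * (1 + 1 / (cmod \<mu> - 1)) ^ (s + 2)) \<longlongrightarrow> 0) at_infinity"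
        using filterlim_compose[OF lim filterlim_norm_at_top] by simp
    qed
  qed
  have "(H \<longlongrightarrow> 0) at_infinity"
  proof (rule Lim_transform_eventually[OF vanish[OF t']])
    show "eventually (\<lambda>\<mu>. resolvent_pairing a t' \<mu> = H \<mu>) at_infinity"
      unfolding eventually_at_infinity by (rule exI[of _ 2]) (use HG in auto)
  qed
  then have "H \<mu> = 0" for \<mu> by (rule Liouville_weak_0[OF H(1)])
  then have zero: "resolvent_pairing a t' \<mu> = 0" if "1 < cmod \<mu>" for \<mu> using HG[OF that] by simp
  \<comment> \<open>a transform that vanishes near infinity determines \<open>t' 0\<close>: after one more shift it equals \<open>t' 0\<close>
    there, while every transform tends to zero\<close>
  have const: "resolvent_pairing a (shift_minus a 0 t') \<mu> = t' 0" if "1 < cmod \<mu>" for \<mu>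
    using resolvent_pairing_shift_minus[OF a t' \<eta> outside_X[OF that, unfolded X_def]] zero[OF that] by simp
  obtain C'' where "\<And>j. cmod (shift_minus a 0 t' j) \<le> C'' * weight \<eta> s j"
    using shift_minus_bound[OF a t' \<eta>] by blast
  from vanish[OF this] have "((\<lambda>_. t' 0) \<longlongrightarrow> 0) (at_infinity :: complex filter)"
  proof (rule Lim_transform_eventually)
    show "eventually (\<lambda>\<mu>. resolvent_pairing a (shift_minus a 0 t') \<mu> = t' 0) at_infinity"
      unfolding eventually_at_infinity by (rule exI[of _ 2]) (use const in auto)
  qed
  then have "t' 0 = 0"
    using tendsto_unique[OF trivial_limit_at_infinity tendsto_const] by blast
  then show ?thesis by (simp add: t'_def)
qed

lemma shift_minus_scale:
  assumes "A \<noteq> 0"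
  shows "shift_minus (\<lambda>j. a j / A) (c / A) (\<lambda>j. b * t j) = (\<lambda>j. (b / A) * shift_minus a c t j)"
proof
  fix j
  have "shift_operator (\<lambda>j. a j / A) (\<lambda>j. b * t j) j = (\<Sum>\<^sub>\<infinity>i. (b / A) * (a i * t (i + j)))"
    unfolding shift_operator_def by (intro infsum_cong) simp
  also have "\<dots> = (b / A) * shift_operator a t j"
    unfolding shift_operator_def by (rule infsum_cmult_right')
  finally show "shift_minus (\<lambda>j. a j / A) (c / A) (\<lambda>j. b * t j) j = (b / A) * shift_minus a c t j"
    using assms by (simp add: shift_minus_def field_simps)
qed

lemma shift_product_scale:
  assumes "A \<noteq> 0"
  shows "shift_product (\<lambda>j. a j / A) (map (\<lambda>c. c / A) cs) t = (\<lambda>j. (1 / A ^ length cs) * shift_product a cs t j)"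
proof (induction cs)
  case (Cons c cs)
  show ?case
    unfolding list.map shift_product_simps Cons shift_minus_scale[OF assms] by (simp add: mult.commute)
qed simp

lemma shift_product_annihilates_scaled:
  assumes a: "rapid \<eta> a" and \<eta>: "0 < \<eta>" and A: "A \<noteq> 0"
    and t: "\<And>n j. cmod (t n j) \<le> C * weight \<eta> s j"
    and rec: "\<And>n. shift_operator a (t (Suc n)) = (\<lambda>j. A * t n j)"
    and le: "\<And>z. z \<in> closed_strip \<eta> \<Longrightarrow> cmod (symbol a z) \<le> cmod A"
    and cs: "\<And>z. z \<in> closed_strip \<eta> \<Longrightarrow> cmod (symbol a z) = cmod A \<Longrightarrow> symbol a z \<in> set cs"
  shows "shift_product a cs (t 0) 0 = 0"
proof -
  have sym: "symbol (\<lambda>j. a j / A) z = symbol a z / A" for z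
  proof -
    have "symbol (\<lambda>j. a j / A) z = (\<Sum>\<^sub>\<infinity>j. (1 / A) * (a j * expi j z))"
      unfolding symbol_def by (intro infsum_cong) simp
    then show ?thesis unfolding infsum_cmult_right' symbol_def by simp
  qed
  have "shift_product (\<lambda>j. a j / A) (map (\<lambda>c. c / A) cs) (t 0) 0 = 0"
  proof (rule shift_product_annihilates[where \<eta> = \<eta> and t = t and C = C and s = s])
    show "rapid \<eta> (\<lambda>j. a j / A)"
      unfolding rapid_def
    proof
      fix s
      have "(\<lambda>j. (1 / cmod A) * (cmod (a j) * weight \<eta> s j)) summable_on UNIV"
        using a by (intro summable_on_cmult_right) (simp add: rapid_def)
      then show "(\<lambda>j. cmod (a j / A) * weight \<eta> s j) summable_on UNIV" by (simp add: norm_divide)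
    qed
    show "shift_operator (\<lambda>j. a j / A) (t (Suc n)) = t n" for n
    proof
      fix j
      have "shift_operator (\<lambda>j. a j / A) (t (Suc n)) j = (\<Sum>\<^sub>\<infinity>i. (1 / A) * (a i * t (Suc n) (i + j)))"
        unfolding shift_operator_def by (intro infsum_cong) simp
      also have "\<dots> = (1 / A) * shift_operator a (t (Suc n)) j"
        unfolding shift_operator_def by (rule infsum_cmult_right')
      finally show "shift_operator (\<lambda>j. a j / A) (t (Suc n)) j = t n j"
        using A by (simp add: rec)
    qed
    show "cmod (symbol (\<lambda>j. a j / A) z) \<le> 1" if "z \<in> closed_strip \<eta>" for z
      using le[OF that] A by (simp add: sym norm_divide)
    show "symbol (\<lambda>j. a j / A) z \<in> set (map (\<lambda>c. c / A) cs)"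
      if "z \<in> closed_strip \<eta>" "cmod (symbol (\<lambda>j. a j / A) z) = 1" for z
      using cs[OF that(1)] that(2) A by (simp add: sym norm_divide)
  qed (use \<eta> t in auto)
  then show ?thesis using A by (simp add: shift_product_scale[OF A])
qed

section \<open>Distances and spheres in a homogeneous tree\<close>

lemma rtranclp_imp_distinct_path:
  assumes "R\<^sup>*\<^sup>* u v"
  shows "\<exists>xs. xs \<noteq> [] \<and> hd xs = u \<and> last xs = v \<and> distinct xs \<and> successively R xs"
  using assms
proof (induction rule: converse_rtranclp_induct)
  case base
  show ?case by (rule exI[of _ "[v]"]) simp
next
  case (step u w)
  then obtain xs where xs: "xs \<noteq> []" "hd xs = w" "last xs = v" "distinct xs" "successively R xs" by blast
  show ?case
  proof (cases "u \<in> set xs")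
    case True
    then obtain ys zs where eq: "xs = ys @ u # zs" by (meson split_list)
    show ?thesis
      by (rule exI[of _ "u # zs"]) (use xs eq in \<open>auto simp: successively_append_iff\<close>)
  next
    case False
    then show ?thesis
      by (intro exI[of _ "u # xs"]) (use xs step.hyps in \<open>auto simp: successively_Cons\<close>)
  qed
qed

text \<open>The vertex \<open>r\<close> is the origin of the weights and of the boundary, whereas spheres are taken about
arbitrary vertices. Parents and children are therefore relative to a vertex given as first argument,
at which the tree is thought to be rooted.\<close>

locale rooted_homogeneous_tree =
  fixes E :: "'v \<Rightarrow> 'v \<Rightarrow> bool" and q :: nat and r :: 'v
  assumes tree: "homogeneous_tree E q" and q_ge_2: "2 \<le> q"
begin

abbreviation d :: "'v \<Rightarrow> 'v \<Rightarrow> nat" where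
  "d \<equiv> tree_dist E"

definition sphere_at :: "'v \<Rightarrow> nat \<Rightarrow> 'v set" where
  "sphere_at x n = {y. d x y = n}"

definition parent :: "'v \<Rightarrow> 'v \<Rightarrow> 'v" where
  "parent x y = (THE u. E y u \<and> d x u + 1 = d x y)"

definition children :: "'v \<Rightarrow> 'v \<Rightarrow> 'v set" where
  "children x y = {u. E y u \<and> d x u = d x y + 1}"

lemma E_sym: "E x y \<Longrightarrow> E y x"
  using tree by (auto simp: homogeneous_tree_def dest: sympD)

lemma E_irrefl [simp]: "\<not> E x x"
  using tree by (auto simp: homogeneous_tree_def irreflp_def)

lemma card_neighbours: "card {y. E x y} = q + 1"
  using tree by (auto simp: homogeneous_tree_def)

lemma finite_neighbours [simp]: "finite {y. E x y}"
  using card_neighbours[of x] by (metis add_is_0 card.infinite zero_neq_one)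

lemma no_cycle: "\<not> cycle E xs"
  using tree by (auto simp: homogeneous_tree_def)

lemma dist_walk: "(E ^^ d x y) x y"
proof -
  have "E\<^sup>*\<^sup>* x y" using tree by (auto simp: homogeneous_tree_def)
  then have "\<exists>n. (E ^^ n) x y" by (simp add: rtranclp_power)
  then show ?thesis unfolding tree_dist_def by (rule LeastI_ex)
qed

lemma dist_le: "(E ^^ n) x y \<Longrightarrow> d x y \<le> n"
  unfolding tree_dist_def by (rule Least_le)

lemma walk_sym: "(E ^^ n) x y \<Longrightarrow> (E ^^ n) y x"
proof (induction n arbitrary: y)
  case (Suc n)
  from Suc.prems obtain z where z: "(E ^^ n) x z" "E z y" by (auto elim: relpowp_Suc_E)
  show ?case by (rule relpowp_Suc_I2[OF E_sym[OF z(2)] Suc.IH[OF z(1)]])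
qed simp

lemma dist_sym: "d x y = d y x"
  by (rule antisym) (rule dist_le[OF walk_sym[OF dist_walk]])+

lemma dist_self [simp]: "d x x = 0"
  using dist_le[of 0 x x] by simp

lemma dist_eq_0 [simp]: "d x y = 0 \<longleftrightarrow> x = y"
  using dist_walk[of x y] by auto

lemma dist_triangle: "d x z \<le> d x y + d y z"
proof -
  have "(E ^^ (d x y + d y z)) x z"
    using dist_walk[of x y] dist_walk[of y z] by (auto simp: relpowp_add)
  then show ?thesis by (rule dist_le)
qed

lemma dist_edge [simp]: "E x y \<Longrightarrow> d x y = 1"
proof -
  assume "E x y"
  then have "d x y \<le> 1" "d x y \<noteq> 0"
    using dist_le[of 1 x y] by (auto simp del: dist_eq_0 simp: dist_eq_0)
  then show ?thesis by linarith
qed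

lemma dist_1_iff: "d x y = 1 \<longleftrightarrow> E x y"
  using dist_walk[of x y] by (metis dist_edge relpowp_1)

lemma dist_edge_le: "E y u \<Longrightarrow> d x u \<le> d x y + 1"
  using dist_triangle[of x u y] by simp

lemma closer_neighbour_exists:
  assumes "x \<noteq> y" shows "\<exists>u. E y u \<and> d x u + 1 = d x y"
proof -
  obtain n where n: "d x y = Suc n" using assms dist_eq_0 by (metis not0_implies_Suc)
  have "(E ^^ Suc n) x y" using dist_walk[of x y] n by simp
  then obtain u where u: "(E ^^ n) x u" "E u y" by (auto elim: relpowp_Suc_E)
  have "d x u \<le> n" using u(1) by (rule dist_le)
  moreover have "d x y \<le> d x u + 1" using u(2) by (rule dist_edge_le)
  ultimately show ?thesis using u n E_sym by (intro exI[of _ u]) auto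
qed

text \<open>From a vertex other than \<open>y\<close> that is not farther from \<open>x\<close> than \<open>y\<close> is, one can walk to \<open>x\<close> by approaching
it at every step, and such a walk avoids \<open>y\<close>. Two different such neighbours of \<open>y\<close> could thus be joined
by a path avoiding \<open>y\<close>, which \<open>y\<close> would close to a cycle. All uses of acyclicity go through this lemma.\<close>

lemma closer_neighbour_unique:
  assumes "E y u" "E y v" "d x u \<le> d x y" "d x v \<le> d x y"
  shows "u = v"
proof (rule ccontr)
  assume "u \<noteq> v"
  have "x \<noteq> y"
  proof
    assume "x = y"
    then show False using assms by auto
  qed
  define R where "R = (\<lambda>a b. E a b \<and> a \<noteq> y \<and> b \<noteq> y)"
  have to_x: "R\<^sup>*\<^sup>* w x" if "w \<noteq> y" "d x w \<le> d x y" for w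
    using that
  proof (induction "d x w" arbitrary: w)
    case 0
    then show ?case by simp
  next
    case (Suc n)
    then have "x \<noteq> w" by auto
    then obtain w' where w': "E w w'" "d x w' + 1 = d x w" using closer_neighbour_exists by blast
    then have "w' \<noteq> y" using Suc.prems by auto
    then have "R w w'" using w' Suc.prems by (simp add: R_def)
    moreover have "R\<^sup>*\<^sup>* w' x" using Suc w' \<open>w' \<noteq> y\<close> by auto
    ultimately show ?case by (rule converse_rtranclp_into_rtranclp)
  qed
  have neq: "u \<noteq> y" "v \<noteq> y" using assms by auto
  have "symp R" using E_sym by (auto simp: R_def symp_def)
  then have "R\<^sup>*\<^sup>* x v" using to_x[OF neq(2) assms(4)] by (metis symp_rtranclp sympD)
  with to_x[OF neq(1) assms(3)] have "R\<^sup>*\<^sup>* u v" by simp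
  then obtain xs where xs: "xs \<noteq> []" "hd xs = u" "last xs = v" "distinct xs" "successively R xs"
    using rtranclp_imp_distinct_path by metis
  obtain ys where ys: "xs = u # ys" "ys \<noteq> []" using xs \<open>u \<noteq> v\<close> by (cases xs) (fastforce split: if_splits)+
  have "y \<notin> set xs" if "successively R xs" "hd xs \<noteq> y" for xs
    using that by (induction xs rule: induct_list012) (auto simp: R_def)
  then have "y \<notin> set xs" using xs neq by auto
  moreover have "successively E xs" using xs(5) by (rule successively_mono) (simp add: R_def)
  ultimately have "cycle E (y # xs)"
    using xs ys assms E_sym by (auto simp: cycle_def successively_Cons Suc_le_eq)
  then show False using no_cycle by blast
qed

lemma parent:
  assumes "x \<noteq> y" shows "E y (parent x y)" "d x (parent x y) + 1 = d x y"
proof -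
  have "\<exists>!u. E y u \<and> d x u + 1 = d x y"
    using closer_neighbour_exists[OF assms] closer_neighbour_unique[of y _ _ x] by (metis le_add1)
  from theI'[OF this] show "E y (parent x y)" "d x (parent x y) + 1 = d x y"
    unfolding parent_def by auto
qed

lemma parent_eqI:
  assumes "E y u" "d x u \<le> d x y" shows "u = parent x y"
proof -
  have "x \<noteq> y" using assms by auto
  from parent[OF this] show ?thesis
    using closer_neighbour_unique[OF assms(1) _ assms(2)] by simp
qed

lemma neighbour_dist:
  assumes "E y u" shows "d x u = d x y + 1 \<or> d x u + 1 = d x y"
proof (cases "d x u \<le> d x y")
  case True
  have "x \<noteq> y" using assms True by auto
  then show ?thesis using parent_eqI[OF assms True] parent[of x y] by simp
next
  case False
  then show ?thesis using dist_edge_le[OF assms, of x] by simp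
qed

lemma finite_children [simp]: "finite (children x y)"
  by (rule finite_subset[OF _ finite_neighbours[of y]]) (auto simp: children_def)

lemma children_root: "children x x = {u. E x u}"
  by (auto simp: children_def)

lemma card_children_root: "card (children x x) = q + 1"
  by (simp only: children_root card_neighbours)

lemma neighbours_eq:
  assumes "x \<noteq> y" shows "{u. E y u} = insert (parent x y) (children x y)" "parent x y \<notin> children x y"
proof -
  have "z = parent x y \<or> z \<in> children x y" if "E y z" for z
    using neighbour_dist[OF that, of x] parent_eqI[OF that, of x] that by (auto simp: children_def)
  then show "{u. E y u} = insert (parent x y) (children x y)"
    using parent(1)[OF assms] by (auto simp: children_def)
  show "parent x y \<notin> children x y" using parent(2)[OF assms] by (auto simp: children_def)
qed

lemma card_children:
  assumes "x \<noteq> y" shows "card (children x y) = q"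
proof -
  have "card (insert (parent x y) (children x y)) = q + 1"
    using neighbours_eq(1)[OF assms] card_neighbours[of y] by simp
  then show ?thesis using neighbours_eq(2)[OF assms] by simp
qed

lemma sphere_at_0: "sphere_at x 0 = {x}"
  by (auto simp: sphere_at_def)

lemma sphere_at_1: "sphere_at x 1 = {u. E x u}"
  by (simp only: sphere_at_def dist_1_iff)

lemma sphere_at_Suc: "sphere_at x (Suc n) = (\<Union>y\<in>sphere_at x n. children x y)"
proof (intro equalityI subsetI)
  fix z assume z: "z \<in> sphere_at x (Suc n)"
  then have "x \<noteq> z" by (auto simp: sphere_at_def)
  from parent[OF this] z show "z \<in> (\<Union>y\<in>sphere_at x n. children x y)"
    by (auto simp: sphere_at_def children_def intro!: bexI[of _ "parent x z"] E_sym)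
qed (auto simp: sphere_at_def children_def)

lemma finite_sphere_at [simp]: "finite (sphere_at x n)"
  by (induction n) (auto simp: sphere_at_0 sphere_at_Suc)

lemma sum_sphere_at_Suc:
  "(\<Sum>z\<in>sphere_at x (Suc n). f z) = (\<Sum>y\<in>sphere_at x n. \<Sum>z\<in>children x y. f z)"
  unfolding sphere_at_Suc
proof (rule sum.UNION_disjoint)
  show "\<forall>y\<in>sphere_at x n. \<forall>y'\<in>sphere_at x n. y \<noteq> y' \<longrightarrow> children x y \<inter> children x y' = {}"
  proof (intro ballI impI equals0I)
    fix y y' z assume "y \<noteq> y'" "z \<in> children x y \<inter> children x y'"
    then have "E z y" "E z y'" "d x y \<le> d x z" "d x y' \<le> d x z" by (auto simp: children_def E_sym)
    then show False using closer_neighbour_unique \<open>y \<noteq> y'\<close> by blast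
  qed
qed auto

lemma card_sphere_at: "card (sphere_at x (Suc n)) = (q + 1) * q ^ n"
proof (induction n)
  case 0
  show ?case using sum_sphere_at_Suc[of "\<lambda>_. 1::nat" x 0]
    by (simp add: sphere_at_0 card_children_root del: sphere_at_Suc)
next
  case (Suc n)
  have "(\<Sum>y\<in>sphere_at x (Suc n). card (children x y)) = (\<Sum>y\<in>sphere_at x (Suc n). q)"
    by (intro sum.cong refl card_children) (auto simp: sphere_at_def)
  moreover have "card (sphere_at x (Suc (Suc n))) = (\<Sum>y\<in>sphere_at x (Suc n). card (children x y))"
    unfolding card_eq_sum by (rule sum_sphere_at_Suc)
  ultimately have "card (sphere_at x (Suc (Suc n))) = card (sphere_at x (Suc n)) * q" by simp
  then show ?case unfolding Suc by (simp add: algebra_simps)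
qed

lemma sphere_at_nonempty: "sphere_at x n \<noteq> {}"
proof (cases n)
  case 0
  then show ?thesis by (simp add: sphere_at_0)
next
  case (Suc m)
  have "0 < card (sphere_at x (Suc m))" using card_sphere_at[of x m] q_ge_2 by simp
  then show ?thesis using Suc by auto
qed

definition sphere_sum :: "nat \<Rightarrow> ('v \<Rightarrow> complex) \<Rightarrow> 'v \<Rightarrow> complex" where
  "sphere_sum n f x = (\<Sum>y\<in>sphere_at x n. f y)"

text \<open>Count the neighbours \<open>u\<close> of \<open>x\<close> from which a vertex \<open>y\<close> has distance \<open>n\<close>. If \<open>d x y = n + 1\<close>, only the parent
of \<open>x\<close> in the tree rooted at \<open>y\<close> qualifies; if \<open>d x y = n - 1\<close>, all children of \<open>x\<close> in that tree do, and
these are \<open>q\<close> in number, or \<open>q + 1\<close> when \<open>y = x\<close>.\<close>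

lemma sphere_sum_recurrence:
  assumes "1 \<le> n"
  shows "sphere_sum 1 (sphere_sum n f) x =
     sphere_sum (n + 1) f x + (if n = 1 then of_nat (q + 1) else of_nat q) * sphere_sum (n - 1) f x"
proof -
  define N where "N = {u. E x u}"
  define A where "A = sphere_at x (n + 1) \<union> sphere_at x (n - 1)"
  have inner: "sphere_at u n = {y\<in>A. d u y = n}" if "u \<in> N" for u
  proof -
    have "d z x = n + 1 \<or> d z x = n - 1" if "d z u = n" for z
      using neighbour_dist[of x u z] \<open>u \<in> N\<close> that by (auto simp: N_def)
    then have "d x z = n + 1 \<or> d x z = n - 1" if "d u z = n" for z
      using that dist_sym[of u z] dist_sym[of x z] by simp
    then show ?thesis by (auto simp: A_def sphere_at_def)
  qed
  have count1: "card {u\<in>N. d u y = n} = 1" if "y \<in> sphere_at x (n + 1)" for y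
  proof -
    have y: "d y x = n + 1" using that dist_sym[of y x] by (simp add: sphere_at_def)
    then have "y \<noteq> x" by auto
    have "u = parent y x" if "E x u" "d u y = n" for u
      using parent_eqI[of x u y] y that dist_sym[of u y] by simp
    moreover have "E x (parent y x)" "d (parent y x) y = n"
      using parent[OF \<open>y \<noteq> x\<close>] y dist_sym[of "parent y x" y] by auto
    ultimately have "{u\<in>N. d u y = n} = {parent y x}" unfolding N_def by blast
    then show ?thesis by simp
  qed
  have count2: "card {u\<in>N. d u y = n} = (if n = 1 then q + 1 else q)" if "y \<in> sphere_at x (n - 1)" for y
  proof -
    have y: "d y x = n - 1" using that dist_sym[of y x] by (simp add: sphere_at_def)
    then have "d u y = n \<longleftrightarrow> d y u = d y x + 1" for u
      using assms dist_sym[of u y] by auto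
    then have eq: "{u\<in>N. d u y = n} = children y x"
      by (simp add: N_def children_def)
    show ?thesis
    proof (cases "n = 1")
      case True
      then have "y = x" using y by simp
      then show ?thesis using True eq card_children_root by simp
    next
      case False
      then have "y \<noteq> x" using y assms by auto
      then show ?thesis using False eq card_children by simp
    qed
  qed
  have "sphere_sum 1 (sphere_sum n f) x = (\<Sum>u\<in>N. \<Sum>y\<in>{y\<in>A. d u y = n}. f y)"
    unfolding sphere_sum_def sphere_at_1 N_def [symmetric] using inner by (intro sum.cong) auto
  also have "\<dots> = (\<Sum>y\<in>A. \<Sum>u\<in>{u\<in>N. d u y = n}. f y)"
    by (rule sum.swap_restrict) (auto simp: N_def A_def)
  also have "\<dots> = (\<Sum>y\<in>A. of_nat (card {u\<in>N. d u y = n}) * f y)" by simp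
  also have "\<dots> = (\<Sum>y\<in>sphere_at x (n + 1). of_nat (card {u\<in>N. d u y = n}) * f y) +
      (\<Sum>y\<in>sphere_at x (n - 1). of_nat (card {u\<in>N. d u y = n}) * f y)"
    unfolding A_def
    by (rule sum.union_disjoint[OF finite_sphere_at finite_sphere_at]) (auto simp: sphere_at_def)
  also have "\<dots> = (\<Sum>y\<in>sphere_at x (n + 1). f y) +
      (\<Sum>y\<in>sphere_at x (n - 1). (if n = 1 then of_nat (q + 1) else of_nat q) * f y)"
    using count1 count2 by (intro arg_cong2[of _ _ _ _ "(+)"] sum.cong) auto
  finally show ?thesis by (simp add: sphere_sum_def sum_distrib_left)
qed

text \<open>A geodesic leaving \<open>x\<close> approaches \<open>r\<close> for some steps and from then on recedes from it. So either all
its \<open>n\<close> steps approached \<open>r\<close>, or the last one receded, and then \<open>y\<close> has the same predecessor seen from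
\<open>x\<close> and from \<open>r\<close>.\<close>

lemma nonbacktracking:
  assumes "d x y = n"
  shows "d r y + n = d r x \<or> (y \<noteq> x \<and> y \<noteq> r \<and> parent r y = parent x y)"
  using assms
proof (induction n arbitrary: y)
  case 0
  then show ?case by simp
next
  case (Suc n)
  then have "x \<noteq> y" by auto
  define p where "p = parent x y"
  have p: "E y p" "d x p = n" using parent[OF \<open>x \<noteq> y\<close>] Suc.prems by (auto simp: p_def)
  show ?case
  proof (cases "d r y = d r p + 1")
    case True
    then have "p = parent r y" using p(1) by (intro parent_eqI) auto
    then show ?thesis using True \<open>x \<noteq> y\<close> by (auto simp: p_def)
  next
    case False
    then have y: "d r y + 1 = d r p" using neighbour_dist[OF p(1), of r] by auto
    then have yp: "y = parent r p" using E_sym[OF p(1)] by (intro parent_eqI) auto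
    from Suc.IH[OF p(2)] show ?thesis
    proof
      assume "d r p + n = d r x"
      then show ?thesis using y by simp
    next
      assume *: "p \<noteq> x \<and> p \<noteq> r \<and> parent r p = parent x p"
      then have "d x y + 1 = d x p" using parent(2)[of x p] yp by auto
      then show ?thesis using p(2) Suc.prems by simp
    qed
  qed
qed

lemma geodesic_vertex_unique:
  assumes "d x y = n" "d x y' = n" "d r y + n = d r x" "d r y' + n = d r x"
  shows "y = y'"
  using assms
proof (induction n arbitrary: y y')
  case 0
  then show ?case by simp
next
  case (Suc n)
  have *: "d x (parent x z) = n \<and> d r (parent x z) + n = d r x \<and> z = parent r (parent x z)"
    if z: "d x z = Suc n" "d r z + Suc n = d r x" for z
  proof -
    have "x \<noteq> z" using z by auto
    note p = parent[OF this]
    have "d x (parent x z) = n" using p z by simp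
    moreover have "d r x \<le> d r (parent x z) + n"
      using dist_triangle[of r x "parent x z"] \<open>d x (parent x z) = n\<close>
      dist_sym[of "parent x z" x] by simp
    moreover have "d r (parent x z) \<le> d r z + 1" using p(1) by (rule dist_edge_le)
    ultimately show ?thesis using z parent_eqI[OF E_sym[OF p(1)], of r] by auto
  qed
  have "parent x y = parent x y'"
    using *[OF Suc.prems(1,3)] *[OF Suc.prems(2,4)] by (intro Suc.IH) auto
  then show ?case using *[OF Suc.prems(1,3)] *[OF Suc.prems(2,4)] by metis
qed

text \<open>Passing from a vertex \<open>y\<close> of the sphere of radius \<open>n\<close> to its children multiplies the summand by at most
\<open>q / \<beta> \<le> \<beta>\<close>, except when a child is nearer to \<open>r\<close>. By \<open>nonbacktracking\<close> this happens only at the one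
vertex of the sphere that lies on the geodesic from \<open>x\<close> to \<open>r\<close>, where it adds at most \<open>\<beta> ^ (n + 1) * (1 / \<beta>) ^ d r x\<close>. One such
contribution in every generation produces the linear factor. The root itself, with its \<open>q + 1\<close>
children, is covered by the same extra term.\<close>

lemma sum_sphere_power_le:
  fixes \<beta> :: real
  assumes \<beta>: "1 \<le> \<beta>" "real q \<le> \<beta> ^ 2"
  shows "(\<Sum>y\<in>sphere_at x n. (1 / \<beta>) ^ d r y) \<le> (real n + 1) * \<beta> ^ n * (1 / \<beta>) ^ d r x"
proof (induction n)
  case 0
  show ?case by (simp add: sphere_at_0)
next
  case (Suc n)
  define \<Psi> where "\<Psi> = (\<lambda>y. (1 / \<beta>) ^ d r y)"
  have \<Psi>: "0 \<le> \<Psi> y" for y using \<beta> by (simp add: \<Psi>_def)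
  have q\<beta>: "real q / \<beta> \<le> \<beta>" "1 / \<beta> \<le> \<beta>"
    using \<beta> mult_mono[of 1 \<beta> 1 \<beta>] by (auto simp: field_simps power2_eq_square)
  define on_geodesic where "on_geodesic = {y\<in>sphere_at x n. d r y + n = d r x}"
  have inner: "(\<Sum>z\<in>children x y. \<Psi> z) \<le> real q / \<beta> * \<Psi> y + (if y \<in> on_geodesic then \<beta> * \<Psi> y else 0)"
    if y: "y \<in> sphere_at x n" for y
  proof -
    define up where "up = {z\<in>children x y. d r z = d r y + 1}"
    define down where "down = {z\<in>children x y. d r z + 1 = d r y}"
    have fin: "finite up" "finite down" by (auto simp: up_def down_def)
    have ch: "children x y = up \<union> down" "up \<inter> down = {}"
      using neighbour_dist[of y _ r] by (auto simp: up_def down_def children_def)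
    have "(\<Sum>z\<in>children x y. \<Psi> z) = (\<Sum>z\<in>up. \<Psi> z) + (\<Sum>z\<in>down. \<Psi> z)"
      unfolding ch(1) by (rule sum.union_disjoint[OF fin ch(2)])
    also have "(\<Sum>z\<in>up. \<Psi> z) = real (card up) * (\<Psi> y / \<beta>)"
      by (simp add: up_def \<Psi>_def)
    also have "(\<Sum>z\<in>down. \<Psi> z) = (\<Sum>z\<in>down. \<beta> * \<Psi> y)"
    proof (rule sum.cong[OF refl])
      fix z assume "z \<in> down"
      then have "d r y = Suc (d r z)" by (simp add: down_def)
      then show "\<Psi> z = \<beta> * \<Psi> y" using \<beta> by (simp add: \<Psi>_def)
    qed
    also have "\<dots> = real (card down) * (\<beta> * \<Psi> y)" by simp
    finally have eq: "(\<Sum>z\<in>children x y. \<Psi> z) = real (card up) * (\<Psi> y / \<beta>) + real (card down) * (\<beta> * \<Psi> y)" .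
    have down_sub: "down \<subseteq> {parent r y}"
    proof
      fix z assume "z \<in> down"
      then have "E y z" "d r z \<le> d r y" by (auto simp: down_def children_def)
      then show "z \<in> {parent r y}" using parent_eqI by blast
    qed
    then have card_down: "card down \<le> 1" using card_mono[OF _ down_sub] by simp
    have down_on_geodesic: "down = {}" if "y \<notin> on_geodesic"
    proof (rule equals0I)
      fix z assume z: "z \<in> down"
      have "y \<noteq> x \<and> y \<noteq> r \<and> parent r y = parent x y"
        using nonbacktracking[of x y n] y that by (auto simp: on_geodesic_def sphere_at_def)
      moreover from this have "z = parent r y" using z down_sub by auto
      ultimately have "d x z + 1 = d x y" using parent(2)[of x y] by auto
      then show False using z by (auto simp: down_def children_def)
    qed
    show ?thesis
    proof (cases "x = r \<and> y = r")
      case True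
      then have "y \<in> on_geodesic" using y by (auto simp: on_geodesic_def sphere_at_def)
      have "down = {}" using True by (auto simp: down_def)
      then have "up = children x y" using ch by auto
      then have "card up = q + 1" using True card_children_root by simp
      then have "(\<Sum>z\<in>children x y. \<Psi> z) = real q / \<beta> * \<Psi> y + (1 / \<beta>) * \<Psi> y"
        unfolding eq using \<open>down = {}\<close> by (simp add: add_divide_distrib distrib_right)
      also have "\<dots> \<le> real q / \<beta> * \<Psi> y + \<beta> * \<Psi> y"
        using q\<beta>(2) \<Psi> by (intro add_left_mono mult_right_mono) auto
      finally show ?thesis using \<open>y \<in> on_geodesic\<close> by simp
    next
      case False
      have "card up \<le> q"
      proof (cases "x = y")
        case True
        then have "r \<noteq> y" using False by auto
        have "up \<subseteq> children r y" by (auto simp: up_def children_def)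
        from card_mono[OF _ this] show ?thesis using card_children[OF \<open>r \<noteq> y\<close>] by simp
      next
        case False
        have "up \<subseteq> children x y" by (auto simp: up_def)
        from card_mono[OF _ this] show ?thesis using card_children[OF False] by simp
      qed
      then have "real (card up) * (\<Psi> y / \<beta>) \<le> real q * (\<Psi> y / \<beta>)"
        using \<Psi> \<beta> by (intro mult_right_mono) auto
      moreover have "real (card down) * (\<beta> * \<Psi> y) \<le> (if y \<in> on_geodesic then \<beta> * \<Psi> y else 0)"
        using card_down down_on_geodesic \<Psi> \<beta> mult_right_mono[of "real (card down)" 1 "\<beta> * \<Psi> y"] by auto
      ultimately show ?thesis unfolding eq by simp
    qed
  qed
  have on_geodesic_eq: "\<Psi> y = \<beta> ^ n * \<Psi> x" if "y \<in> on_geodesic" for y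
  proof -
    have "d r x = d r y + n" using that by (simp add: on_geodesic_def)
    then show ?thesis using \<beta> by (simp add: \<Psi>_def power_add power_one_over)
  qed
  have "card on_geodesic \<le> 1"
  proof (rule ccontr)
    assume "\<not> card on_geodesic \<le> 1"
    then obtain y y' where "y \<in> on_geodesic" "y' \<in> on_geodesic" "y \<noteq> y'"
      by (metis One_nat_def card_le_Suc0_iff_eq card.infinite le0)
    then show False using geodesic_vertex_unique[of x y n y'] by (auto simp: on_geodesic_def sphere_at_def)
  qed
  have "(\<Sum>z\<in>sphere_at x (Suc n). \<Psi> z) = (\<Sum>y\<in>sphere_at x n. \<Sum>z\<in>children x y. \<Psi> z)"
    by (rule sum_sphere_at_Suc)
  also have "\<dots> \<le> (\<Sum>y\<in>sphere_at x n. real q / \<beta> * \<Psi> y + (if y \<in> on_geodesic then \<beta> * \<Psi> y else 0))"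
    by (intro sum_mono inner)
  also have "\<dots> = real q / \<beta> * (\<Sum>y\<in>sphere_at x n. \<Psi> y) + (\<Sum>y\<in>on_geodesic. \<beta> * \<Psi> y)"
    by (simp add: sum.distrib sum_distrib_left on_geodesic_def sum.inter_filter)
  also have "\<dots> \<le> \<beta> * ((real n + 1) * \<beta> ^ n * \<Psi> x) + \<beta> * (\<beta> ^ n * \<Psi> x)"
  proof (rule add_mono)
    show "real q / \<beta> * (\<Sum>y\<in>sphere_at x n. \<Psi> y) \<le> \<beta> * ((real n + 1) * \<beta> ^ n * \<Psi> x)"
      using q\<beta> Suc \<Psi> \<beta> by (intro mult_mono sum_nonneg) (auto simp: \<Psi>_def)
    have "(\<Sum>y\<in>on_geodesic. \<beta> * \<Psi> y) = real (card on_geodesic) * (\<beta> * (\<beta> ^ n * \<Psi> x))"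
      using on_geodesic_eq by simp
    also have "\<dots> \<le> 1 * (\<beta> * (\<beta> ^ n * \<Psi> x))"
      using \<open>card on_geodesic \<le> 1\<close> \<Psi> \<beta> by (intro mult_right_mono) auto
    finally show "(\<Sum>y\<in>on_geodesic. \<beta> * \<Psi> y) \<le> \<beta> * (\<beta> ^ n * \<Psi> x)" by simp
  qed
  also have "\<dots> = (real (Suc n) + 1) * \<beta> ^ Suc n * \<Psi> x" by (simp add: algebra_simps)
  finally show ?case by (simp only: \<Psi>_def)
qed

end

section \<open>Chebyshev operators\<close>

text \<open>The sum of \<open>f\<close> over \<open>- n + 1, - n + 3, \<dots>, n - 1\<close>. For \<open>f j = exp (i j w)\<close> it is the Chebyshev polynomial
of the second kind, \<open>sin (n * w) / sin w\<close>.\<close>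

definition string_sum :: "nat \<Rightarrow> (int \<Rightarrow> complex) \<Rightarrow> complex" where
  "string_sum n f = (\<Sum>i<n. f (2 * int i - int n + 1))"

lemma string_sum_simps [simp]: "string_sum 0 f = 0" "string_sum (Suc 0) f = f 0"
  by (simp_all add: string_sum_def)

lemma string_sum_2: "string_sum (Suc (Suc 0)) f = f (- 1) + f 1"
  by (simp add: string_sum_def)

lemma string_sum_step: "string_sum (Suc (Suc n)) f = string_sum n f + f (int n + 1) + f (- int n - 1)"
proof -
  have "string_sum (Suc (Suc n)) f = (\<Sum>i<Suc n. f (2 * int i - int (Suc (Suc n)) + 1)) + f (int n + 1)"
    unfolding string_sum_def by (subst sum.lessThan_Suc) (simp add: algebra_simps)
  also have "(\<Sum>i<Suc n. f (2 * int i - int (Suc (Suc n)) + 1)) =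
      f (- int n - 1) + (\<Sum>i<n. f (2 * int (Suc i) - int (Suc (Suc n)) + 1))"
  proof -
    have "2 * int 0 - int (Suc (Suc n)) + 1 = - int n - 1" by simp
    then show ?thesis unfolding sum.lessThan_Suc_shift by (simp only:)
  qed
  also have "(\<Sum>i<n. f (2 * int (Suc i) - int (Suc (Suc n)) + 1)) = string_sum n f"
    unfolding string_sum_def by (intro sum.cong refl arg_cong[of _ _ f]) simp
  finally show ?thesis by simp
qed

text \<open>For exponentials this is \<open>2 * cos w * sin ((n + 1) * w) = sin ((n + 2) * w) + sin (n * w)\<close>.\<close>

lemma string_sum_shift:
  "string_sum (Suc n) (\<lambda>j. f (j + 1) + f (j - 1)) = string_sum (Suc (Suc n)) f + string_sum n f"
proof -
  have "string_sum (Suc n) (\<lambda>j. f (j + 1) + f (j - 1)) =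
      (\<Sum>i<Suc n. f (2 * int i - int n + 1)) + (\<Sum>i<Suc n. f (2 * int i - int n - 1))"
    unfolding string_sum_def sum.distrib
    by (intro arg_cong2[of _ _ _ _ "(+)"] sum.cong refl arg_cong[of _ _ f]) auto
  also have "\<dots> = (string_sum n f + f (int n + 1)) + (\<Sum>i<Suc n. f (2 * int i - int n - 1))"
    by (simp add: string_sum_def algebra_simps)
  also have "(\<Sum>i<Suc n. f (2 * int i - int n - 1)) = f (- int n - 1) + string_sum n f"
  proof -
    have "2 * int (Suc i) - int n - 1 = 2 * int i - int n + 1" "2 * int 0 - int n - 1 = - int n - 1" for i
      by simp_all
    then show ?thesis unfolding sum.lessThan_Suc_shift string_sum_def by (simp only:)
  qed
  finally show ?thesis unfolding string_sum_step by (simp add: algebra_simps)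
qed

lemma string_sum_sum: "(\<Sum>u\<in>A. string_sum n (\<lambda>j. f j u)) = string_sum n (\<lambda>j. \<Sum>u\<in>A. f j u)"
  unfolding string_sum_def by (rule sum.swap)

lemma string_sum_cmult: "string_sum n (\<lambda>j. c * f j) = c * string_sum n f"
  by (simp add: string_sum_def sum_distrib_left)

lemma string_sum_uminus: "string_sum n (\<lambda>j. f (- j)) = string_sum n f"
  unfolding string_sum_def
proof (rule sum.reindex_bij_witness[of _ "\<lambda>i. n - Suc i" "\<lambda>i. n - Suc i"])
  fix i assume i: "i \<in> {..<n}"
  then show "f (2 * int (n - Suc i) - int n + 1) = f (- (2 * int i - int n + 1))"
    by (intro arg_cong[of _ _ f]) (simp add: of_nat_diff)
qed auto

lemma string_sum_expand:
  assumes "finite A" "\<And>i. i < n \<Longrightarrow> 2 * int i - int n + 1 \<in> A"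
  shows "string_sum n f = (\<Sum>j\<in>A. string_sum n (\<lambda>i. if i = j then 1 else 0) * f j)"
proof -
  have "string_sum n f = (\<Sum>i<n. \<Sum>j\<in>A. (if 2 * int i - int n + 1 = j then 1 else 0) * f j)"
    unfolding string_sum_def
  proof (intro sum.cong refl)
    fix i assume "i \<in> {..<n}"
    then have "2 * int i - int n + 1 \<in> A" using assms(2) by simp
    then show "f (2 * int i - int n + 1) = (\<Sum>j\<in>A. (if 2 * int i - int n + 1 = j then 1 else 0) * f j)"
      using assms(1) by (simp add: if_distrib[of "\<lambda>c. c * _"] cong: if_cong)
  qed
  also have "\<dots> = (\<Sum>j\<in>A. \<Sum>i<n. (if 2 * int i - int n + 1 = j then 1 else 0) * f j)"
    by (rule sum.swap)
  finally show ?thesis by (simp only: string_sum_def sum_distrib_right)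
qed

context rooted_homogeneous_tree
begin

text \<open>The expression of the sum over a sphere of radius \<open>n\<close> in terms of Chebyshev operators. It is defined
for an arbitrary sequence \<open>f\<close> because it is used twice: for the operators themselves and for the
exponentials \<open>expi j\<close>. For \<open>n \<le> 1\<close> the subtracted sum is empty.\<close>

definition sphere_poly :: "nat \<Rightarrow> (int \<Rightarrow> complex) \<Rightarrow> complex" where
  "sphere_poly n f = of_real (sqrt (real q) ^ n) * (string_sum (n + 1) f - string_sum (n - 1) f / of_nat q)"

definition sphere_coeff :: "nat \<Rightarrow> int \<Rightarrow> complex" where
  "sphere_coeff n j = sphere_poly n (\<lambda>i. if i = j then 1 else 0)"

lemma sqrt_q: "1 \<le> sqrt (real q)" "sqrt (real q) ^ 2 = real q" "sqrt (real q) * sqrt (real q) = real q"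
  "0 < sqrt (real q)"
  using q_ge_2 by auto

lemma sphere_poly_0 [simp]: "sphere_poly 0 f = f 0"
  by (simp add: sphere_poly_def)

lemma sphere_poly_1: "sphere_poly 1 f = of_real (sqrt (real q)) * (f (- 1) + f 1)"
  by (simp add: sphere_poly_def string_sum_2)

lemma sphere_poly_recurrence:
  assumes "1 \<le> n"
  shows "of_real (sqrt (real q)) * sphere_poly n (\<lambda>j. f (j + 1) + f (j - 1)) =
     sphere_poly (n + 1) f + (if n = 1 then of_nat (q + 1) else of_nat q) * sphere_poly (n - 1) f"
proof -
  define s where "s = complex_of_real (sqrt (real q))"
  have s: "s * s = of_nat q" unfolding s_def by (simp flip: of_real_mult)
  have q0: "of_nat q \<noteq> (0::complex)" using q_ge_2 by simp
  obtain m where n: "n = Suc m" using assms by (cases n) auto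
  show ?thesis
  proof (cases m)
    case 0
    have sh: "string_sum (Suc (Suc 0)) (\<lambda>j. f (j + 1) + f (j - 1)) = string_sum (Suc (Suc (Suc 0))) f + string_sum (Suc 0) f"
      by (rule string_sum_shift)
    show ?thesis
      using q0 s unfolding n 0 sphere_poly_def of_real_power s_def [symmetric]
      by (simp add: sh mult.assoc [symmetric] power2_eq_square) (simp add: field_simps)
  next
    case (Suc l)
    have sh: "string_sum (Suc (Suc (Suc l))) (\<lambda>j. f (j + 1) + f (j - 1)) = string_sum (Suc (Suc (Suc (Suc l)))) f + string_sum (Suc (Suc l)) f"
      "string_sum (Suc l) (\<lambda>j. f (j + 1) + f (j - 1)) = string_sum (Suc (Suc l)) f + string_sum l f"
      by (rule string_sum_shift)+
    have "s * s ^ Suc (Suc l) = s ^ Suc l * of_nat q" unfolding s [symmetric] by simp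
    then show ?thesis
      using q0 unfolding n Suc sphere_poly_def of_real_power s_def [symmetric]
      by (simp add: sh mult.assoc [symmetric] del: power_Suc) (simp add: field_simps s [symmetric])
  qed
qed

text \<open>The polynomial \<open>cos (n * w)\<close> in \<open>cos w\<close>, evaluated at the nearest neighbour sum divided by
\<open>2 * sqrt q\<close>, the operator with eigenvalue \<open>cos w\<close> on the spherical function of scaled parameter \<open>w\<close>.\<close>

fun chebyshev_nat :: "nat \<Rightarrow> ('v \<Rightarrow> complex) \<Rightarrow> 'v \<Rightarrow> complex" where
  "chebyshev_nat 0 f = f"
| "chebyshev_nat (Suc 0) f = (\<lambda>x. sphere_sum 1 f x / (2 * of_real (sqrt (real q))))"
| "chebyshev_nat (Suc (Suc n)) f = (\<lambda>x. sphere_sum 1 (chebyshev_nat (Suc n) f) x / of_real (sqrt (real q)) - chebyshev_nat n f x)"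

definition chebyshev :: "int \<Rightarrow> ('v \<Rightarrow> complex) \<Rightarrow> 'v \<Rightarrow> complex" where
  "chebyshev j = chebyshev_nat (nat \<bar>j\<bar>)"

lemma chebyshev_0 [simp]: "chebyshev 0 f = f"
  by (simp add: chebyshev_def)

lemma chebyshev_uminus [simp]: "chebyshev (- j) = chebyshev j"
  by (simp add: chebyshev_def)

lemma sphere_sum_1_chebyshev:
  "sphere_sum 1 (chebyshev j f) x = of_real (sqrt (real q)) * (chebyshev (j + 1) f x + chebyshev (j - 1) f x)"
proof -
  have s: "complex_of_real (sqrt (real q)) \<noteq> 0" using q_ge_2 by simp
  have nonneg: "sphere_sum 1 (chebyshev (int n) f) x =
      of_real (sqrt (real q)) * (chebyshev (int n + 1) f x + chebyshev (int n - 1) f x)" for n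
  proof (cases n)
    case 0
    have "chebyshev (- 1) f x = chebyshev 1 f x" by (simp only: chebyshev_uminus)
    then show ?thesis using 0 s by (simp add: chebyshev_def)
  next
    case (Suc m)
    have "nat \<bar>int n + 1\<bar> = Suc (Suc m)" "nat \<bar>int n - 1\<bar> = m" "nat \<bar>int n\<bar> = Suc m" using Suc by auto
    then show ?thesis using s by (simp only: chebyshev_def chebyshev_nat.simps) simp
  qed
  show ?thesis
  proof (cases "0 \<le> j")
    case True
    then show ?thesis using nonneg[of "nat j"] by simp
  next
    case False
    have "chebyshev j = chebyshev (- j)" "chebyshev (j + 1) = chebyshev (- j - 1)" "chebyshev (j - 1) = chebyshev (- j + 1)"
    proof -
      have "\<bar>j + 1\<bar> = \<bar>- j - 1\<bar>" "\<bar>j - 1\<bar> = \<bar>- j + 1\<bar>" by linarith+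
      then show "chebyshev (j + 1) = chebyshev (- j - 1)" "chebyshev (j - 1) = chebyshev (- j + 1)"
        by (simp_all only: chebyshev_def)
    qed simp
    then show ?thesis using nonneg[of "nat (- j)"] False by (simp add: add.commute)
  qed
qed

lemma sphere_sum_lincomb:
  "sphere_sum n (\<lambda>x. c * f x + e * g x) x = c * sphere_sum n f x + e * sphere_sum n g x"
  by (simp add: sphere_sum_def sum.distrib sum_distrib_left)

text \<open>Both sides agree for \<open>n \<le> 1\<close> and satisfy the same three-term recurrence.\<close>

lemma sphere_sum_chebyshev:
  "sphere_sum n f x = sphere_poly n (\<lambda>j. chebyshev j f x)"
proof -
  have "(\<forall>x. sphere_sum n f x = sphere_poly n (\<lambda>j. chebyshev j f x)) \<and>
        (\<forall>x. sphere_sum (Suc n) f x = sphere_poly (Suc n) (\<lambda>j. chebyshev j f x))" for n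
  proof (induction n)
    case 0
    have "sphere_sum (Suc 0) f x = sphere_poly (Suc 0) (\<lambda>j. chebyshev j f x)" for x
      using sphere_sum_1_chebyshev[of 0 f x] sphere_poly_1 by (simp add: add.commute)
    then show ?case by (simp add: sphere_sum_def sphere_at_0)
  next
    case (Suc n)
    have "sphere_sum (Suc (Suc n)) f x = sphere_poly (Suc (Suc n)) (\<lambda>j. chebyshev j f x)" for x
    proof -
      define c where "c = (if Suc n = 1 then of_nat (q + 1) else of_nat q :: complex)"
      have "sphere_sum 1 (sphere_sum (Suc n) f) x = sphere_sum 1 (\<lambda>u. sphere_poly (Suc n) (\<lambda>j. chebyshev j f u)) x"
        using Suc by (simp add: sphere_sum_def)
      also have "\<dots> = sphere_poly (Suc n) (\<lambda>j. sphere_sum 1 (chebyshev j f) x)"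
        unfolding sphere_sum_def sphere_poly_def string_sum_sum [symmetric]
        by (simp add: sum_distrib_left [symmetric] sum_subtractf sum_divide_distrib [symmetric])
      also have "\<dots> = of_real (sqrt (real q)) * sphere_poly (Suc n) (\<lambda>j. chebyshev (j + 1) f x + chebyshev (j - 1) f x)"
        unfolding sphere_sum_1_chebyshev sphere_poly_def string_sum_cmult by (simp add: algebra_simps)
      also have "\<dots> = sphere_poly (Suc (Suc n)) (\<lambda>j. chebyshev j f x) + c * sphere_poly n (\<lambda>j. chebyshev j f x)"
        using sphere_poly_recurrence[of "Suc n" "\<lambda>j. chebyshev j f x"] by (simp add: c_def)
      finally have 1: "sphere_sum 1 (sphere_sum (Suc n) f) x =
          sphere_poly (Suc (Suc n)) (\<lambda>j. chebyshev j f x) + c * sphere_sum n f x"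
        using Suc by simp
      have "sphere_sum 1 (sphere_sum (Suc n) f) x = sphere_sum (Suc (Suc n)) f x + c * sphere_sum n f x"
        using sphere_sum_recurrence[of "Suc n" f x] by (simp add: c_def)
      with 1 show ?thesis by simp
    qed
    then show ?case using Suc by blast
  qed
  then show ?thesis by blast
qed

text \<open>The operator form of \<open>2 * cos (i * w) * cos (j * w) = cos ((j + i) * w) + cos ((j - i) * w)\<close>.\<close>

lemma chebyshev_mult:
  "chebyshev i (chebyshev j f) x = (chebyshev (j + i) f x + chebyshev (j - i) f x) / 2"
proof -
  have s: "complex_of_real (sqrt (real q)) \<noteq> 0" using q_ge_2 by simp
  have *: "(\<forall>x. chebyshev (int n) (chebyshev j f) x = (chebyshev (j + int n) f x + chebyshev (j - int n) f x) / 2) \<and>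
        (\<forall>x. chebyshev (int (Suc n)) (chebyshev j f) x = (chebyshev (j + int (Suc n)) f x + chebyshev (j - int (Suc n)) f x) / 2)" for n
  proof (induction n)
    case 0
    have "chebyshev 1 (chebyshev j f) x = (chebyshev (j + 1) f x + chebyshev (j - 1) f x) / 2" for x
      using sphere_sum_1_chebyshev[of j f x] s by (simp add: chebyshev_def)
    then show ?case by simp
  next
    case (Suc n)
    have "chebyshev (int (Suc (Suc n))) (chebyshev j f) x =
        (chebyshev (j + int (Suc (Suc n))) f x + chebyshev (j - int (Suc (Suc n))) f x) / 2" for x
    proof -
      let ?g = "chebyshev (int (Suc n)) (chebyshev j f)"
      let ?s = "complex_of_real (sqrt (real q))"
      have g: "?g = (\<lambda>x. (1 / 2) * chebyshev (j + int (Suc n)) f x + (1 / 2) * chebyshev (j - int (Suc n)) f x)"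
        using Suc by (auto simp: fun_eq_iff add_divide_distrib)
      have "?s * (chebyshev (int (Suc (Suc n))) (chebyshev j f) x + chebyshev (int n) (chebyshev j f) x) = sphere_sum 1 ?g x"
        using sphere_sum_1_chebyshev[of "int (Suc n)" "chebyshev j f" x] by (simp add: algebra_simps)
      also have "\<dots> = (1 / 2) * sphere_sum 1 (chebyshev (j + int (Suc n)) f) x + (1 / 2) * sphere_sum 1 (chebyshev (j - int (Suc n)) f) x"
        unfolding g by (rule sphere_sum_lincomb)
      also have "\<dots> = ?s * ((1 / 2) * (chebyshev (j + int (Suc (Suc n))) f x + chebyshev (j + int n) f x) +
          (1 / 2) * (chebyshev (j - int n) f x + chebyshev (j - int (Suc (Suc n))) f x))"
        unfolding sphere_sum_1_chebyshev by (simp add: algebra_simps)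
      finally have "chebyshev (int (Suc (Suc n))) (chebyshev j f) x + chebyshev (int n) (chebyshev j f) x =
          (1 / 2) * (chebyshev (j + int (Suc (Suc n))) f x + chebyshev (j + int n) f x) +
          (1 / 2) * (chebyshev (j - int n) f x + chebyshev (j - int (Suc (Suc n))) f x)"
        using s by (simp only: mult_cancel_left simp_thms)
      moreover have "chebyshev (int n) (chebyshev j f) x = (chebyshev (j + int n) f x + chebyshev (j - int n) f x) / 2"
        using Suc by blast
      moreover have "X = (a + e) / 2" if "X + y = (1 / 2) * (a + b) + (1 / 2) * (c + e)" "y = (b + c) / 2"
        for X y a b c e :: complex
        using that by (simp add: field_simps) algebra
      ultimately show ?thesis by blast
    qed
    then show ?case using Suc by blast
  qed
  show ?thesis
  proof (cases "0 \<le> i")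
    case True
    then show ?thesis using *[of "nat i"] by simp
  next
    case False
    then have "chebyshev (int (nat (- i))) (chebyshev j f) x = (chebyshev (j - i) f x + chebyshev (j + i) f x) / 2"
      using *[of "nat (- i)"] by simp
    moreover have "chebyshev (int (nat (- i))) = chebyshev i" using False by simp
    ultimately show ?thesis by (simp add: add.commute)
  qed
qed

lemma chebyshev_chebyshev_symmetric:
  "chebyshev i (chebyshev j f) x = (chebyshev (i + j) f x + chebyshev (i - j) f x) / 2"
proof -
  have "chebyshev (j - i) = chebyshev (i - j)" by (metis chebyshev_uminus minus_diff_eq)
  then show ?thesis by (simp add: chebyshev_mult add.commute)
qed

text \<open>By the triangle inequality \<open>1 + d r x \<le> (1 + n) * (1 + d r y)\<close> on the sphere of radius \<open>n\<close> about \<open>x\<close>, so the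
polynomial part of the decay is transferred from \<open>y\<close> to \<open>x\<close> at the cost of \<open>(1 + n) ^ m\<close>.\<close>

lemma norm_sphere_sum_le:
  fixes \<beta> B :: real
  assumes \<beta>: "1 \<le> \<beta>" "real q \<le> \<beta> ^ 2"
    and f: "\<And>y. cmod (f y) \<le> B * (1 / \<beta>) ^ d r y / (1 + real (d r y)) ^ m"
  shows "(\<Sum>y\<in>sphere_at x n. cmod (f y)) \<le>
     (1 + real n) ^ (m + 1) * \<beta> ^ n * (B * (1 / \<beta>) ^ d r x / (1 + real (d r x)) ^ m)"
proof -
  have B: "0 \<le> B" using f[of r] norm_ge_zero[of "f r"] by (simp del: norm_ge_zero)
  have "(\<Sum>y\<in>sphere_at x n. cmod (f y)) \<le>
      (\<Sum>y\<in>sphere_at x n. B * (1 + real n) ^ m / (1 + real (d r x)) ^ m * (1 / \<beta>) ^ d r y)"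
  proof (rule sum_mono)
    fix y assume y: "y \<in> sphere_at x n"
    have "1 + real (d r x) \<le> (1 + real n) * (1 + real (d r y))"
    proof -
      have "d r x \<le> d r y + n" using dist_triangle[of r x y] y dist_sym[of y x] by (simp add: sphere_at_def)
      then have "1 + real (d r x) \<le> 1 + real n + real (d r y)" by linarith
      also have "\<dots> \<le> (1 + real n) * (1 + real (d r y))" by (simp add: algebra_simps)
      finally show ?thesis .
    qed
    then have "(1 + real (d r x)) ^ m \<le> (1 + real n) ^ m * (1 + real (d r y)) ^ m"
      unfolding power_mult_distrib [symmetric] by (intro power_mono) auto
    then have "1 / (1 + real (d r y)) ^ m \<le> (1 + real n) ^ m / (1 + real (d r x)) ^ m"
      by (simp add: divide_simps)
    then have "B * (1 / \<beta>) ^ d r y * (1 / (1 + real (d r y)) ^ m) \<le> B * (1 / \<beta>) ^ d r y * ((1 + real n) ^ m / (1 + real (d r x)) ^ m)"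
      using B \<beta> by (intro mult_left_mono) auto
    then show "cmod (f y) \<le> B * (1 + real n) ^ m / (1 + real (d r x)) ^ m * (1 / \<beta>) ^ d r y"
      using f[of y] by (simp add: mult_ac)
  qed
  also have "\<dots> \<le> B * (1 + real n) ^ m / (1 + real (d r x)) ^ m * ((real n + 1) * \<beta> ^ n * (1 / \<beta>) ^ d r x)"
    unfolding sum_distrib_left [symmetric] using B
    by (intro mult_left_mono sum_sphere_power_le \<beta>) auto
  finally show ?thesis by (simp add: mult_ac add.commute)
qed

text \<open>Let \<open>W n\<close> be the string sum of the operators. The expansion of the sphere sums says that
\<open>W (n + 1) - W (n - 1) / q\<close> is the sphere sum divided by \<open>sqrt q ^ n\<close>, hence at most \<open>D n\<close>, which is of order
\<open>(\<beta> / sqrt q) ^ n\<close> up to a power of \<open>n\<close>. Adding up these bounds gives \<open>W n \<le> n * D (n - 1)\<close>, and twice the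
operator of index \<open>n\<close> is \<open>W (n + 1) - W (n - 1)\<close>. The rate \<open>ln (\<beta> / sqrt q)\<close> is the half-width of the strip
if \<open>\<beta> = q powr (1 / p)\<close>.\<close>

lemma norm_chebyshev_le:
  fixes \<beta> B :: real
  assumes \<beta>: "1 \<le> \<beta>" "real q \<le> \<beta> ^ 2"
    and f: "\<And>y. cmod (f y) \<le> B * (1 / \<beta>) ^ d r y / (1 + real (d r y)) ^ m"
  shows "cmod (chebyshev j f x) \<le>
     weight (ln (\<beta> / sqrt (real q))) (m + 2) j * (B * (1 / \<beta>) ^ d r x / (1 + real (d r x)) ^ m)"
proof -
  define s where "s = sqrt (real q)"
  define R where "R = B * (1 / \<beta>) ^ d r x / (1 + real (d r x)) ^ m"
  define D where "D = (\<lambda>n::nat. (1 + real n) ^ (m + 1) * (\<beta> / s) ^ n * R)"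
  have B: "0 \<le> B" using f[of r] norm_ge_zero[of "f r"] by (simp del: norm_ge_zero)
  have R: "0 \<le> R" using B \<beta> by (simp add: R_def)
  have s: "1 \<le> s" "s ^ 2 = real q" using sqrt_q by (auto simp: s_def)
  have "s \<le> \<beta>" unfolding s_def using \<beta> by (intro real_le_lsqrt) auto
  then have \<beta>s: "1 \<le> \<beta> / s" using s by simp
  have Dmono: "D k \<le> D n" if "k \<le> n" for k n
    unfolding D_def using that R \<beta>s by (intro mult_right_mono mult_mono power_mono power_increasing) auto
  have D0: "0 \<le> D n" for n unfolding D_def using R \<beta>s by simp
  let ?c = "\<lambda>j. chebyshev j f x"
  have S: "cmod (string_sum (Suc n) ?c) \<le> D n + cmod (string_sum (n - 1) ?c)" for n
  proof -
    have "cmod (sphere_sum n f x) \<le> (\<Sum>y\<in>sphere_at x n. cmod (f y))"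
      unfolding sphere_sum_def by (rule norm_sum)
    also have "\<dots> \<le> (1 + real n) ^ (m + 1) * \<beta> ^ n * R"
      unfolding R_def by (rule norm_sphere_sum_le[OF \<beta> f])
    finally have 1: "cmod (sphere_poly n ?c) \<le> (1 + real n) ^ (m + 1) * \<beta> ^ n * R"
      by (simp add: sphere_sum_chebyshev)
    have "cmod (string_sum (Suc n) ?c - string_sum (n - 1) ?c / of_nat q) = cmod (sphere_poly n ?c) / s ^ n"
      using s by (simp add: sphere_poly_def norm_mult s_def norm_power)
    also have "\<dots> \<le> ((1 + real n) ^ (m + 1) * \<beta> ^ n * R) / s ^ n"
      using 1 s by (intro divide_right_mono) auto
    also have "\<dots> = D n" by (simp add: D_def power_divide)
    finally have 2: "cmod (string_sum (Suc n) ?c - string_sum (n - 1) ?c / of_nat q) \<le> D n" .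
    have "cmod (string_sum (n - 1) ?c / of_nat q) \<le> cmod (string_sum (n - 1) ?c) / 1"
      unfolding norm_divide using q_ge_2 by (intro divide_left_mono) auto
    moreover have "cmod (string_sum (Suc n) ?c) \<le> cmod (string_sum (Suc n) ?c - string_sum (n - 1) ?c / of_nat q) + cmod (string_sum (n - 1) ?c / of_nat q)"
      by (metis norm_triangle_sub add.commute)
    ultimately show ?thesis using 2 by simp
  qed
  have W: "cmod (string_sum n ?c) \<le> real n * D (n - 1)" for n
  proof (induction n rule: less_induct)
    case (less n)
    show ?case
    proof (cases n)
      case (Suc k)
      have "cmod (string_sum (k - 1) ?c) \<le> real (k - 1) * D (k - 1 - 1)"
        using less[of "k - 1"] Suc by simp
      also have "\<dots> \<le> real k * D k"
        using D0 by (intro mult_mono Dmono) auto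
      finally show ?thesis using S[of k] Suc by (simp add: algebra_simps)
    qed simp
  qed
  have main: "cmod (?c (int n)) \<le> (1 + real n) * D n" for n
  proof (cases n)
    case 0
    then show ?thesis using W[of "Suc 0"] by simp
  next
    case (Suc k)
    have "int k + 1 = int n" "- int k - 1 = - int n" using Suc by auto
    then have "?c (int n) + ?c (- int n) = string_sum (Suc (Suc k)) ?c - string_sum k ?c"
      by (simp only: string_sum_step) simp
    then have "2 * ?c (int n) = string_sum (Suc (Suc k)) ?c - string_sum k ?c" by simp
    then have "2 * cmod (?c (int n)) = cmod (string_sum (Suc (Suc k)) ?c - string_sum k ?c)"
      by (metis norm_mult norm_numeral)
    also have "\<dots> \<le> cmod (string_sum (Suc (Suc k)) ?c) + cmod (string_sum k ?c)"
      by (rule norm_triangle_ineq4)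
    also have "\<dots> \<le> (1 + real n) * D n + (1 + real n) * D n"
    proof (rule add_mono)
      show "cmod (string_sum (Suc (Suc k)) ?c) \<le> (1 + real n) * D n"
        using W[of "Suc (Suc k)"] Suc by simp
      have "real k * D (k - 1) \<le> (1 + real n) * D n" using Suc D0 by (intro mult_mono Dmono) auto
      then show "cmod (string_sum k ?c) \<le> (1 + real n) * D n" using W[of k] by linarith
    qed
    finally show ?thesis by linarith
  qed
  define n where "n = nat \<bar>j\<bar>"
  have "chebyshev j = chebyshev (int n)" by (simp add: chebyshev_def n_def)
  moreover have "weight (ln (\<beta> / s)) (m + 2) j = (\<beta> / s) ^ n * (1 + real n) ^ (m + 2)"
  proof -
    have "real n = \<bar>real_of_int j\<bar>" by (simp add: n_def)
    moreover have "exp (ln (\<beta> / s) * real n) = (\<beta> / s) ^ n"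
      using \<beta>s by (simp add: exp_of_nat2_mult)
    ultimately show ?thesis by (simp add: weight_def)
  qed
  ultimately show ?thesis
    using main[of n] unfolding s_def [symmetric] R_def [symmetric] by (simp add: D_def mult_ac)
qed

lemma sphere_coeff_eq_0: "sphere_coeff n j = 0" if "int n < \<bar>j\<bar>"
proof -
  have "string_sum k (\<lambda>i. if i = j then 1 else 0) = 0" if "k \<le> n + 1" for k
    unfolding string_sum_def
  proof (rule sum.neutral, rule ballI)
    fix i assume "i \<in> {..<k}"
    then have "2 * int i - int k + 1 \<noteq> j" using \<open>int n < \<bar>j\<bar>\<close> that by auto
    then show "(if 2 * int i - int k + 1 = j then 1 else 0) = (0 :: complex)" by simp
  qed
  then show ?thesis by (simp add: sphere_coeff_def sphere_poly_def)
qed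

lemma sphere_coeff_uminus: "sphere_coeff n (- j) = sphere_coeff n j"
proof -
  have "string_sum k (\<lambda>i. if i = - j then 1 else 0) = string_sum k (\<lambda>i. if i = j then 1 else 0)" for k
  proof -
    have "(\<lambda>i. if i = - j then 1 else 0 :: complex) = (\<lambda>i. if - i = j then 1 else 0)"
      by (auto simp: fun_eq_iff)
    then show ?thesis using string_sum_uminus[of k "\<lambda>i. if i = j then 1 else 0"] by simp
  qed
  then show ?thesis by (simp add: sphere_coeff_def sphere_poly_def)
qed

lemma sphere_poly_expand: "sphere_poly n f = (\<Sum>j\<in>{- int n..int n}. sphere_coeff n j * f j)"
proof -
  have "string_sum (n + 1) f = (\<Sum>j\<in>{- int n..int n}. string_sum (n + 1) (\<lambda>i. if i = j then 1 else 0) * f j)"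
    by (rule string_sum_expand) auto
  moreover have "string_sum (n - 1) f = (\<Sum>j\<in>{- int n..int n}. string_sum (n - 1) (\<lambda>i. if i = j then 1 else 0) * f j)"
    by (rule string_sum_expand) auto
  ultimately show ?thesis
    unfolding sphere_coeff_def sphere_poly_def
    by (simp add: sum_distrib_left sum_subtractf [symmetric] sum_divide_distrib algebra_simps)
qed

lemma norm_sphere_coeff_le: "cmod (sphere_coeff n j) \<le> 2 * (1 + real n) * sqrt (real q) ^ n"
proof -
  have W: "cmod (string_sum k (\<lambda>i. if i = j then 1 else 0)) \<le> real k" for k
  proof -
    have "cmod (string_sum k (\<lambda>i. if i = j then 1 else 0)) \<le> (\<Sum>i<k. 1)"
      unfolding string_sum_def by (rule sum_norm_le) auto
    then show ?thesis by simp
  qed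
  let ?f = "\<lambda>i. if i = j then 1 else 0 :: complex"
  have "cmod (string_sum (n - 1) ?f / of_nat q) \<le> cmod (string_sum (n - 1) ?f) / 1"
    unfolding norm_divide using q_ge_2 by (intro divide_left_mono) auto
  then have "cmod (string_sum (n + 1) ?f - string_sum (n - 1) ?f / of_nat q) \<le> 2 * (1 + real n)"
    using norm_triangle_ineq4[of "string_sum (n + 1) ?f" "string_sum (n - 1) ?f / of_nat q"] W[of "n + 1"] W[of "n - 1"]
    by (simp add: of_nat_diff)
  then have "sqrt (real q) ^ n * cmod (string_sum (n + 1) ?f - string_sum (n - 1) ?f / of_nat q) \<le> sqrt (real q) ^ n * (2 * (1 + real n))"
    by (intro mult_left_mono) auto
  then show ?thesis
    by (simp add: sphere_coeff_def sphere_poly_def norm_mult norm_power mult_ac)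
qed

section \<open>Radial kernels as series in Chebyshev operators\<close>

text \<open>The Fourier coefficients of the spherical transform of the radial function with values \<open>k n\<close>.\<close>

definition transform_coeff :: "(nat \<Rightarrow> complex) \<Rightarrow> int \<Rightarrow> complex" where
  "transform_coeff k j = (\<Sum>\<^sub>\<infinity>n. k n * sphere_coeff n j)"

lemma transform_coeff_uminus: "transform_coeff k (- j) = transform_coeff k j"
  by (simp add: transform_coeff_def sphere_coeff_uminus)

lemma summable_inverse_square_nat: "(\<lambda>n::nat. 1 / (1 + real n) ^ 2) summable_on UNIV"
proof -
  have "(\<lambda>j::int. 1 / (1 + \<bar>real_of_int j\<bar>) ^ 2) summable_on range int"
    by (rule summable_on_subset_banach[OF summable_inverse_square_int]) simp
  then show ?thesis by (subst (asm) summable_on_reindex) (auto simp: o_def)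
qed

text \<open>In \<open>k n * sphere_coeff n j * f j\<close> with \<open>\<bar>j\<bar> \<le> n\<close> the exponential factors are at most \<open>(1 / \<beta>) ^ n\<close>,
\<open>sqrt q ^ n\<close> and \<open>(\<beta> / sqrt q) ^ n\<close>, and they cancel. The sphere coefficients cost one power of \<open>1 + n\<close>
and the weight costs \<open>s\<close> of them, so the exponent \<open>s + 5\<close> leaves four: two for the sum over \<open>n\<close> and
two for the sum over \<open>j\<close>.\<close>

lemma transform_terms_summable:
  fixes \<beta> :: real
  assumes \<beta>: "1 \<le> \<beta>" "real q \<le> \<beta> ^ 2"
    and k: "\<And>n. cmod (k n) \<le> C1 * (1 / \<beta>) ^ n / (1 + real n) ^ (s + 5)"
    and f: "\<And>j. cmod (f j) \<le> C2 * weight (ln (\<beta> / sqrt (real q))) s j"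
  shows "(\<lambda>(n, j). cmod (k n * sphere_coeff n j * f j)) summable_on UNIV \<times> UNIV"
proof -
  define t where "t = sqrt (real q)"
  have t: "1 \<le> t" using sqrt_q by (simp add: t_def)
  have "t \<le> \<beta>" unfolding t_def using \<beta> by (intro real_le_lsqrt) auto
  then have \<beta>t: "1 \<le> \<beta> / t" using t by simp
  have C1: "0 \<le> C1" using k[of 0] norm_ge_zero[of "k 0"] by (simp del: norm_ge_zero)
  have C2: "0 \<le> C2" using f[of 0] norm_ge_zero[of "f 0"] by (simp del: norm_ge_zero)
  have sum: "(\<lambda>(n, j). (2 * C1 * C2 * (1 / (1 + real n) ^ 2)) * (1 / (1 + \<bar>real_of_int j\<bar>) ^ 2)) summable_on UNIV \<times> UNIV"
    by (rule summable_on_product_nonneg[OF summable_on_cmult_right[OF summable_inverse_square_nat] summable_inverse_square_int])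
      (use C1 C2 in auto)
  have le: "cmod (k n * sphere_coeff n j * f j) \<le>
      (2 * C1 * C2 * (1 / (1 + real n) ^ 2)) * (1 / (1 + \<bar>real_of_int j\<bar>) ^ 2)" for n j
  proof (cases "int n < \<bar>j\<bar>")
    case True
    then show ?thesis using C1 C2 by (simp add: sphere_coeff_eq_0)
  next
    case False
    define i where "i = nat \<bar>j\<bar>"
    have i: "i \<le> n" "real i = \<bar>real_of_int j\<bar>" using False by (auto simp: i_def)
    have "exp (ln (\<beta> / t) * real i) = (\<beta> / t) ^ i"
      using \<beta>t by (simp add: exp_of_nat2_mult)
    then have "weight (ln (\<beta> / t)) s j = (\<beta> / t) ^ i * (1 + real i) ^ s"
      by (simp add: weight_def i)
    also have "\<dots> \<le> (\<beta> / t) ^ n * (1 + real n) ^ s"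
      using \<beta>t i(1) by (intro mult_mono power_increasing power_mono) auto
    finally have "C2 * weight (ln (\<beta> / t)) s j \<le> C2 * ((\<beta> / t) ^ n * (1 + real n) ^ s)"
      using C2 by (rule mult_left_mono)
    then have f': "cmod (f j) \<le> C2 * ((\<beta> / t) ^ n * (1 + real n) ^ s)"
      using f[of j] unfolding t_def by linarith
    have "cmod (k n * sphere_coeff n j * f j) \<le>
        (C1 * (1 / \<beta>) ^ n / (1 + real n) ^ (s + 5)) * (2 * (1 + real n) * t ^ n) * (C2 * ((\<beta> / t) ^ n * (1 + real n) ^ s))"
      unfolding norm_mult using C1 \<beta> t
      by (intro mult_mono k f' norm_sphere_coeff_le[folded t_def]) auto
    also have "\<dots> = 2 * C1 * C2 * (1 / (1 + real n) ^ 4) * ((1 / \<beta>) ^ n * t ^ n * (\<beta> / t) ^ n)"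
    proof -
      have "(1 + real n) ^ (s + 5) = (1 + real n) ^ s * (1 + real n) * (1 + real n) ^ 4"
        by (simp add: power_add [symmetric] power_Suc2 [symmetric] add_ac del: power_Suc)
      moreover have "C1 * b / (x * y * z) * (2 * y * c) * (C2 * (e * x)) = 2 * C1 * C2 * (1 / z) * (b * c * e)"
        if "x \<noteq> 0" "y \<noteq> 0" for b c e x y z :: real
        using that by simp
      moreover have "(1 + real n) ^ s \<noteq> 0" "1 + real n \<noteq> 0" by (simp_all add: add_nonneg_eq_0_iff)
      ultimately show ?thesis by metis
    qed
    also have "(1 / \<beta>) ^ n * t ^ n * (\<beta> / t) ^ n = 1"
      using \<beta> t by (simp add: power_mult_distrib [symmetric])
    also have "2 * C1 * C2 * (1 / (1 + real n) ^ 4) * 1 \<le>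
        (2 * C1 * C2 * (1 / (1 + real n) ^ 2)) * (1 / (1 + \<bar>real_of_int j\<bar>) ^ 2)"
    proof -
      have "(1 + \<bar>real_of_int j\<bar>) ^ 2 \<le> (1 + real n) ^ 2" using i by (intro power_mono) auto
      moreover have "0 < (1 + \<bar>real_of_int j\<bar>) ^ 2" by (intro zero_less_power) simp
      ultimately have le: "1 / (1 + real n) ^ 2 \<le> 1 / (1 + \<bar>real_of_int j\<bar>) ^ 2"
        by (intro frac_le) simp_all
      have "(1 + real n) ^ 4 = (1 + real n) ^ 2 * (1 + real n) ^ 2"
        by (simp add: power_add [symmetric])
      then have "2 * C1 * C2 * (1 / (1 + real n) ^ 4) * 1 =
          (2 * C1 * C2 * (1 / (1 + real n) ^ 2)) * (1 / (1 + real n) ^ 2)" by simp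
      also have "\<dots> \<le> (2 * C1 * C2 * (1 / (1 + real n) ^ 2)) * (1 / (1 + \<bar>real_of_int j\<bar>) ^ 2)"
        using C1 C2 by (intro mult_left_mono le) auto
      finally show ?thesis .
    qed
    finally show ?thesis .
  qed
  show ?thesis
    by (rule summable_on_norm_comparison[OF sum]) (use le in auto)
qed

lemma infsum_sphere_coeff: "(\<Sum>\<^sub>\<infinity>j. k n * sphere_coeff n j * f j) = k n * sphere_poly n f"
proof -
  have "(\<Sum>\<^sub>\<infinity>j. k n * sphere_coeff n j * f j) = (\<Sum>\<^sub>\<infinity>j\<in>{- int n..int n}. k n * sphere_coeff n j * f j)"
    by (rule infsum_cong_neutral) (auto simp: sphere_coeff_eq_0)
  then show ?thesis by (simp add: sphere_poly_expand sum_distrib_left mult.assoc)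
qed

lemma bij_betw_swap_UNIV: "bij_betw prod.swap UNIV UNIV"
  by (simp add: bij_swap)

text \<open>Exchanging the order of summation. With \<open>f j = chebyshev j \<phi> x\<close> this expands convolution operators,
with \<open>f j = expi j w\<close> it expands spherical transforms; that the same coefficients occur in both is what
makes the symbol describe the operator.\<close>

lemma transform_has_sum:
  fixes \<beta> :: real
  assumes \<beta>: "1 \<le> \<beta>" "real q \<le> \<beta> ^ 2"
    and k: "\<And>n. cmod (k n) \<le> C1 * (1 / \<beta>) ^ n / (1 + real n) ^ (s + 5)"
    and f: "\<And>j. cmod (f j) \<le> C2 * weight (ln (\<beta> / sqrt (real q))) s j"
  shows "((\<lambda>j. transform_coeff k j * f j) has_sum (\<Sum>\<^sub>\<infinity>n. k n * sphere_poly n f)) UNIV"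
    and "(\<lambda>n. cmod (k n * sphere_poly n f)) summable_on UNIV"
proof -
  let ?g = "\<lambda>n j. k n * sphere_coeff n j * f j"
  have abs: "(\<lambda>(n, j). cmod (?g n j)) summable_on UNIV \<times> UNIV"
    by (rule transform_terms_summable[OF assms])
  have sum: "(\<lambda>(n, j). ?g n j) summable_on UNIV \<times> UNIV"
    by (rule abs_summable_summable) (use abs in \<open>simp add: case_prod_unfold\<close>)
  have sw: "(\<lambda>(j, n). ?g n j) summable_on UNIV \<times> UNIV"
    using summable_on_reindex_bij_betw[OF bij_betw_swap_UNIV, of "\<lambda>(n, j). ?g n j"] sum
    by (simp add: case_prod_unfold)
  have inner: "(\<Sum>\<^sub>\<infinity>n. ?g n j) = transform_coeff k j * f j" for j
    unfolding transform_coeff_def by (rule infsum_cmult_left')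
  have "(\<lambda>j. \<Sum>\<^sub>\<infinity>n. ?g n j) summable_on UNIV"
    using summable_on_Sigma_banach[OF sw] by simp
  then have "((\<lambda>j. transform_coeff k j * f j) has_sum (\<Sum>\<^sub>\<infinity>j. \<Sum>\<^sub>\<infinity>n. ?g n j)) UNIV"
    unfolding inner by (rule has_sum_infsum)
  moreover have "(\<Sum>\<^sub>\<infinity>j. \<Sum>\<^sub>\<infinity>n. ?g n j) = (\<Sum>\<^sub>\<infinity>n. k n * sphere_poly n f)"
    using infsum_swap_banach[OF sum] by (simp add: infsum_sphere_coeff)
  ultimately show "((\<lambda>j. transform_coeff k j * f j) has_sum (\<Sum>\<^sub>\<infinity>n. k n * sphere_poly n f)) UNIV" by simp
  have "(\<lambda>n. \<Sum>\<^sub>\<infinity>j. cmod (?g n j)) summable_on UNIV"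
    using summable_on_Sigma_banach[OF abs] by simp
  then show "(\<lambda>n. cmod (k n * sphere_poly n f)) summable_on UNIV"
  proof (rule summable_on_norm_comparison)
    fix n
    have "(\<lambda>j. cmod (?g n j)) summable_on UNIV"
      using summable_on_SigmaD1[OF abs, of n] by simp
    then have "cmod (\<Sum>\<^sub>\<infinity>j. ?g n j) \<le> (\<Sum>\<^sub>\<infinity>j. cmod (?g n j))"
      by (rule norm_infsum_bound)
    then show "norm (cmod (k n * sphere_poly n f)) \<le> (\<Sum>\<^sub>\<infinity>j. cmod (?g n j))"
      by (simp add: infsum_sphere_coeff)
  qed
qed

lemma rapid_transform_coeff:
  fixes \<beta> :: real
  assumes \<beta>: "1 \<le> \<beta>" "real q \<le> \<beta> ^ 2"
    and k: "\<And>s. \<exists>C. \<forall>n. cmod (k n) \<le> C * (1 / \<beta>) ^ n / (1 + real n) ^ s"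
  shows "rapid (ln (\<beta> / sqrt (real q))) (transform_coeff k)"
  unfolding rapid_def
proof
  fix s
  let ?w = "weight (ln (\<beta> / sqrt (real q))) s"
  let ?g = "\<lambda>n j. k n * sphere_coeff n j * of_real (?w j)"
  obtain C where C: "\<And>n. cmod (k n) \<le> C * (1 / \<beta>) ^ n / (1 + real n) ^ (s + 5)"
    using k by blast
  have abs: "(\<lambda>(n, j). cmod (?g n j)) summable_on UNIV \<times> UNIV"
  proof (rule transform_terms_summable[OF \<beta> C])
    show "cmod (of_real (?w j)) \<le> 1 * ?w j" for j by simp
  qed
  have sw: "(\<lambda>(j, n). cmod (?g n j)) summable_on UNIV \<times> UNIV"
    using summable_on_reindex_bij_betw[OF bij_betw_swap_UNIV, of "\<lambda>(n, j). cmod (?g n j)"] abs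
    by (simp add: case_prod_unfold)
  have "(\<lambda>j. \<Sum>\<^sub>\<infinity>n. cmod (?g n j)) summable_on UNIV"
    using summable_on_Sigma_banach[OF sw] by simp
  then show "(\<lambda>j. cmod (transform_coeff k j) * ?w j) summable_on UNIV"
  proof (rule summable_on_norm_comparison)
    fix j
    have "(\<lambda>n. cmod (?g n j)) summable_on UNIV"
      using summable_on_SigmaD1[OF sw, of j] by simp
    then have "cmod (\<Sum>\<^sub>\<infinity>n. ?g n j) \<le> (\<Sum>\<^sub>\<infinity>n. cmod (?g n j))"
      by (rule norm_infsum_bound)
    moreover have "(\<Sum>\<^sub>\<infinity>n. ?g n j) = transform_coeff k j * of_real (?w j)"
      unfolding transform_coeff_def by (rule infsum_cmult_left')
    ultimately show "norm (cmod (transform_coeff k j) * ?w j) \<le> (\<Sum>\<^sub>\<infinity>n. cmod (?g n j))"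
      by (simp add: norm_mult)
  qed
qed

lemma has_sum_over_spheres:
  fixes F :: "'v \<Rightarrow> complex"
  assumes "(\<lambda>n. \<Sum>y\<in>sphere_at x n. cmod (F y)) summable_on UNIV"
  shows "(F has_sum (\<Sum>\<^sub>\<infinity>n. \<Sum>y\<in>sphere_at x n. F y)) UNIV"
proof -
  have bij: "bij_betw snd (Sigma UNIV (sphere_at x)) UNIV"
    by (rule bij_betwI[where g = "\<lambda>y. (d x y, y)"]) (auto simp: sphere_at_def)
  have "(\<lambda>(n, y). cmod (F y)) summable_on Sigma UNIV (sphere_at x)"
    by (rule summable_on_SigmaI[OF _ assms]) (auto intro!: has_sum_finiteI)
  then have sum: "(\<lambda>(n, y). F y) summable_on Sigma UNIV (sphere_at x)"
    by (intro abs_summable_summable[of "\<lambda>(n, y). F y"]) (simp add: case_prod_unfold)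
  then have "(\<lambda>p. F (snd p)) summable_on Sigma UNIV (sphere_at x)"
    by (simp add: case_prod_unfold)
  then have "F summable_on UNIV"
    by (subst (asm) summable_on_reindex_bij_betw[OF bij])
  moreover have "infsum F UNIV = (\<Sum>\<^sub>\<infinity>n. \<Sum>y\<in>sphere_at x n. F y)"
  proof -
    have "infsum F UNIV = infsum (\<lambda>p. F (snd p)) (Sigma UNIV (sphere_at x))"
      by (rule infsum_reindex_bij_betw[OF bij, symmetric])
    also have "\<dots> = (\<Sum>\<^sub>\<infinity>n. infsum F (sphere_at x n))"
      using infsum_Sigma'_banach[OF sum] by (simp add: case_prod_unfold)
    finally show ?thesis by simp
  qed
  ultimately show ?thesis using has_sum_infsum[of F UNIV] by simp
qed

lemma conv_has_sum:
  fixes \<beta> B :: real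
  assumes \<beta>: "1 \<le> \<beta>" "real q \<le> \<beta> ^ 2"
    and k: "\<And>s. \<exists>C. \<forall>n. cmod (radial_value E r k n) \<le> C * (1 / \<beta>) ^ n / (1 + real n) ^ s"
    and \<phi>: "\<And>y. cmod (\<phi> y) \<le> B * (1 / \<beta>) ^ d r y / (1 + real (d r y)) ^ m"
  shows "((\<lambda>j. transform_coeff (radial_value E r k) j * chebyshev j \<phi> x) has_sum conv E r \<phi> k x) UNIV"
proof -
  define k' where "k' = radial_value E r k"
  define R where "R = B * (1 / \<beta>) ^ d r x / (1 + real (d r x)) ^ m"
  have B: "0 \<le> B" using \<phi>[of r] norm_ge_zero[of "\<phi> r"] by (simp del: norm_ge_zero)
  have R: "0 \<le> R" using B \<beta> by (simp add: R_def)
  obtain C where C: "\<And>n. cmod (k' n) \<le> C * (1 / \<beta>) ^ n / (1 + real n) ^ ((m + 2) + 5)"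
    using k unfolding k'_def by blast
  obtain C' where C': "\<And>n. cmod (k' n) \<le> C' * (1 / \<beta>) ^ n / (1 + real n) ^ (m + 3)"
    using k unfolding k'_def by blast
  have cheb: "cmod (chebyshev j \<phi> x) \<le> R * weight (ln (\<beta> / sqrt (real q))) (m + 2) j" for j
    using norm_chebyshev_le[OF \<beta> \<phi>, of j x] by (simp add: R_def mult.commute)
  have sums: "((\<lambda>j. transform_coeff k' j * chebyshev j \<phi> x) has_sum
      (\<Sum>\<^sub>\<infinity>n. k' n * sphere_poly n (\<lambda>j. chebyshev j \<phi> x))) UNIV"
    by (rule transform_has_sum(1)[OF \<beta> C cheb])
  have "(\<lambda>n. \<Sum>y\<in>sphere_at x n. cmod (\<phi> y * k' (d x y))) summable_on UNIV"
  proof (rule summable_on_norm_comparison[OF summable_on_cmult_right[OF summable_inverse_square_nat, of "C' * R"]])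
    fix n
    have C'0: "0 \<le> C'" using C'[of 0] norm_ge_zero[of "k' 0"] by (simp del: norm_ge_zero)
    have "(\<Sum>y\<in>sphere_at x n. cmod (\<phi> y * k' (d x y))) = cmod (k' n) * (\<Sum>y\<in>sphere_at x n. cmod (\<phi> y))"
      by (simp add: norm_mult sum_distrib_left sphere_at_def mult.commute)
    also have "\<dots> \<le> (C' * (1 / \<beta>) ^ n / (1 + real n) ^ (m + 3)) * ((1 + real n) ^ (m + 1) * \<beta> ^ n * R)"
      unfolding R_def using C'0 \<beta>
      by (intro mult_mono C' norm_sphere_sum_le[OF \<beta> \<phi>] sum_nonneg) auto
    also have "\<dots> = C' * R * (1 / (1 + real n) ^ 2)"
    proof -
      have "m + 3 = (m + 1) + 2" by simp
      then have "(1 + real n) ^ (m + 3) = (1 + real n) ^ (m + 1) * (1 + real n) ^ 2"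
        by (simp only: power_add)
      moreover have "(1 / \<beta>) ^ n * \<beta> ^ n = 1" using \<beta> by (simp add: power_mult_distrib [symmetric])
      moreover have "(1 + real n) ^ (m + 1) \<noteq> 0" by (simp add: add_nonneg_eq_0_iff)
      moreover have "C' * b / (x * y) * (x * c * R) = C' * R * (1 / y)" if "x \<noteq> 0" "b * c = 1" for b c x y :: real
      proof -
        have "C' * b / (x * y) * (x * c * R) = C' * R * (1 / y) * (b * c)" using that(1) by simp
        then show ?thesis using that(2) by simp
      qed
      ultimately show ?thesis by metis
    qed
    finally show "norm (\<Sum>y\<in>sphere_at x n. cmod (\<phi> y * k' (d x y))) \<le> C' * R * (1 / (1 + real n) ^ 2)"
      by (simp add: sum_nonneg)
  qed
  from has_sum_over_spheres[OF this]
  have "conv E r \<phi> k x = (\<Sum>\<^sub>\<infinity>n. \<Sum>y\<in>sphere_at x n. \<phi> y * k' (d x y))"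
    by (simp add: conv_def k'_def infsumI)
  also have "\<dots> = (\<Sum>\<^sub>\<infinity>n. k' n * sphere_sum n \<phi> x)"
    by (intro infsum_cong) (simp add: sphere_sum_def sum_distrib_left sphere_at_def mult.commute)
  finally show ?thesis
    using sums by (simp add: sphere_sum_chebyshev k'_def)
qed

section \<open>The boundary and its measure\<close>

definition ancestor :: "'v \<Rightarrow> nat \<Rightarrow> 'v" where
  "ancestor x i = (parent r ^^ (d r x - i)) x"

lemma ancestor_self [simp]: "ancestor x (d r x) = x"
  by (simp add: ancestor_def)

lemma level_parent: "r \<noteq> x \<Longrightarrow> d r (parent r x) = d r x - 1"
  using parent(2)[of r x] by simp

lemma level_iterate_parent: "n \<le> d r x \<Longrightarrow> d r ((parent r ^^ n) x) = d r x - n"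
proof (induction n)
  case (Suc n)
  then have "r \<noteq> (parent r ^^ n) x" by auto
  then show ?case using Suc level_parent by simp
qed simp

lemma level_ancestor [simp]: "i \<le> d r x \<Longrightarrow> d r (ancestor x i) = i"
  by (simp add: ancestor_def level_iterate_parent)

lemma ancestor_0 [simp]: "ancestor x 0 = r"
  using level_ancestor[of 0 x] by (metis dist_eq_0 le0)

lemma parent_ancestor: "i < d r x \<Longrightarrow> parent r (ancestor x (Suc i)) = ancestor x i"
proof -
  assume "i < d r x"
  then have "d r x - i = Suc (d r x - Suc i)" by simp
  then show ?thesis by (simp add: ancestor_def)
qed

lemma edge_ancestor:
  assumes "i < d r x" shows "E (ancestor x i) (ancestor x (Suc i))"
proof -
  have "d r (ancestor x (Suc i)) = Suc i" using assms by simp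
  then have "r \<noteq> ancestor x (Suc i)" by auto
  from parent(1)[OF this] show ?thesis
    using parent_ancestor[OF assms] E_sym[of "ancestor x (Suc i)"] by simp
qed

text \<open>Going down one level means passing to the parent, so such a walk is determined by its last vertex.
Geodesics from \<open>r\<close> and rays are both of this kind.\<close>

lemma ascending_walk_ancestor:
  assumes "\<And>i. i \<le> n \<Longrightarrow> d r (w i) = i" and "\<And>i. i < n \<Longrightarrow> E (w i) (w (Suc i))" and "i \<le> n"
  shows "w i = ancestor (w n) i"
proof -
  have "w (n - k) = ancestor (w n) (n - k)" if "k \<le> n" for k
    using that
  proof (induction k)
    case 0
    have "d r (w n) = n" using assms(1) by simp
    then show ?case using ancestor_self[of "w n"] by simp
  next
    case (Suc k)
    define i where "i = n - Suc k"
    have i: "n - k = Suc i" "i < n" using Suc.prems by (auto simp: i_def)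
    have "w i = parent r (w (Suc i))"
      using assms(1)[of i] assms(1)[of "Suc i"] i E_sym[OF assms(2)[of i]]
      by (intro parent_eqI) auto
    also have "w (Suc i) = ancestor (w n) (Suc i)" using Suc i by simp
    also have "parent r \<dots> = ancestor (w n) i" using parent_ancestor[of i "w n"] i assms(1)[of n] by simp
    finally show ?case by (simp add: i_def)
  qed
  from this[of "n - i"] show ?thesis using assms(3) by simp
qed

lemma geodesic_eq: "geodesic E r x = map (ancestor x) [0..<Suc (d r x)]"
  unfolding geodesic_def
proof (rule the_equality)
  let ?xs = "map (ancestor x) [0..<Suc (d r x)]"
  have "successively E ?xs"
    unfolding successively_conv_nth using edge_ancestor by (auto simp del: upt_Suc)
  moreover have "hd ?xs = r" by (subst upt_conv_Cons) simp_all
  moreover have "last ?xs = x" by simp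
  ultimately show "?xs \<noteq> [] \<and> hd ?xs = r \<and> last ?xs = x \<and> successively E ?xs \<and> length ?xs = d r x + 1"
    by (simp del: upt_Suc)
  fix xs assume xs: "xs \<noteq> [] \<and> hd xs = r \<and> last xs = x \<and> successively E xs \<and> length xs = d r x + 1"
  let ?n = "d r x"
  have edge: "E (xs ! i) (xs ! Suc i)" if "i < ?n" for i
  proof -
    have "successively E xs" "Suc i < length xs" using xs that by simp_all
    then show ?thesis unfolding successively_conv_nth by blast
  qed
  have x0: "xs ! 0 = r" "xs ! ?n = x"
  proof -
    have "xs \<noteq> []" "length xs - 1 = ?n" using xs by simp_all
    then have "hd xs = xs ! 0" "last xs = xs ! ?n" by (simp_all add: hd_conv_nth last_conv_nth)
    then show "xs ! 0 = r" "xs ! ?n = x" using xs by simp_all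
  qed
  have up: "d r (xs ! i) \<le> i" if "i \<le> ?n" for i
    using that
  proof (induction i)
    case (Suc i)
    then show ?case using dist_edge_le[OF edge[of i], of r] by simp
  qed (simp add: x0)
  have down: "d r x \<le> d r (xs ! (?n - k)) + k" if "k \<le> ?n" for k
    using that
  proof (induction k)
    case (Suc k)
    then have "Suc (?n - Suc k) = ?n - k" by simp
    then have "d r (xs ! (?n - k)) \<le> d r (xs ! (?n - Suc k)) + 1"
      using dist_edge_le[OF edge[of "?n - Suc k"], of r] Suc.prems by simp
    then show ?case using Suc by simp
  qed (simp add: x0)
  have level: "d r (xs ! i) = i" if "i \<le> ?n" for i
    using up[OF that] down[of "?n - i"] that by simp
  have "xs ! i = ancestor x i" if "i \<le> ?n" for i
    using ascending_walk_ancestor[of ?n "\<lambda>i. xs ! i" i] level edge that x0 by simp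
  then show "xs = ?xs"
    using xs by (intro nth_equalityI) (auto simp del: upt_Suc)
qed

lemma boundary_level:
  assumes "\<omega> \<in> boundary E r" shows "d r (\<omega> i) = i"
proof -
  have "\<omega> 0 = r" "d (\<omega> 0) (\<omega> i) = i - 0" using assms unfolding boundary_def by blast+
  then show ?thesis by simp
qed

lemma boundary_edge:
  assumes "\<omega> \<in> boundary E r" shows "E (\<omega> i) (\<omega> (Suc i))"
proof -
  have "d (\<omega> i) (\<omega> (Suc i)) = Suc i - i" using assms unfolding boundary_def by (blast intro: le_SucI)
  then have "d (\<omega> i) (\<omega> (Suc i)) = 1" by simp
  then show ?thesis by (simp only: dist_1_iff)
qed

lemma boundary_ancestor: "\<omega> \<in> boundary E r \<Longrightarrow> i \<le> n \<Longrightarrow> \<omega> i = ancestor (\<omega> n) i"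
  by (rule ascending_walk_ancestor[of n \<omega>]) (auto simp: boundary_level boundary_edge)

text \<open>A ray and the geodesic to \<open>x\<close> coincide up to some level and never meet again, because a common vertex
determines all vertices below it.\<close>

lemma level_confluent_ge_iff:
  assumes \<omega>: "\<omega> \<in> boundary E r" and i: "i \<le> d r x"
  shows "i \<le> d r (confluent E r x \<omega>) \<longleftrightarrow> \<omega> i = ancestor x i" and "d r (confluent E r x \<omega>) \<le> d r x"
proof -
  define P where "P = (\<lambda>i. \<omega> i = ancestor x i)"
  define js where "js = filter P [0..<Suc (d r x)]"
  have "ancestor x i \<in> range \<omega> \<longleftrightarrow> P i" if "i \<le> d r x" for i
  proof
    assume "ancestor x i \<in> range \<omega>"
    then obtain k where "ancestor x i = \<omega> k" by auto
    then have "k = i" using boundary_level[OF \<omega>, of k] level_ancestor[OF that] by simp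
    then show "P i" using \<open>ancestor x i = \<omega> k\<close> by (simp add: P_def)
  qed (auto simp: P_def intro: range_eqI[OF sym])
  then have filt: "filter (\<lambda>v. v \<in> range \<omega>) (geodesic E r x) = map (ancestor x) js"
    unfolding geodesic_eq js_def filter_map
    by (intro arg_cong[of _ _ "map (ancestor x)"] filter_cong refl) (simp del: upt_Suc)
  have P0: "P 0" using \<omega> by (simp add: P_def boundary_def)
  then have "0 \<in> set js" by (simp add: js_def del: upt_Suc)
  then have ne: "js \<noteq> []" by auto
  then have c: "confluent E r x \<omega> = ancestor x (last js)"
    by (simp add: confluent_def filt last_map)
  have last: "last js \<in> set js" using ne by simp
  then have k: "last js \<le> d r x" "P (last js)" by (auto simp: js_def)
  have lev: "d r (confluent E r x \<omega>) = last js" using c k(1) by simp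
  have mx: "j \<le> last js" if "j \<in> set js" for j
  proof -
    have srt: "sorted js" unfolding js_def by (intro sorted_wrt_filter sorted_upt)
    obtain ys y where ys: "js = ys @ [y]" using ne by (cases js rule: rev_cases) auto
    show ?thesis using srt that unfolding ys by (auto simp: sorted_append)
  qed
  show "d r (confluent E r x \<omega>) \<le> d r x" using lev k by simp
  show "i \<le> d r (confluent E r x \<omega>) \<longleftrightarrow> \<omega> i = ancestor x i"
  proof
    assume "i \<le> d r (confluent E r x \<omega>)"
    then have le: "i \<le> last js" using lev by simp
    have "\<omega> i = ancestor (\<omega> (last js)) i" by (rule boundary_ancestor[OF \<omega> le])
    also have "\<omega> (last js) = ancestor x (last js)" using k(2) by (simp add: P_def)
    also have "ancestor (ancestor x (last js)) i = ancestor x i"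
      using ascending_walk_ancestor[of "last js" "ancestor x" i] le k(1) edge_ancestor by simp
    finally show "\<omega> i = ancestor x i" .
  next
    assume "\<omega> i = ancestor x i"
    then have "i \<in> set js" using i by (simp add: js_def P_def del: upt_Suc)
    then show "i \<le> d r (confluent E r x \<omega>)" using mx lev by simp
  qed
qed

lemma boundary_arc_eq: "boundary_arc E r x = {\<omega> \<in> boundary E r. \<omega> (d r x) = x}"
proof -
  have "d r (confluent E r x \<omega>) = d r x \<longleftrightarrow> \<omega> (d r x) = x" if "\<omega> \<in> boundary E r" for \<omega>
    using level_confluent_ge_iff[OF that, of "d r x" x] by auto
  then show ?thesis by (auto simp: boundary_arc_def)
qed

text \<open>The boundary measure is specified by its values on arcs alone, so that it has to be shown that some
measure takes these values. Draw a child at every vertex, uniformly and independently, and let a ray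
follow the draws; its distribution is such a measure. Drawing also at the vertices that the ray does
not visit turns the space of draws into a product.\<close>

definition choices :: "'v \<Rightarrow> 'v measure" where
  "choices v = uniform_count_measure (children r v)"

primrec ray :: "('v \<Rightarrow> 'v) \<Rightarrow> nat \<Rightarrow> 'v" where
  "ray c 0 = r"
| "ray c (Suc n) = c (ray c n)"

lemma children_nonempty: "children r v \<noteq> {}"
  using card_children_root[of r] card_children[of r v] q_ge_2 by (cases "v = r") auto

lemma space_choices: "space (choices v) = children r v"
  by (simp add: choices_def uniform_count_measure_def space_point_measure)

lemma prob_space_choices: "prob_space (choices v)"
  unfolding choices_def by (intro prob_space_uniform_count_measure children_nonempty) simp

lemma ray_in_boundary:
  assumes "c \<in> space (PiM UNIV choices)" shows "ray c \<in> boundary E r"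
proof -
  have c: "c v \<in> children r v" for v
    using assms by (auto simp: space_PiM space_choices PiE_iff)
  have level: "d r (ray c n) = n" for n
    by (induction n) (use c in \<open>auto simp: children_def\<close>)
  have edge: "E (ray c n) (ray c (Suc n))" for n
    using c[of "ray c n"] by (simp add: children_def)
  have "d (ray c i) (ray c (i + k)) = k" for i k
  proof (rule antisym)
    show "d (ray c i) (ray c (i + k)) \<le> k"
    proof (induction k)
      case (Suc k)
      then show ?case using dist_edge_le[OF edge[of "i + k"], of "ray c i"] by simp
    qed simp
    show "k \<le> d (ray c i) (ray c (i + k))"
      using dist_triangle[of r "ray c (i + k)" "ray c i"] by (simp add: level)
  qed
  then show ?thesis
    unfolding boundary_def by (auto dest!: le_Suc_ex)
qed

definition arc_mass :: "nat \<Rightarrow> real" where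
  "arc_mass n = 1 / (real (q + 1) * real q ^ (n - 1))"

text \<open>The ray passes through \<open>x\<close> if and only if the draws at the proper ancestors of \<open>x\<close> all point towards
\<open>x\<close>. One of them is a choice among \<open>q + 1\<close> children, the others are choices among \<open>q\<close>.\<close>

lemma emeasure_random_ray_arc:
  assumes "x \<noteq> r"
  shows "emeasure (PiM UNIV choices) (ray -` boundary_arc E r x \<inter> space (PiM UNIV choices)) = ennreal (arc_mass (d r x))"
    and "ray -` boundary_arc E r x \<inter> space (PiM UNIV choices) \<in> sets (PiM UNIV choices)"
proof -
  define n where "n = d r x"
  define J where "J = ancestor x ` {..<n}"
  define X where "X = (\<lambda>v. {ancestor x (Suc (d r v))})"
  have n: "1 \<le> n" using assms dist_eq_0[of r x] unfolding n_def by (cases "d r x") auto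
  have inj: "inj_on (ancestor x) {..<n}"
    by (rule inj_on_inverseI[of _ "d r"]) (simp add: n_def)
  have J: "finite J" by (simp add: J_def)
  have child: "ancestor x (Suc i) \<in> children r (ancestor x i)" if "i < n" for i
    using that edge_ancestor[of i x] by (simp add: children_def n_def)
  have X: "X v \<in> sets (choices v)" if "v \<in> J" for v
    using that child by (auto simp: X_def J_def choices_def n_def sets_uniform_count_measure)
  have eq: "ray -` boundary_arc E r x \<inter> space (PiM UNIV choices) = prod_emb UNIV choices J (PiE J X)"
  proof (intro equalityI subsetI)
    fix c assume c: "c \<in> ray -` boundary_arc E r x \<inter> space (PiM UNIV choices)"
    then have \<omega>: "ray c \<in> boundary E r" "ray c n = x" by (auto simp: boundary_arc_eq n_def)
    have "c (ancestor x i) = ancestor x (Suc i)" if "i < n" for i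
      using boundary_ancestor[OF \<omega>(1), of i n] boundary_ancestor[OF \<omega>(1), of "Suc i" n] \<omega>(2) that by simp
    then have "restrict c J \<in> PiE J X" by (auto simp: J_def X_def n_def)
    then show "c \<in> prod_emb UNIV choices J (PiE J X)"
      using c by (auto simp: prod_emb_def space_PiM)
  next
    fix c assume c: "c \<in> prod_emb UNIV choices J (PiE J X)"
    then have sp: "c \<in> space (PiM UNIV choices)" by (auto simp: prod_emb_def space_PiM)
    have step: "c (ancestor x i) = ancestor x (Suc i)" if "i < n" for i
    proof -
      have "ancestor x i \<in> J" using that by (simp add: J_def)
      moreover have "restrict c J \<in> PiE J X" using c by (simp add: prod_emb_def)
      ultimately have "c (ancestor x i) \<in> X (ancestor x i)" by (auto simp: PiE_iff)
      then show ?thesis using that by (simp add: X_def n_def)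
    qed
    have "ray c i = ancestor x i" if "i \<le> n" for i
      using that by (induction i) (auto simp: step)
    then show "c \<in> ray -` boundary_arc E r x \<inter> space (PiM UNIV choices)"
      using sp ray_in_boundary[OF sp] by (auto simp: boundary_arc_eq n_def)
  qed
  have card1: "emeasure (choices (ancestor x i)) (X (ancestor x i)) = ennreal (if i = 0 then 1 / real (q + 1) else 1 / real q)" if "i < n" for i
  proof -
    have "emeasure (choices (ancestor x i)) (X (ancestor x i)) = ennreal (1 / real (card (children r (ancestor x i))))"
      unfolding choices_def X_def using child[OF that] that
      by (subst emeasure_uniform_count_measure) (auto simp: n_def)
    moreover have "card (children r (ancestor x i)) = (if i = 0 then q + 1 else q)"
    proof (cases "i = 0")
      case True
      then show ?thesis using card_children_root[of r] by simp
    next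
      case False
      then have "d r (ancestor x i) \<noteq> 0" using level_ancestor[of i x] that by (simp add: n_def del: dist_eq_0)
      then have "r \<noteq> ancestor x i" by (metis dist_self)
      then show ?thesis using False card_children by simp
    qed
    ultimately show ?thesis by simp
  qed
  have "emeasure (PiM UNIV choices) (prod_emb UNIV choices J (PiE J X)) = (\<Prod>v\<in>J. emeasure (choices v) (X v))"
    by (rule emeasure_PiM_emb) (auto simp: prob_space_choices J X)
  also have "\<dots> = (\<Prod>i<n. emeasure (choices (ancestor x i)) (X (ancestor x i)))"
    unfolding J_def by (subst prod.reindex[OF inj]) simp
  also have "\<dots> = (\<Prod>i<n. ennreal (if i = 0 then 1 / real (q + 1) else 1 / real q))"
    by (intro prod.cong refl card1) simp
  also have "\<dots> = ennreal (\<Prod>i<n. if i = 0 then 1 / real (q + 1) else 1 / real q)"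
    by (rule prod_ennreal) auto
  also have "(\<Prod>i<n. if i = 0 then 1 / real (q + 1) else 1 / real q) = arc_mass n"
  proof -
    obtain m where m: "n = Suc m" using n by (cases n) auto
    show ?thesis unfolding m prod.lessThan_Suc_shift by (simp add: arc_mass_def power_one_over)
  qed
  finally show "emeasure (PiM UNIV choices) (ray -` boundary_arc E r x \<inter> space (PiM UNIV choices)) = ennreal (arc_mass (d r x))"
    by (simp add: eq n_def)
  show "ray -` boundary_arc E r x \<inter> space (PiM UNIV choices) \<in> sets (PiM UNIV choices)"
    unfolding eq by (rule sets_PiM_I) (use J X in auto)
qed

lemma arcs_subset: "boundary_arc E r ` (- {r}) \<subseteq> Pow (boundary E r)"
  by (auto simp: boundary_arc_def)

lemma sets_boundary_measure:
  "sets (boundary_measure E q r) = sigma_sets (boundary E r) (boundary_arc E r ` (- {r}))"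
  "space (boundary_measure E q r) = boundary E r"
  unfolding boundary_measure_def
  by (simp_all add: sets_extend_measure[OF arcs_subset] space_extend_measure[OF arcs_subset])

lemma emeasure_boundary_arc:
  assumes "x \<noteq> r"
  shows "emeasure (boundary_measure E q r) (boundary_arc E r x) = ennreal (arc_mass (d r x))"
proof -
  let ?P = "PiM UNIV choices"
  let ?N = "distr ?P (sigma (boundary E r) (boundary_arc E r ` (- {r}))) ray"
  have meas: "ray \<in> measurable ?P (sigma (boundary E r) (boundary_arc E r ` (- {r})))"
  proof (rule measurable_measure_of[OF arcs_subset])
    show "ray \<in> space ?P \<rightarrow> boundary E r" using ray_in_boundary by auto
    show "ray -` A \<inter> space ?P \<in> sets ?P" if "A \<in> boundary_arc E r ` (- {r})" for A
      using that emeasure_random_ray_arc(2) by auto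
  qed
  have sets_N: "sets ?N = sigma_sets (boundary E r) (boundary_arc E r ` (- {r}))"
    using arcs_subset by simp
  have "emeasure (boundary_measure E q r) (boundary_arc E r x) =
      ennreal (inverse (real (q + 1)) * real q powi (1 - int (d r x)))"
  proof (rule emeasure_extend_measure[OF boundary_measure_def])
    fix y assume y: "y \<in> - {r}"
    have "emeasure ?N (boundary_arc E r y) = emeasure ?P (ray -` boundary_arc E r y \<inter> space ?P)"
      using meas arcs_subset y by (intro emeasure_distr) (auto intro!: sigma_sets.Basic)
    also have "\<dots> = ennreal (arc_mass (d r y))" using emeasure_random_ray_arc(1) y by simp
    also have "arc_mass (d r y) = inverse (real (q + 1)) * real q powi (1 - int (d r y))"
    proof -
      obtain m where m: "d r y = Suc m" using y dist_eq_0[of r y] by (cases "d r y") auto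
      then have "1 - int (d r y) = - int m" by simp
      then show ?thesis unfolding arc_mass_def m by (simp add: power_int_minus divide_simps)
    qed
    finally show "emeasure ?N (boundary_arc E r y) = ennreal (inverse (real (q + 1)) * real q powi (1 - int (d r y)))" .
  next
    show "boundary_arc E r ` (- {r}) \<subseteq> Pow (boundary E r)" by (rule arcs_subset)
    show "positive (sets (boundary_measure E q r)) (emeasure ?N)"
      by (simp add: positive_def)
    show "countably_additive (sets (boundary_measure E q r)) (emeasure ?N)"
      using emeasure_countably_additive[of ?N] by (simp only: sets_N sets_boundary_measure)
    show "x \<in> - {r}" using assms by simp
  qed
  also have "inverse (real (q + 1)) * real q powi (1 - int (d r x)) = arc_mass (d r x)"
  proof -
    obtain m where m: "d r x = Suc m" using assms dist_eq_0[of r x] by (cases "d r x") auto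
    then have "1 - int (d r x) = - int m" by simp
    then show ?thesis unfolding arc_mass_def m by (simp add: power_int_minus divide_simps)
  qed
  finally show ?thesis .
qed

lemma arc_in_sets: "x \<noteq> r \<Longrightarrow> boundary_arc E r x \<in> sets (boundary_measure E q r)"
  unfolding sets_boundary_measure by (rule sigma_sets.Basic) auto

lemma emeasure_boundary: "emeasure (boundary_measure E q r) (boundary E r) = 1"
proof -
  have eq: "boundary E r = (\<Union>u\<in>{u. E r u}. boundary_arc E r u)"
  proof (intro equalityI subsetI)
    fix \<omega> assume \<omega>: "\<omega> \<in> boundary E r"
    have "\<omega> 0 = r" using \<omega> by (simp add: boundary_def)
    then have "E r (\<omega> 1)" using boundary_edge[OF \<omega>, of 0] by simp
    then show "\<omega> \<in> (\<Union>u\<in>{u. E r u}. boundary_arc E r u)"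
      using \<omega> by (auto simp: boundary_arc_eq)
  qed (auto simp: boundary_arc_def)
  have ne: "u \<noteq> r" if "E r u" for u using that by auto
  have "(\<Sum>u\<in>{u. E r u}. emeasure (boundary_measure E q r) (boundary_arc E r u)) =
      emeasure (boundary_measure E q r) (\<Union>u\<in>{u. E r u}. boundary_arc E r u)"
  proof (rule sum_emeasure)
    show "disjoint_family_on (boundary_arc E r) {u. E r u}"
      by (auto simp: disjoint_family_on_def boundary_arc_eq)
  qed (use arc_in_sets ne in auto)
  then have "emeasure (boundary_measure E q r) (boundary E r) = (\<Sum>u\<in>{u. E r u}. ennreal (arc_mass 1))"
    unfolding eq [symmetric] using emeasure_boundary_arc[OF ne] by simp
  also have "\<dots> = ennreal (\<Sum>u\<in>{u. E r u}. arc_mass 1)"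
    by (rule sum_ennreal) (simp add: arc_mass_def)
  also have "(\<Sum>u\<in>{u. E r u}. arc_mass 1) = 1"
    unfolding sum_constant card_neighbours by (simp add: arc_mass_def)
  finally show ?thesis by simp
qed

text \<open>Write the integrand as \<open>h 0\<close> plus the increments \<open>h j - h (j - 1)\<close> over the levels \<open>j\<close> that the confluent
reaches; level \<open>j\<close> is reached on the arc of the ancestor of \<open>x\<close> at that level.\<close>

lemma integral_confluent_level:
  fixes h :: "nat \<Rightarrow> complex"
  shows "(LINT \<omega>|boundary_measure E q r. h (d r (confluent E r x \<omega>))) =
     h 0 + (\<Sum>j=1..d r x. (h j - h (j - 1)) * of_real (arc_mass j))"
proof -
  let ?M = "boundary_measure E q r"
  define A where "A = (\<lambda>j. boundary_arc E r (ancestor x j))"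
  have anc_ne: "ancestor x j \<noteq> r" if "j \<in> {1..d r x}" for j
  proof
    assume "ancestor x j = r"
    then have "d r (ancestor x j) = 0" by simp
    then show False using level_ancestor[of j x] that by simp
  qed
  have A: "A j \<in> sets ?M" "emeasure ?M (A j) = ennreal (arc_mass j)" if "j \<in> {1..d r x}" for j
    using arc_in_sets[OF anc_ne[OF that]] emeasure_boundary_arc[OF anc_ne[OF that]] that by (auto simp: A_def)
  have hb: "has_bochner_integral ?M (\<lambda>\<omega>. indicator (A j) \<omega> *\<^sub>R (h j - h (j - 1))) (arc_mass j *\<^sub>R (h j - h (j - 1)))"
    if "j \<in> {1..d r x}" for j
    using has_bochner_integral_indicator[OF A(1)[OF that], of "h j - h (j - 1)"] A(2)[OF that]
    by (simp add: measure_def arc_mass_def)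
  have hb0: "has_bochner_integral ?M (\<lambda>\<omega>. indicator (boundary E r) \<omega> *\<^sub>R h 0) (1 *\<^sub>R h 0)"
    using has_bochner_integral_indicator[of "boundary E r" ?M "h 0"] emeasure_boundary
      sets.top[of ?M] by (simp add: sets_boundary_measure(2) measure_def)
  have "has_bochner_integral ?M (\<lambda>\<omega>. indicator (boundary E r) \<omega> *\<^sub>R h 0 +
      (\<Sum>j=1..d r x. indicator (A j) \<omega> *\<^sub>R (h j - h (j - 1))))
      (1 *\<^sub>R h 0 + (\<Sum>j=1..d r x. arc_mass j *\<^sub>R (h j - h (j - 1))))"
    by (intro has_bochner_integral_add hb0 has_bochner_integral_sum hb)
  moreover have "indicator (boundary E r) \<omega> *\<^sub>R h 0 + (\<Sum>j=1..d r x. indicator (A j) \<omega> *\<^sub>R (h j - h (j - 1))) =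
      h (d r (confluent E r x \<omega>))" if \<omega>: "\<omega> \<in> space ?M" for \<omega>
  proof -
    have \<omega>: "\<omega> \<in> boundary E r" using \<omega> by (simp add: sets_boundary_measure(2))
    define k where "k = d r (confluent E r x \<omega>)"
    have k: "k \<le> d r x" using level_confluent_ge_iff(2)[OF \<omega>, of 0 x] by (simp add: k_def)
    have "\<omega> \<in> A j \<longleftrightarrow> j \<le> k" if "j \<in> {1..d r x}" for j
      using level_confluent_ge_iff(1)[OF \<omega>, of j x] that \<omega> by (simp add: A_def boundary_arc_eq k_def)
    then have "(\<Sum>j=1..d r x. indicator (A j) \<omega> *\<^sub>R (h j - h (j - 1))) =
        (\<Sum>j=1..d r x. if j \<le> k then h j - h (j - 1) else 0)"
      by (intro sum.cong) (auto simp: indicator_def)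
    also have "\<dots> = (\<Sum>j=1..k. h j - h (j - 1))"
    proof -
      have "{1..k} = {j\<in>{1..d r x}. j \<le> k}" using k by auto
      then show ?thesis by (simp only: sum.inter_filter finite_atLeastAtMost)
    qed
    also have "\<dots> = h k - h 0"
      by (induction k) auto
    finally show ?thesis using \<omega> by (simp add: k_def)
  qed
  ultimately have "has_bochner_integral ?M (\<lambda>\<omega>. h (d r (confluent E r x \<omega>)))
      (1 *\<^sub>R h 0 + (\<Sum>j=1..d r x. arc_mass j *\<^sub>R (h j - h (j - 1))))"
    by (simp cong: has_bochner_integral_cong)
  then show ?thesis
    by (subst has_bochner_integral_integral_eq) (auto simp: scaleR_conv_of_real mult.commute)
qed

section \<open>Spherical functions\<close>

lemma poisson_power_eq:
  "complex_of_real (real q powi k) powr (1 / 2 + \<i> * z) =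
     exp (of_real (real_of_int k / 2 * ln (real q))) * expi k (z * of_real (ln (real q)))"
proof -
  have q: "0 < real q" using q_ge_2 by simp
  have "real q powi k = exp (real_of_int k * ln (real q))"
    using powr_real_of_int'[of "real q" k] q by (simp add: powr_def)
  then have "complex_of_real (real q powi k) powr (1 / 2 + \<i> * z) =
      exp ((1 / 2 + \<i> * z) * of_real (real_of_int k * ln (real q)))"
    by (simp add: powr_def Ln_of_real del: of_real_mult)
  also have "\<dots> = exp (of_real (real_of_int k / 2 * ln (real q)) + \<i> * of_int k * (z * of_real (ln (real q))))"
    by (intro arg_cong[of _ _ exp]) (simp add: algebra_simps)
  finally show ?thesis by (simp add: exp_add expi_def)
qed

text \<open>Multiplied by \<open>q ^ (n - j)\<close>, the value \<open>h j\<close> of the Poisson kernel power on level \<open>j\<close> becomes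
\<open>sqrt q ^ n * exp (i (2 * j - n) w)\<close>. After multiplication by the size of the sphere, the arc masses in
\<open>integral_confluent_level\<close> provide exactly these powers of \<open>q\<close>, and the two parts of the increments
add up to the two string sums in \<open>sphere_poly\<close>.\<close>

lemma spherical_sphere_total:
  assumes "d r x = n"
  shows "of_nat (card (sphere_at r n)) * spherical E q r z x = sphere_poly n (\<lambda>j. expi j (z * of_real (ln (real q))))"
proof -
  define e where "e = (\<lambda>j. expi j (z * of_real (ln (real q))))"
  define h where "h = (\<lambda>j. complex_of_real (real q powi (2 * int j - int n)) powr (1 / 2 + \<i> * z))"
  define s where "s = complex_of_real (sqrt (real q))"
  define Q where "Q = (of_nat q :: complex)"
  have Q0: "Q \<noteq> 0" "1 + Q \<noteq> 0"
    using q_ge_2 unfolding Q_def by (auto simp flip: of_nat_Suc)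
  have "spherical E q r z x = (LINT \<omega>|boundary_measure E q r. h (d r (confluent E r x \<omega>)))"
    by (simp add: spherical_def poisson_kernel_def h_def assms)
  then have sph: "spherical E q r z x = h 0 + (\<Sum>j=1..n. (h j - h (j - 1)) * of_real (arc_mass j))"
    using integral_confluent_level[of h x] assms by simp
  have u: "Q ^ (n - j) * h j = s ^ n * e (2 * int j - int n)" if "j \<le> n" for j
  proof -
    have q: "0 < real q" using q_ge_2 by simp
    define c1 where "c1 = real (n - j) * ln (real q)"
    define c2 where "c2 = real_of_int (2 * int j - int n) / 2 * ln (real q)"
    have s_exp: "sqrt (real q) = exp (ln (real q) / 2)"
      using exp_ln[of "sqrt (real q)"] ln_sqrt[of "real q"] q by simp
    have "real q ^ (n - j) = exp c1"
      using q unfolding c1_def exp_of_nat_mult by simp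
    then have 1: "Q ^ (n - j) = exp (of_real c1)"
      unfolding Q_def exp_of_real by (metis of_real_of_nat_eq of_real_power)
    have "sqrt (real q) ^ n = exp (real n * (ln (real q) / 2))"
      unfolding s_exp by (rule exp_of_nat_mult [symmetric])
    also have "real n * (ln (real q) / 2) = c1 + c2"
      using that by (simp add: c1_def c2_def of_nat_diff field_simps)
    finally have 2: "s ^ n = exp (of_real (c1 + c2))"
      unfolding s_def exp_of_real by (metis of_real_power)
    show ?thesis
      unfolding h_def poisson_power_eq c2_def [symmetric] 1 2 e_def of_real_add exp_add by (simp only: mult.assoc)
  qed
  show ?thesis
  proof (cases n)
    case 0
    then show ?thesis using sph u[of 0] by (simp add: sphere_at_0 e_def)
  next
    case (Suc m)
    have card: "of_nat (card (sphere_at r n)) = (Q + 1) * Q ^ m"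
      unfolding Suc card_sphere_at Q_def by (simp add: algebra_simps)
    define v where "v = (\<lambda>j. Q ^ (n - j) * h j)"
    have tm: "(Q + 1) * Q ^ m * ((h j - h (j - 1)) * of_real (arc_mass j)) = v j - v (j - 1) / Q" if j: "j \<in> {1..n}" for j
    proof -
      obtain i where i: "j = Suc i" "i \<le> m" using j Suc by (cases j) auto
      have "of_real (arc_mass j) = 1 / ((Q + 1) * Q ^ i)"
        by (simp add: arc_mass_def i Q_def add.commute)
      moreover have "Q ^ m = Q ^ (m - i) * Q ^ i" using i by (simp flip: power_add)
      ultimately have "(Q + 1) * Q ^ m * ((h j - h (j - 1)) * of_real (arc_mass j)) = Q ^ (m - i) * (h j - h (j - 1))"
        using Q0 by (simp add: add.commute)
      also have "\<dots> = v j - v (j - 1) / Q"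
        using Q0 i Suc by (simp add: v_def Suc_diff_le algebra_simps)
      finally show ?thesis .
    qed
    have "of_nat (card (sphere_at r n)) * spherical E q r z x =
        (Q + 1) * Q ^ m * h 0 + (\<Sum>j=1..n. v j - v (j - 1) / Q)"
      unfolding sph card distrib_left sum_distrib_left using tm by simp
    also have "(Q + 1) * Q ^ m * h 0 = v 0 + v 0 / Q"
      using Q0 by (simp add: v_def Suc algebra_simps)
    also have "(\<Sum>j=1..n. v j - v (j - 1) / Q) = (\<Sum>i<n. v (Suc i)) - (\<Sum>i<n. v i) / Q"
    proof -
      have "(\<Sum>j=1..n. v j - v (j - 1) / Q) = (\<Sum>i<n. v (Suc i) - v i / Q)"
        by (rule sum.reindex_bij_witness[of _ Suc "\<lambda>j. j - 1"]) auto
      then show ?thesis by (simp add: sum_subtractf sum_divide_distrib)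
    qed
    also have "(\<Sum>i<n. v i) = v 0 + (\<Sum>i<m. v (Suc i))"
      unfolding Suc by (rule sum.lessThan_Suc_shift)
    also have "v 0 + v 0 / Q + ((\<Sum>i<n. v (Suc i)) - (v 0 + (\<Sum>i<m. v (Suc i))) / Q) =
        (v 0 + (\<Sum>i<n. v (Suc i))) - (\<Sum>i<m. v (Suc i)) / Q"
      by (simp add: add_divide_distrib)
    also have "v 0 + (\<Sum>i<n. v (Suc i)) = (\<Sum>i<Suc n. v i)"
      by (rule sum.lessThan_Suc_shift [symmetric])
    also have "(\<Sum>i<Suc n. v i) = s ^ n * string_sum (Suc n) e"
      unfolding string_sum_def sum_distrib_left by (intro sum.cong) (auto simp: v_def u)
    also have "(\<Sum>i<m. v (Suc i)) = s ^ n * string_sum m e"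
      unfolding string_sum_def sum_distrib_left
    proof (intro sum.cong refl)
      fix i assume i: "i \<in> {..<m}"
      have eq: "2 * int (Suc i) - int n = 2 * int i - int m + 1" using Suc by simp
      show "v (Suc i) = s ^ n * e (2 * int i - int m + 1)"
        unfolding v_def eq [symmetric] by (rule u) (use i Suc in simp)
    qed
    finally show ?thesis
      unfolding sphere_poly_def e_def [symmetric] using Suc by (simp add: s_def Q_def right_diff_distrib)
  qed
qed

lemma spherical_transform_eq_symbol:
  fixes \<beta> :: real
  assumes \<beta>: "1 \<le> \<beta>" "real q \<le> \<beta> ^ 2"
    and k: "\<And>s. \<exists>C. \<forall>n. cmod (k' n) \<le> C * (1 / \<beta>) ^ n / (1 + real n) ^ s"
    and rad: "\<And>x. k x = k' (d r x)"
    and z: "z * of_real (ln (real q)) \<in> closed_strip (ln (\<beta> / sqrt (real q)))"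
  shows "spherical_transform E q r k z = symbol (transform_coeff k') (z * of_real (ln (real q)))"
proof -
  define w where "w = z * of_real (ln (real q))"
  let ?f = "\<lambda>j. expi j w"
  obtain C where C: "\<And>n. cmod (k' n) \<le> C * (1 / \<beta>) ^ n / (1 + real n) ^ (0 + 5)"
    using k by blast
  have f: "cmod (expi j w) \<le> 1 * weight (ln (\<beta> / sqrt (real q))) 0 j" for j
    using order_trans[OF norm_expi_le[OF z[folded w_def]] exp_le_weight] by simp
  have S: "((\<lambda>j. transform_coeff k' j * expi j w) has_sum (\<Sum>\<^sub>\<infinity>n. k' n * sphere_poly n ?f)) UNIV"
    and ab: "(\<lambda>n. cmod (k' n * sphere_poly n ?f)) summable_on UNIV"
    by (rule transform_has_sum[OF \<beta> C f])+
  have sph: "(\<Sum>x\<in>sphere_at r n. g (spherical E q r z x)) = of_nat (card (sphere_at r n)) * g (sphere_poly n ?f / of_nat (card (sphere_at r n)))"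
    for n and g :: "complex \<Rightarrow> 'b :: real_normed_field"
  proof -
    have c: "of_nat (card (sphere_at r n)) \<noteq> (0::complex)"
      using sphere_at_nonempty[of r n] by simp
    have "spherical E q r z x = sphere_poly n ?f / of_nat (card (sphere_at r n))" if "x \<in> sphere_at r n" for x
      using spherical_sphere_total[of x n z] that c by (simp add: sphere_at_def w_def field_simps)
    then show ?thesis by simp
  qed
  have c: "card (sphere_at r n) \<noteq> 0" for n
    using sphere_at_nonempty[of r n] by simp
  have val: "(\<Sum>x\<in>sphere_at r n. k x * spherical E q r z x) = k' n * sphere_poly n ?f" for n
  proof -
    have "(\<Sum>x\<in>sphere_at r n. k x * spherical E q r z x) = (\<Sum>x\<in>sphere_at r n. k' n * spherical E q r z x)"
      by (intro sum.cong) (auto simp: rad sphere_at_def)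
    then show ?thesis using sph[of "\<lambda>y. k' n * y" n] c[of n] by simp
  qed
  have nval: "(\<Sum>x\<in>sphere_at r n. cmod (k x * spherical E q r z x)) = cmod (k' n * sphere_poly n ?f)" for n
  proof -
    have "(\<Sum>x\<in>sphere_at r n. cmod (k x * spherical E q r z x)) = (\<Sum>x\<in>sphere_at r n. cmod (k' n * spherical E q r z x))"
      by (intro sum.cong) (auto simp: rad sphere_at_def)
    then show ?thesis using sph[of "\<lambda>y. cmod (k' n * y)" n] c[of n] by (simp add: norm_mult norm_divide)
  qed
  have "((\<lambda>x. k x * spherical E q r z x) has_sum (\<Sum>\<^sub>\<infinity>n. k' n * sphere_poly n ?f)) UNIV"
    using has_sum_over_spheres[of "\<lambda>x. k x * spherical E q r z x" r] ab unfolding val nval by blast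
  then have "spherical_transform E q r k z = (\<Sum>\<^sub>\<infinity>n. k' n * sphere_poly n ?f)"
    unfolding spherical_transform_def by (rule infsumI)
  also have "\<dots> = symbol (transform_coeff k') w"
    unfolding symbol_def using infsumI[OF S] by simp
  finally show ?thesis by (simp add: w_def)
qed

end

section \<open>Schwartz functions and multipliers\<close>

locale tree_schwartz_space = rooted_homogeneous_tree E q r
  for E :: "'v \<Rightarrow> 'v \<Rightarrow> bool" and q :: nat and r :: 'v +
  fixes p :: real
  assumes p_ge_1: "1 \<le> p" and p_less_2: "p < 2"
begin

abbreviation \<S> :: "('v \<Rightarrow> complex) set" where
  "\<S> \<equiv> schwartz E q r p"

abbreviation seminorm :: "nat \<Rightarrow> ('v \<Rightarrow> complex) \<Rightarrow> real" where
  "seminorm \<equiv> schwartz_seminorm E q r p"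

definition \<beta> :: real where
  "\<beta> = real q powr (1 / p)"

text \<open>The half-width of \<open>strip p\<close> after scaling by \<open>ln q\<close>, in the form in which it arises as the growth rate of
the Chebyshev operators.\<close>

definition \<eta> :: real where
  "\<eta> = ln (\<beta> / sqrt (real q))"

lemma beta: "1 \<le> \<beta>" "real q \<le> \<beta> ^ 2"
proof -
  show "1 \<le> \<beta>" unfolding \<beta>_def using q_ge_2 p_ge_1 by (intro ge_one_powr_ge_zero) auto
  have "real q = real q powr 1" using q_ge_2 by simp
  also have "\<dots> \<le> real q powr (2 / p)" using q_ge_2 p_ge_1 p_less_2 by (intro powr_mono) auto
  also have "\<dots> = \<beta> ^ 2" using q_ge_2 by (simp add: \<beta>_def powr_power)
  finally show "real q \<le> \<beta> ^ 2" .
qed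

lemma eta: "\<eta> = (1 / p - 1 / 2) * ln (real q)" "0 < \<eta>"
proof -
  have q: "0 < real q" "1 < real q" using q_ge_2 by auto
  have "\<eta> = ln \<beta> - ln (sqrt (real q))"
    unfolding \<eta>_def using q beta(1) by (subst ln_div) auto
  then show eq: "\<eta> = (1 / p - 1 / 2) * ln (real q)"
    using q by (simp add: \<beta>_def ln_powr ln_sqrt left_diff_distrib)
  have "1 / 2 < 1 / p" using p_ge_1 p_less_2 by (intro divide_strict_left_mono) auto
  then show "0 < \<eta>" unfolding eq using q by (intro mult_pos_pos) auto
qed

lemma schwartz_weight_eq: "schwartz_weight E q r p m x = (1 + real (d r x)) ^ m * \<beta> ^ d r x"
proof -
  have "real q powr (real (d r x) / p) = \<beta> ^ d r x"
    using q_ge_2 by (simp add: \<beta>_def powr_powr powr_realpow [symmetric])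
  then show ?thesis by (simp add: schwartz_weight_def)
qed

lemma weighted_le_iff:
  "schwartz_weight E q r p m x * c \<le> B \<longleftrightarrow> c \<le> B * (1 / \<beta>) ^ d r x / (1 + real (d r x)) ^ m"
proof -
  have "0 < (1 + real (d r x)) ^ m" "0 < \<beta> ^ d r x" using beta(1) by (auto intro!: zero_less_power)
  then show ?thesis
    unfolding schwartz_weight_eq by (simp add: field_simps power_one_over)
qed

lemma schwartz_decay:
  assumes "\<phi> \<in> \<S>"
  shows "cmod (\<phi> x) \<le> seminorm m \<phi> * (1 / \<beta>) ^ d r x / (1 + real (d r x)) ^ m"
proof -
  have "bdd_above (range (\<lambda>x. schwartz_weight E q r p m x * cmod (\<phi> x)))"
    using assms by (simp add: schwartz_def)
  from cSUP_upper[OF UNIV_I this, of x] show ?thesis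
    by (simp add: schwartz_seminorm_def weighted_le_iff [symmetric])
qed

lemma schwartzI:
  assumes "\<And>m. \<exists>B. \<forall>x. cmod (\<phi> x) \<le> B * (1 / \<beta>) ^ d r x / (1 + real (d r x)) ^ m"
  shows "\<phi> \<in> \<S>"
  unfolding schwartz_def
proof (rule CollectI, rule allI)
  fix m
  obtain B where "\<forall>x. cmod (\<phi> x) \<le> B * (1 / \<beta>) ^ d r x / (1 + real (d r x)) ^ m" using assms by blast
  then show "bdd_above (range (\<lambda>x. schwartz_weight E q r p m x * cmod (\<phi> x)))"
    by (intro bdd_aboveI2[of _ _ B]) (simp add: weighted_le_iff)
qed

lemma seminorm_le:
  assumes "\<And>x. cmod (\<phi> x) \<le> B * (1 / \<beta>) ^ d r x / (1 + real (d r x)) ^ m"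
  shows "seminorm m \<phi> \<le> B"
  unfolding schwartz_seminorm_def by (rule cSUP_least) (auto simp: weighted_le_iff assms)

lemma schwartz_lincomb:
  assumes "\<phi> \<in> \<S>" "\<psi> \<in> \<S>" shows "(\<lambda>x. c * \<phi> x + e * \<psi> x) \<in> \<S>"
proof (rule schwartzI, rule exI, rule allI)
  fix m x
  let ?w = "(1 / \<beta>) ^ d r x / (1 + real (d r x)) ^ m"
  have "cmod (c * \<phi> x + e * \<psi> x) \<le> cmod c * cmod (\<phi> x) + cmod e * cmod (\<psi> x)"
    unfolding norm_mult [symmetric] by (rule norm_triangle_ineq)
  also have "\<dots> \<le> cmod c * (seminorm m \<phi> * (1 / \<beta>) ^ d r x / (1 + real (d r x)) ^ m) +
      cmod e * (seminorm m \<psi> * (1 / \<beta>) ^ d r x / (1 + real (d r x)) ^ m)"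
    by (intro add_mono mult_left_mono schwartz_decay assms) auto
  also have "\<dots> = (cmod c * seminorm m \<phi> + cmod e * seminorm m \<psi>) * (1 / \<beta>) ^ d r x / (1 + real (d r x)) ^ m"
    by (simp add: algebra_simps add_divide_distrib)
  finally show "cmod (c * \<phi> x + e * \<psi> x) \<le>
      (cmod c * seminorm m \<phi> + cmod e * seminorm m \<psi>) * (1 / \<beta>) ^ d r x / (1 + real (d r x)) ^ m" .
qed

lemma schwartz_add: "\<phi> \<in> \<S> \<Longrightarrow> \<psi> \<in> \<S> \<Longrightarrow> (\<lambda>x. \<phi> x + \<psi> x) \<in> \<S>"
  using schwartz_lincomb[of \<phi> \<psi> 1 1] by simp

lemma schwartz_cmult: "\<phi> \<in> \<S> \<Longrightarrow> (\<lambda>x. c * \<phi> x) \<in> \<S>"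
  using schwartz_lincomb[of \<phi> \<phi> c 0] by simp

lemma schwartz_diff: "\<phi> \<in> \<S> \<Longrightarrow> \<psi> \<in> \<S> \<Longrightarrow> (\<lambda>x. \<phi> x - \<psi> x) \<in> \<S>"
  using schwartz_lincomb[of \<phi> \<psi> 1 "- 1"] by simp

lemma schwartz_zero: "(\<lambda>_. 0) \<in> \<S>"
  by (rule schwartzI) (auto intro: exI[of _ 0])

lemma schwartz_sum: "(\<And>j. j \<in> F \<Longrightarrow> f j \<in> \<S>) \<Longrightarrow> (\<lambda>x. \<Sum>j\<in>F. f j x) \<in> \<S>"
  by (induction F rule: infinite_finite_induct) (auto intro: schwartz_zero schwartz_add)

lemma chebyshev_decay:
  assumes "\<phi> \<in> \<S>"
  shows "cmod (chebyshev j \<phi> x) \<le>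
     weight \<eta> (m + 2) j * seminorm m \<phi> * (1 / \<beta>) ^ d r x / (1 + real (d r x)) ^ m"
proof -
  have "cmod (chebyshev j \<phi> x) \<le>
      weight (ln (\<beta> / sqrt (real q))) (m + 2) j * (seminorm m \<phi> * (1 / \<beta>) ^ d r x / (1 + real (d r x)) ^ m)"
    by (rule norm_chebyshev_le[OF beta schwartz_decay[OF assms]])
  then show ?thesis by (simp only: \<eta>_def mult.assoc times_divide_eq_right)
qed

lemma chebyshev_schwartz:
  assumes "\<phi> \<in> \<S>" shows "chebyshev j \<phi> \<in> \<S>"
proof (rule schwartzI)
  fix m
  show "\<exists>B. \<forall>x. cmod (chebyshev j \<phi> x) \<le> B * (1 / \<beta>) ^ d r x / (1 + real (d r x)) ^ m"
    using chebyshev_decay[OF assms, of j _ m] by blast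
qed

text \<open>Values outside the Schwartz space are left arbitrary, so that the class is closed under composition
with \<open>\<Lambda>\<close> and under linear combinations. The index \<open>m\<close> of the dominating seminorm fixes the polynomial
order of the sequences that these functionals give rise to.\<close>

definition bounded_functional :: "nat \<Rightarrow> (('v \<Rightarrow> complex) \<Rightarrow> complex) \<Rightarrow> bool" where
  "bounded_functional m T \<longleftrightarrow>
     (\<forall>\<phi>\<in>\<S>. \<forall>\<psi>\<in>\<S>. T (\<lambda>x. \<phi> x + \<psi> x) = T \<phi> + T \<psi>) \<and>
     (\<forall>c. \<forall>\<phi>\<in>\<S>. T (\<lambda>x. c * \<phi> x) = c * T \<phi>) \<and>
     (\<exists>M\<ge>0. \<forall>\<phi>\<in>\<S>. cmod (T \<phi>) \<le> M * seminorm m \<phi>)"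

lemma bounded_functional_add:
  assumes "bounded_functional m T" "\<phi> \<in> \<S>" "\<psi> \<in> \<S>"
  shows "T (\<lambda>x. \<phi> x + \<psi> x) = T \<phi> + T \<psi>"
  using assms unfolding bounded_functional_def by simp

lemma bounded_functional_cmult:
  assumes "bounded_functional m T" "\<phi> \<in> \<S>"
  shows "T (\<lambda>x. c * \<phi> x) = c * T \<phi>"
  using assms unfolding bounded_functional_def by simp

lemma bounded_functional_zero:
  assumes "bounded_functional m T" shows "T (\<lambda>_. 0) = 0"
  using bounded_functional_cmult[OF assms schwartz_zero, of 0] by simp

lemma bounded_functional_sum:
  assumes "bounded_functional m T" "finite F" "\<And>j. j \<in> F \<Longrightarrow> f j \<in> \<S>"
  shows "T (\<lambda>x. \<Sum>j\<in>F. c j * f j x) = (\<Sum>j\<in>F. c j * T (f j))"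
  using assms(2,3)
proof (induction F)
  case empty
  show ?case using bounded_functional_zero[OF assms(1)] by simp
next
  case (insert j F)
  have "(\<lambda>x. c j * f j x) \<in> \<S>" "(\<lambda>x. \<Sum>i\<in>F. c i * f i x) \<in> \<S>"
    using insert.prems by (auto intro!: schwartz_cmult schwartz_sum)
  then have "T (\<lambda>x. c j * f j x + (\<Sum>i\<in>F. c i * f i x)) = T (\<lambda>x. c j * f j x) + T (\<lambda>x. \<Sum>i\<in>F. c i * f i x)"
    by (rule bounded_functional_add[OF assms(1)])
  moreover have "T (\<lambda>x. c j * f j x) = c j * T (f j)"
    using insert.prems by (intro bounded_functional_cmult[OF assms(1)]) auto
  ultimately show ?case using insert by simp
qed

lemma bounded_functional_diff:
  assumes "bounded_functional m T" "\<phi> \<in> \<S>" "\<psi> \<in> \<S>"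
  shows "T (\<lambda>x. \<phi> x - \<psi> x) = T \<phi> - T \<psi>"
proof -
  have "T (\<lambda>x. \<phi> x + (- 1) * \<psi> x) = T \<phi> + T (\<lambda>x. (- 1) * \<psi> x)"
    by (rule bounded_functional_add[OF assms(1,2) schwartz_cmult[OF assms(3)]])
  then show ?thesis
    unfolding bounded_functional_cmult[OF assms(1,3)] by simp
qed

lemma delta_schwartz: "(\<lambda>x. if x = r then 1 else 0) \<in> \<S>"
proof (rule schwartzI, rule exI, rule allI)
  fix m x
  show "cmod (if x = r then 1 else 0) \<le> 1 * (1 / \<beta>) ^ d r x / (1 + real (d r x)) ^ m"
    using beta(1) by auto
qed

lemma conv_delta: "conv E r (\<lambda>x. if x = r then 1 else 0) k x = radial_value E r k (d r x)"
proof -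
  have "conv E r (\<lambda>x. if x = r then 1 else 0) k x =
      (\<Sum>\<^sub>\<infinity>y\<in>{r}. (if y = r then 1 else 0) * radial_value E r k (d x y))"
    unfolding conv_def by (rule infsum_cong_neutral) auto
  then show ?thesis by (simp add: dist_sym)
qed

lemma radial_value_eq:
  assumes "radial E r k" shows "radial_value E r k (d r x) = k x"
  unfolding radial_value_def
proof (rule the_equality)
  show "\<forall>y. d r y = d r x \<longrightarrow> k y = k x" using assms unfolding radial_def by blast
qed auto

lemma strip_iff: "z \<in> strip p \<longleftrightarrow> z * of_real (ln (real q)) \<in> closed_strip \<eta>"
proof -
  have q: "0 < ln (real q)" using q_ge_2 by simp
  have "0 \<le> 1 / p - 1 / 2" using p_ge_1 p_less_2 by (simp add: field_simps)
  then show ?thesis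
    using q by (simp add: strip_def closed_strip_def eta(1) abs_mult)
qed

text \<open>The multiplier maps the indicator function of \<open>r\<close> to its own kernel, so the kernel is a Schwartz
function, and its decay permits the rearrangements behind both expansions.\<close>

lemma multiplier_series:
  assumes "multiplier E q r p \<Lambda> \<kappa>"
  obtains a where "rapid \<eta> a" "\<And>j. a (- j) = a j"
    and "\<And>z. z \<in> strip p \<Longrightarrow> \<kappa> z = symbol a (z * of_real (ln (real q)))"
    and "\<And>\<phi> x. \<phi> \<in> \<S> \<Longrightarrow> ((\<lambda>j. a j * chebyshev j \<phi> x) has_sum \<Lambda> \<phi> x) UNIV"
    and "\<And>\<phi>. \<phi> \<in> \<S> \<Longrightarrow> \<Lambda> \<phi> \<in> \<S>"
    and "\<And>m. \<exists>C>0. \<forall>\<phi>\<in>\<S>. seminorm m (\<Lambda> \<phi>) \<le> C * seminorm m \<phi>"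
proof -
  from assms obtain k where rad: "radial E r k"
    and L: "\<And>\<phi>. \<phi> \<in> \<S> \<Longrightarrow> \<Lambda> \<phi> = conv E r \<phi> k \<and> conv E r \<phi> k \<in> \<S>"
    and cont: "\<And>m. \<exists>C>0. \<forall>\<phi>\<in>\<S>. seminorm m (conv E r \<phi> k) \<le> C * seminorm m \<phi>"
    and \<kappa>: "\<And>z. z \<in> strip p \<Longrightarrow> \<kappa> z = spherical_transform E q r k z"
    unfolding multiplier_def by blast
  define k' where "k' = radial_value E r k"
  have "(\<lambda>x. k' (d r x)) \<in> \<S>"
    using L[OF delta_schwartz] by (simp add: conv_delta [abs_def] k'_def)
  note dec = schwartz_decay[OF this]
  have k': "\<exists>C. \<forall>n. cmod (k' n) \<le> C * (1 / \<beta>) ^ n / (1 + real n) ^ s" for s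
  proof (rule exI, rule allI)
    fix n
    obtain x where "d r x = n" using sphere_at_nonempty[of r n] by (auto simp: sphere_at_def)
    then show "cmod (k' n) \<le> seminorm s (\<lambda>x. k' (d r x)) * (1 / \<beta>) ^ n / (1 + real n) ^ s"
      using dec[of x s] by simp
  qed
  show thesis
  proof (rule that[of "transform_coeff k'"])
    show "rapid \<eta> (transform_coeff k')"
      unfolding \<eta>_def by (rule rapid_transform_coeff[OF beta k'])
    show "transform_coeff k' (- j) = transform_coeff k' j" for j
      by (rule transform_coeff_uminus)
    show "\<kappa> z = symbol (transform_coeff k') (z * of_real (ln (real q)))" if "z \<in> strip p" for z
    proof -
      have "k x = k' (d r x)" for x using radial_value_eq[OF rad] by (simp add: k'_def)
      from spherical_transform_eq_symbol[OF beta k' this, where z = z] that show ?thesis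
        unfolding strip_iff \<eta>_def by (simp add: \<kappa>[OF that])
    qed
    show "((\<lambda>j. transform_coeff k' j * chebyshev j \<phi> x) has_sum \<Lambda> \<phi> x) UNIV" if "\<phi> \<in> \<S>" for \<phi> x
      using conv_has_sum[OF beta k'[unfolded k'_def] schwartz_decay[OF that]] L[OF that] by (simp add: k'_def)
    show "\<Lambda> \<phi> \<in> \<S>" if "\<phi> \<in> \<S>" for \<phi> using L[OF that] by simp
    show "\<exists>C>0. \<forall>\<phi>\<in>\<S>. seminorm m (\<Lambda> \<phi>) \<le> C * seminorm m \<phi>" for m
      using cont[of m] L by simp
  qed
qed

text \<open>The partial sums converge in the seminorm of index \<open>m\<close>, since the coefficients \<open>a j\<close> decay faster than
the Chebyshev operators grow in that seminorm.\<close>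

lemma functional_series:
  assumes T: "bounded_functional m T" and a: "rapid \<eta> a" and \<psi>: "\<psi> \<in> \<S>" and g: "g \<in> \<S>"
    and sums: "\<And>x. ((\<lambda>j. a j * chebyshev j \<psi> x) has_sum g x) UNIV"
  shows "((\<lambda>j. a j * T (chebyshev j \<psi>)) has_sum T g) UNIV"
proof -
  obtain M where M: "0 \<le> M" "\<And>\<phi>. \<phi> \<in> \<S> \<Longrightarrow> cmod (T \<phi>) \<le> M * seminorm m \<phi>"
    using T unfolding bounded_functional_def by blast
  define b where "b = (\<lambda>j. cmod (a j) * weight \<eta> (m + 2) j)"
  have b: "b summable_on UNIV" using a by (simp add: b_def rapid_def)
  define tail where "tail = (\<lambda>F. infsum b UNIV - sum b F)"
  have main: "cmod (T g - (\<Sum>j\<in>F. a j * T (chebyshev j \<psi>))) \<le> M * (seminorm m \<psi> * tail F)" if F: "finite F" for F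
  proof -
    let ?h = "\<lambda>x. g x - (\<Sum>j\<in>F. a j * chebyshev j \<psi> x)"
    have sum_S: "(\<lambda>x. \<Sum>j\<in>F. a j * chebyshev j \<psi> x) \<in> \<S>"
      by (intro schwartz_sum schwartz_cmult chebyshev_schwartz \<psi>)
    have h: "?h \<in> \<S>" by (rule schwartz_diff[OF g sum_S])
    have "T g - (\<Sum>j\<in>F. a j * T (chebyshev j \<psi>)) = T ?h"
      using bounded_functional_diff[OF T g sum_S] bounded_functional_sum[OF T F, of "\<lambda>j. chebyshev j \<psi>" a]
        chebyshev_schwartz[OF \<psi>] by simp
    moreover have "seminorm m ?h \<le> seminorm m \<psi> * tail F"
    proof (rule seminorm_le)
      fix x
      let ?w = "seminorm m \<psi> * (1 / \<beta>) ^ d r x / (1 + real (d r x)) ^ m"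
      have 1: "((\<lambda>j. a j * chebyshev j \<psi> x) has_sum ?h x) (UNIV - F)"
        by (rule has_sum_Diff[OF sums]) (use F in auto)
      have 2: "(b has_sum tail F) (UNIV - F)"
        unfolding tail_def by (rule has_sum_Diff[OF has_sum_infsum[OF b]]) (use F in auto)
      have 3: "((\<lambda>j. b j * ?w) has_sum tail F * ?w) (UNIV - F)"
        by (rule has_sum_cmult_left[OF 2])
      have "cmod (?h x) \<le> tail F * ?w"
      proof (rule norm_infsum_le[OF 1 3])
        fix j
        show "cmod (a j * chebyshev j \<psi> x) \<le> b j * ?w"
          using mult_left_mono[OF chebyshev_decay[OF \<psi>, of j x m] norm_ge_zero[of "a j"]]
          by (simp add: norm_mult b_def mult.assoc)
      qed
      then show "cmod (?h x) \<le> seminorm m \<psi> * tail F * (1 / \<beta>) ^ d r x / (1 + real (d r x)) ^ m"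
        by (simp add: mult_ac)
    qed
    ultimately show ?thesis using M(2)[OF h] mult_left_mono[OF _ M(1)] by fastforce
  qed
  have "((\<lambda>F. M * (seminorm m \<psi> * tail F)) \<longlongrightarrow> M * (seminorm m \<psi> * (infsum b UNIV - infsum b UNIV))) (finite_subsets_at_top UNIV)"
    unfolding tail_def using has_sum_infsum[OF b] unfolding has_sum_def by (intro tendsto_intros)
  then have lim: "((\<lambda>F. M * (seminorm m \<psi> * tail F)) \<longlongrightarrow> 0) (finite_subsets_at_top UNIV)" by simp
  have "((\<lambda>F. T g - (\<Sum>j\<in>F. a j * T (chebyshev j \<psi>))) \<longlongrightarrow> 0) (finite_subsets_at_top UNIV)"
  proof (rule Lim_null_comparison[OF _ lim])
    show "eventually (\<lambda>F. cmod (T g - (\<Sum>j\<in>F. a j * T (chebyshev j \<psi>))) \<le> M * (seminorm m \<psi> * tail F)) (finite_subsets_at_top UNIV)"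
      using main by (intro eventually_finite_subsets_at_top_weakI) auto
  qed
  then have "((\<lambda>F. T g - (T g - (\<Sum>j\<in>F. a j * T (chebyshev j \<psi>)))) \<longlongrightarrow> T g - 0) (finite_subsets_at_top UNIV)"
    by (intro tendsto_diff tendsto_const)
  then show ?thesis by (simp add: has_sum_def)
qed

lemma functional_chebyshev_bound:
  assumes T: "bounded_functional m T" and \<phi>: "\<phi> \<in> \<S>"
  obtains C where "\<And>j. cmod (T (chebyshev j \<phi>)) \<le> C * weight \<eta> (m + 2) j"
proof -
  obtain M where M: "0 \<le> M" "\<And>\<phi>. \<phi> \<in> \<S> \<Longrightarrow> cmod (T \<phi>) \<le> M * seminorm m \<phi>"
    using T unfolding bounded_functional_def by blast
  have "cmod (T (chebyshev j \<phi>)) \<le> (M * seminorm m \<phi>) * weight \<eta> (m + 2) j" for j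
  proof -
    have "seminorm m (chebyshev j \<phi>) \<le> weight \<eta> (m + 2) j * seminorm m \<phi>"
      by (rule seminorm_le) (rule chebyshev_decay[OF \<phi>])
    from mult_left_mono[OF this M(1)] M(2)[OF chebyshev_schwartz[OF \<phi>], of j]
    show ?thesis by (simp add: mult_ac)
  qed
  then show thesis by (rule that)
qed

text \<open>By the product formula, \<open>T (E i (E j \<phi>))\<close> is the mean of the entries of index \<open>i + j\<close> and \<open>i - j\<close>. The two
halves have equal sums because \<open>a\<close> and the sequence are even.\<close>

lemma shift_operator_functional:
  assumes T: "bounded_functional m T" and a: "rapid \<eta> a" and even: "\<And>j. a (- j) = a j" and \<phi>: "\<phi> \<in> \<S>"
    and \<Lambda>: "\<And>\<phi> x. \<phi> \<in> \<S> \<Longrightarrow> ((\<lambda>j. a j * chebyshev j \<phi> x) has_sum \<Lambda> \<phi> x) UNIV" "\<And>\<phi>. \<phi> \<in> \<S> \<Longrightarrow> \<Lambda> \<phi> \<in> \<S>"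
  shows "shift_operator a (\<lambda>j. T (chebyshev j \<phi>)) = (\<lambda>j. T (\<Lambda> (chebyshev j \<phi>)))"
proof
  fix j
  let ?t = "\<lambda>j. T (chebyshev j \<phi>)"
  obtain C where C: "\<And>j. cmod (?t j) \<le> C * weight \<eta> (m + 2) j"
    using functional_chebyshev_bound[OF T \<phi>] by blast
  have C0: "0 \<le> C" using C[of 0] norm_ge_zero[of "?t 0"] by (simp del: norm_ge_zero)
  have sum: "(\<lambda>i. a i * ?t (i + l)) summable_on UNIV" for l
  proof (rule summable_on_norm_comparison)
    show "(\<lambda>i. cmod (a i) * weight \<eta> (m + 2) i * (C * weight \<eta> (m + 2) l)) summable_on UNIV"
      using a by (intro summable_on_cmult_left) (simp add: rapid_def)
    fix i
    have "cmod (?t (i + l)) \<le> C * (weight \<eta> (m + 2) i * weight \<eta> (m + 2) l)"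
      using order_trans[OF C mult_left_mono[OF weight_add_le C0]] eta(2) by simp
    from mult_left_mono[OF this norm_ge_zero[of "a i"]]
    show "cmod (a i * ?t (i + l)) \<le> cmod (a i) * weight \<eta> (m + 2) i * (C * weight \<eta> (m + 2) l)"
      by (simp add: norm_mult mult_ac)
  qed
  have flip: "(\<Sum>\<^sub>\<infinity>i. a i * ?t (i - j)) = (\<Sum>\<^sub>\<infinity>i. a i * ?t (i + j))"
  proof -
    have "(\<Sum>\<^sub>\<infinity>i. a (- i) * ?t (- i - j)) = (\<Sum>\<^sub>\<infinity>i. a i * ?t (i - j))"
      by (rule infsum_reindex_bij_betw) (rule bij_uminus)
    moreover have "?t (- i - j) = ?t (i + j)" for i
      using chebyshev_uminus[of "i + j"] by simp
    ultimately show ?thesis by (simp add: even)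
  qed
  have prod: "T (chebyshev i (chebyshev j \<phi>)) = (?t (i + j) + ?t (i - j)) / 2" for i
  proof -
    have "chebyshev i (chebyshev j \<phi>) = (\<lambda>x. (1 / 2) * (chebyshev (i + j) \<phi> x + chebyshev (i - j) \<phi> x))"
      by (rule ext) (simp add: chebyshev_chebyshev_symmetric)
    moreover have "T (\<lambda>x. (1 / 2) * (chebyshev (i + j) \<phi> x + chebyshev (i - j) \<phi> x)) =
        (1 / 2) * T (\<lambda>x. chebyshev (i + j) \<phi> x + chebyshev (i - j) \<phi> x)"
      by (rule bounded_functional_cmult[OF T schwartz_add[OF chebyshev_schwartz[OF \<phi>] chebyshev_schwartz[OF \<phi>]]])
    ultimately have "T (chebyshev i (chebyshev j \<phi>)) = (1 / 2) * T (\<lambda>x. chebyshev (i + j) \<phi> x + chebyshev (i - j) \<phi> x)"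
      by simp
    also have "T (\<lambda>x. chebyshev (i + j) \<phi> x + chebyshev (i - j) \<phi> x) = ?t (i + j) + ?t (i - j)"
      by (rule bounded_functional_add[OF T chebyshev_schwartz[OF \<phi>] chebyshev_schwartz[OF \<phi>]])
    finally show ?thesis by simp
  qed
  have \<psi>: "chebyshev j \<phi> \<in> \<S>" by (rule chebyshev_schwartz[OF \<phi>])
  have "T (\<Lambda> (chebyshev j \<phi>)) = (\<Sum>\<^sub>\<infinity>i. a i * T (chebyshev i (chebyshev j \<phi>)))"
    using functional_series[OF T a \<psi> \<Lambda>(2)[OF \<psi>] \<Lambda>(1)[OF \<psi>]] by (simp add: infsumI)
  also have "\<dots> = (\<Sum>\<^sub>\<infinity>i. (1 / 2) * (a i * ?t (i + j)) + (1 / 2) * (a i * ?t (i + - j)))"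
    by (intro infsum_cong) (simp add: prod algebra_simps add_divide_distrib)
  also have "\<dots> = (\<Sum>\<^sub>\<infinity>i. (1 / 2) * (a i * ?t (i + j))) + (\<Sum>\<^sub>\<infinity>i. (1 / 2) * (a i * ?t (i + - j)))"
    by (intro infsum_add summable_on_cmult_right sum)
  also have "\<dots> = (1 / 2) * (\<Sum>\<^sub>\<infinity>i. a i * ?t (i + j)) + (1 / 2) * (\<Sum>\<^sub>\<infinity>i. a i * ?t (i - j))"
    by (simp only: infsum_cmult_right' add_uminus_conv_diff)
  finally show "shift_operator a ?t j = T (\<Lambda> (chebyshev j \<phi>))"
    unfolding flip shift_operator_def by simp
qed

end

section \<open>Decomposition into eigenfunctionals\<close>

text \<open>The action of \<open>\<Lambda> - c\<close> on functionals by duality.\<close>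

definition op_minus :: "('f \<Rightarrow> 'f) \<Rightarrow> complex \<Rightarrow> ('f \<Rightarrow> complex) \<Rightarrow> 'f \<Rightarrow> complex" where
  "op_minus \<Lambda> c T \<phi> = T (\<Lambda> \<phi>) - c * T \<phi>"

lemma foldr_op_minus_commute: "foldr (op_minus \<Lambda>) cs (op_minus \<Lambda> c T) = op_minus \<Lambda> c (foldr (op_minus \<Lambda>) cs T)"
proof (induction cs)
  case (Cons b cs)
  have "op_minus \<Lambda> b (op_minus \<Lambda> c U) = op_minus \<Lambda> c (op_minus \<Lambda> b U)" for U
    by (rule ext) (simp add: op_minus_def algebra_simps)
  then show ?case using Cons by simp
qed simp

text \<open>Partial fractions, one factor at a time. By induction \<open>T \<circ> \<Lambda> - c * T\<close> is a sum of eigenfunctionals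
\<open>f b\<close>; then \<open>f b / (b - c)\<close> is the component of \<open>T\<close> with eigenvalue \<open>b\<close>, and what remains of \<open>T\<close> after
removing these components has eigenvalue \<open>c\<close>.\<close>

lemma eigenfunctional_decomposition:
  assumes "distinct cs" and "T \<in> \<B>" and "\<And>\<phi>. \<phi> \<in> S \<Longrightarrow> foldr (op_minus \<Lambda>) cs T \<phi> = 0"
    and \<Lambda>: "\<And>\<phi>. \<phi> \<in> S \<Longrightarrow> \<Lambda> \<phi> \<in> S"
    and op: "\<And>c T. T \<in> \<B> \<Longrightarrow> op_minus \<Lambda> c T \<in> \<B>"
    and lin: "\<And>c e T U. T \<in> \<B> \<Longrightarrow> U \<in> \<B> \<Longrightarrow> (\<lambda>\<phi>. c * T \<phi> + e * U \<phi>) \<in> \<B>"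
  shows "\<exists>f. (\<forall>c\<in>set cs. f c \<in> \<B> \<and> (\<forall>\<phi>\<in>S. f c (\<Lambda> \<phi>) = c * f c \<phi>)) \<and> (\<forall>\<phi>\<in>S. T \<phi> = (\<Sum>c\<in>set cs. f c \<phi>))"
  using assms(1-3)
proof (induction cs arbitrary: T)
  case Nil
  then show ?case by simp
next
  case (Cons c cs)
  have "foldr (op_minus \<Lambda>) cs (op_minus \<Lambda> c T) \<phi> = 0" if "\<phi> \<in> S" for \<phi>
    using Cons.prems(3)[OF that] by (simp add: foldr_op_minus_commute)
  then obtain f where f: "\<And>b. b \<in> set cs \<Longrightarrow> f b \<in> \<B>"
      "\<And>b \<phi>. b \<in> set cs \<Longrightarrow> \<phi> \<in> S \<Longrightarrow> f b (\<Lambda> \<phi>) = b * f b \<phi>"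
      "\<And>\<phi>. \<phi> \<in> S \<Longrightarrow> op_minus \<Lambda> c T \<phi> = (\<Sum>b\<in>set cs. f b \<phi>)"
    using Cons.IH[OF _ op[OF Cons.prems(2)], of c] Cons.prems(1) by (metis distinct.simps(2))
  define g where "g = (\<lambda>b \<phi>. f b \<phi> / (b - c))"
  define h where "h = (\<lambda>\<phi>. T \<phi> - (\<Sum>b\<in>set cs. g b \<phi>))"
  have cnotin: "c \<notin> set cs" using Cons.prems(1) by simp
  have g: "g b \<in> \<B>" if "b \<in> set cs" for b
    using lin[OF f(1)[OF that] f(1)[OF that], of "1 / (b - c)" 0] by (simp add: g_def [abs_def])
  have "finite B \<Longrightarrow> B \<subseteq> set cs \<Longrightarrow> (\<lambda>\<phi>. T \<phi> - (\<Sum>b\<in>B. g b \<phi>)) \<in> \<B>" for B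
  proof (induction B rule: finite_induct)
    case empty
    show ?case using Cons.prems(2) by simp
  next
    case (insert b B)
    then have "(\<lambda>\<phi>. T \<phi> - (\<Sum>b\<in>B. g b \<phi>)) \<in> \<B>" "g b \<in> \<B>" using g by auto
    from lin[OF this, of 1 "- 1"] insert show ?case by (simp add: algebra_simps)
  qed
  then have h: "h \<in> \<B>" by (simp add: h_def)
  have h_eig: "h (\<Lambda> \<phi>) = c * h \<phi>" if \<phi>: "\<phi> \<in> S" for \<phi>
  proof -
    have "h (\<Lambda> \<phi>) - c * h \<phi> = op_minus \<Lambda> c T \<phi> - (\<Sum>b\<in>set cs. g b (\<Lambda> \<phi>) - c * g b \<phi>)"
      by (simp add: h_def op_minus_def sum_subtractf sum_distrib_left algebra_simps)
    also have "(\<Sum>b\<in>set cs. g b (\<Lambda> \<phi>) - c * g b \<phi>) = (\<Sum>b\<in>set cs. f b \<phi>)"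
    proof (rule sum.cong[OF refl])
      fix b assume b: "b \<in> set cs"
      then have "b - c \<noteq> 0" using cnotin by auto
      moreover have "g b (\<Lambda> \<phi>) - c * g b \<phi> = (b - c) * f b \<phi> / (b - c)"
        using f(2)[OF b \<phi>] by (simp add: g_def diff_divide_distrib left_diff_distrib)
      ultimately show "g b (\<Lambda> \<phi>) - c * g b \<phi> = f b \<phi>" by simp
    qed
    finally show ?thesis using f(3)[OF \<phi>] by simp
  qed
  show ?case
  proof (intro exI[of _ "\<lambda>b. if b = c then h else g b"] conjI ballI)
    fix b assume b: "b \<in> set (c # cs)"
    show "(if b = c then h else g b) \<in> \<B>" using b h g by auto
    fix \<phi> assume "\<phi> \<in> S"
    then show "(if b = c then h else g b) (\<Lambda> \<phi>) = b * (if b = c then h else g b) \<phi>"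
      using b h_eig f(2)[of b \<phi>] by (auto simp: g_def)
  next
    fix \<phi> assume "\<phi> \<in> S"
    have "(\<Sum>b\<in>set cs. (if b = c then h else g b) \<phi>) = (\<Sum>b\<in>set cs. g b \<phi>)"
      using cnotin by (intro sum.cong) auto
    then show "T \<phi> = (\<Sum>b\<in>set (c # cs). (if b = c then h else g b) \<phi>)"
      using cnotin by (simp add: h_def)
  qed
qed

text \<open>Evaluating the vanishing sum at \<open>\<Lambda> \<phi>\<close> and subtracting \<open>a k\<close> times its value at \<open>\<phi>\<close> removes the term of
index \<open>k\<close>.\<close>

lemma eigenfunctionals_independent:
  assumes "finite I" "inj_on a I" and \<Lambda>: "\<And>\<phi>. \<phi> \<in> S \<Longrightarrow> \<Lambda> \<phi> \<in> S"
    and "\<And>i \<phi>. i \<in> I \<Longrightarrow> \<phi> \<in> S \<Longrightarrow> \<sigma> i (\<Lambda> \<phi>) = a i * \<sigma> i \<phi>"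
    and "\<And>\<phi>. \<phi> \<in> S \<Longrightarrow> (\<Sum>i\<in>I. \<sigma> i \<phi>) = (0::complex)"
  shows "\<forall>i\<in>I. \<forall>\<phi>\<in>S. \<sigma> i \<phi> = 0"
  using assms(1,2,4,5)
proof (induction I arbitrary: \<sigma> rule: finite_induct)
  case (insert k I)
  have "\<forall>i\<in>I. \<forall>\<phi>\<in>S. (a i - a k) * \<sigma> i \<phi> = 0"
  proof (rule insert.IH)
    show "inj_on a I" using insert.prems(1) by simp
    show "(a i - a k) * \<sigma> i (\<Lambda> \<phi>) = a i * ((a i - a k) * \<sigma> i \<phi>)" if "i \<in> I" "\<phi> \<in> S" for i \<phi>
      using insert.prems(2)[of i \<phi>] that by simp
    show "(\<Sum>i\<in>I. (a i - a k) * \<sigma> i \<phi>) = 0" if \<phi>: "\<phi> \<in> S" for \<phi>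
    proof -
      have "(\<Sum>i\<in>insert k I. \<sigma> i (\<Lambda> \<phi>)) = (\<Sum>i\<in>insert k I. a i * \<sigma> i \<phi>)"
        using insert.prems(2) \<phi> by (intro sum.cong) auto
      then have "(\<Sum>i\<in>insert k I. a i * \<sigma> i \<phi>) - a k * (\<Sum>i\<in>insert k I. \<sigma> i \<phi>) = 0"
        using insert.prems(3)[OF \<phi>] insert.prems(3)[OF \<Lambda>[OF \<phi>]] by simp
      then have "(\<Sum>i\<in>insert k I. (a i - a k) * \<sigma> i \<phi>) = 0"
        by (simp only: left_diff_distrib sum_subtractf sum_distrib_left)
      then show ?thesis using insert.hyps by simp
    qed
  qed
  moreover have "a i \<noteq> a k" if "i \<in> I" for i
    using insert.prems(1) insert.hyps(2) that by (auto simp: inj_on_def)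
  ultimately have I0: "\<forall>i\<in>I. \<forall>\<phi>\<in>S. \<sigma> i \<phi> = 0" by simp
  moreover have "\<sigma> k \<phi> = 0" if "\<phi> \<in> S" for \<phi>
    using insert.prems(3)[OF that] insert.hyps I0 that by simp
  ultimately show ?case by simp
qed simp

context tree_schwartz_space
begin

lemma bounded_functional_op_minus:
  assumes T: "bounded_functional m T"
    and \<Lambda>: "\<And>\<phi>. \<phi> \<in> \<S> \<Longrightarrow> \<Lambda> \<phi> \<in> \<S>" "\<exists>C>0. \<forall>\<phi>\<in>\<S>. seminorm m (\<Lambda> \<phi>) \<le> C * seminorm m \<phi>"
    and add: "\<And>\<phi> \<psi>. \<phi> \<in> \<S> \<Longrightarrow> \<psi> \<in> \<S> \<Longrightarrow> \<Lambda> (\<lambda>x. \<phi> x + \<psi> x) = (\<lambda>x. \<Lambda> \<phi> x + \<Lambda> \<psi> x)"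
    and cmult: "\<And>c \<phi>. \<phi> \<in> \<S> \<Longrightarrow> \<Lambda> (\<lambda>x. c * \<phi> x) = (\<lambda>x. c * \<Lambda> \<phi> x)"
  shows "bounded_functional m (op_minus \<Lambda> c T)"
  unfolding bounded_functional_def
proof (intro conjI ballI allI)
  fix \<phi> \<psi> assume \<phi>: "\<phi> \<in> \<S>" and \<psi>: "\<psi> \<in> \<S>"
  show "op_minus \<Lambda> c T (\<lambda>x. \<phi> x + \<psi> x) = op_minus \<Lambda> c T \<phi> + op_minus \<Lambda> c T \<psi>"
    unfolding op_minus_def add[OF \<phi> \<psi>] bounded_functional_add[OF T \<phi> \<psi>]
      bounded_functional_add[OF T \<Lambda>(1)[OF \<phi>] \<Lambda>(1)[OF \<psi>]] by (simp add: algebra_simps)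
next
  fix e \<phi> assume \<phi>: "\<phi> \<in> \<S>"
  show "op_minus \<Lambda> c T (\<lambda>x. e * \<phi> x) = e * op_minus \<Lambda> c T \<phi>"
    unfolding op_minus_def cmult[OF \<phi>] bounded_functional_cmult[OF T \<phi>]
      bounded_functional_cmult[OF T \<Lambda>(1)[OF \<phi>]] by (simp add: algebra_simps)
next
  obtain M where M: "0 \<le> M" "\<And>\<phi>. \<phi> \<in> \<S> \<Longrightarrow> cmod (T \<phi>) \<le> M * seminorm m \<phi>"
    using T unfolding bounded_functional_def by blast
  obtain C where C: "0 < C" "\<And>\<phi>. \<phi> \<in> \<S> \<Longrightarrow> seminorm m (\<Lambda> \<phi>) \<le> C * seminorm m \<phi>"
    using \<Lambda>(2) by blast
  show "\<exists>M\<ge>0. \<forall>\<phi>\<in>\<S>. cmod (op_minus \<Lambda> c T \<phi>) \<le> M * seminorm m \<phi>"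
  proof (intro exI[of _ "M * C + cmod c * M"] conjI ballI)
    show "0 \<le> M * C + cmod c * M" using M(1) C(1) by simp
    fix \<phi> assume \<phi>: "\<phi> \<in> \<S>"
    have "cmod (op_minus \<Lambda> c T \<phi>) \<le> cmod (T (\<Lambda> \<phi>)) + cmod c * cmod (T \<phi>)"
      unfolding op_minus_def norm_mult [symmetric] by (rule norm_triangle_ineq4)
    also have "\<dots> \<le> M * (C * seminorm m \<phi>) + cmod c * (M * seminorm m \<phi>)"
      by (intro add_mono mult_left_mono M(2)[OF \<phi>] order_trans[OF M(2)[OF \<Lambda>(1)[OF \<phi>]]] C(2)[OF \<phi>] M(1) norm_ge_zero)
    finally show "cmod (op_minus \<Lambda> c T \<phi>) \<le> (M * C + cmod c * M) * seminorm m \<phi>"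
      by (simp add: algebra_simps)
  qed
qed

lemma bounded_functional_lincomb:
  assumes T: "bounded_functional m T" and U: "bounded_functional m U"
  shows "bounded_functional m (\<lambda>\<phi>. c * T \<phi> + e * U \<phi>)"
  unfolding bounded_functional_def
proof (intro conjI ballI allI)
  fix \<phi> \<psi> assume \<phi>: "\<phi> \<in> \<S>" and \<psi>: "\<psi> \<in> \<S>"
  show "c * T (\<lambda>x. \<phi> x + \<psi> x) + e * U (\<lambda>x. \<phi> x + \<psi> x) = c * T \<phi> + e * U \<phi> + (c * T \<psi> + e * U \<psi>)"
    unfolding bounded_functional_add[OF T \<phi> \<psi>] bounded_functional_add[OF U \<phi> \<psi>] by (simp add: algebra_simps)
next
  fix b \<phi> assume \<phi>: "\<phi> \<in> \<S>"
  show "c * T (\<lambda>x. b * \<phi> x) + e * U (\<lambda>x. b * \<phi> x) = b * (c * T \<phi> + e * U \<phi>)"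
    unfolding bounded_functional_cmult[OF T \<phi>] bounded_functional_cmult[OF U \<phi>] by (simp add: algebra_simps)
next
  obtain M where M: "0 \<le> M" "\<And>\<phi>. \<phi> \<in> \<S> \<Longrightarrow> cmod (T \<phi>) \<le> M * seminorm m \<phi>"
    using T unfolding bounded_functional_def by blast
  obtain N where N: "0 \<le> N" "\<And>\<phi>. \<phi> \<in> \<S> \<Longrightarrow> cmod (U \<phi>) \<le> N * seminorm m \<phi>"
    using U unfolding bounded_functional_def by blast
  show "\<exists>M\<ge>0. \<forall>\<phi>\<in>\<S>. cmod (c * T \<phi> + e * U \<phi>) \<le> M * seminorm m \<phi>"
  proof (intro exI[of _ "cmod c * M + cmod e * N"] conjI ballI)
    show "0 \<le> cmod c * M + cmod e * N" using M(1) N(1) by simp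
    fix \<phi> assume \<phi>: "\<phi> \<in> \<S>"
    have "cmod (c * T \<phi> + e * U \<phi>) \<le> cmod c * cmod (T \<phi>) + cmod e * cmod (U \<phi>)"
      unfolding norm_mult [symmetric] by (rule norm_triangle_ineq)
    also have "\<dots> \<le> cmod c * (M * seminorm m \<phi>) + cmod e * (N * seminorm m \<phi>)"
      by (intro add_mono mult_left_mono M(2)[OF \<phi>] N(2)[OF \<phi>] norm_ge_zero)
    finally show "cmod (c * T \<phi> + e * U \<phi>) \<le> (cmod c * M + cmod e * N) * seminorm m \<phi>"
      by (simp add: algebra_simps)
  qed
qed

lemma topspace_schwartz_topology: "topspace (schwartz_topology E q r p) = \<S>"
  unfolding schwartz_topology_def topology_generated_by_topspace
proof (intro equalityI subsetI)
  fix \<phi> assume \<phi>: "\<phi> \<in> \<S>"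
  have "seminorm 0 (\<lambda>x. \<phi> x - \<phi> x) < 1"
    using seminorm_le[of "\<lambda>x. \<phi> x - \<phi> x" 0 0] by simp
  then show "\<phi> \<in> \<Union>{{\<psi> \<in> \<S>. seminorm m (\<lambda>x. \<psi> x - \<phi> x) < e} |m \<phi> e. \<phi> \<in> \<S> \<and> 0 < e}"
    using \<phi> by (intro UnionI[of "{\<psi> \<in> \<S>. seminorm 0 (\<lambda>x. \<psi> x - \<phi> x) < 1}"] CollectI
        exI[of _ 0] exI[of _ \<phi>] exI[of _ 1]) simp_all
qed blast

lemma bounded_functional_tempered:
  assumes T: "bounded_functional m T"
  shows "restrict T \<S> \<in> tempered E q r p"
  unfolding tempered_def
proof (intro CollectI conjI ballI allI)
  show "restrict T \<S> \<in> extensional \<S>" by simp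
  show "restrict T \<S> (\<lambda>x. \<phi> x + \<psi> x) = restrict T \<S> \<phi> + restrict T \<S> \<psi>" if "\<phi> \<in> \<S>" "\<psi> \<in> \<S>" for \<phi> \<psi>
    using that schwartz_add[OF that] bounded_functional_add[OF T that] by simp
  show "restrict T \<S> (\<lambda>x. c * \<phi> x) = c * restrict T \<S> \<phi>" if "\<phi> \<in> \<S>" for c \<phi>
    using that schwartz_cmult[OF that, of c] bounded_functional_cmult[OF T that, of c] by simp
  obtain M where M: "0 \<le> M" "\<And>\<phi>. \<phi> \<in> \<S> \<Longrightarrow> cmod (T \<phi>) \<le> M * seminorm m \<phi>"
    using T unfolding bounded_functional_def by blast
  show "continuous_map (schwartz_topology E q r p) euclidean (restrict T \<S>)"
    unfolding continuous_map_def topspace_schwartz_topology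
  proof (intro conjI allI impI)
    show "restrict T \<S> \<in> \<S> \<rightarrow> topspace euclidean" by simp
    fix U :: "complex set" assume "openin euclidean U"
    then have U: "open U" by simp
    show "openin (schwartz_topology E q r p) {\<phi> \<in> \<S>. restrict T \<S> \<phi> \<in> U}"
    proof (subst openin_subopen, intro ballI)
      fix \<phi> assume "\<phi> \<in> {\<phi> \<in> \<S>. restrict T \<S> \<phi> \<in> U}"
      then have \<phi>: "\<phi> \<in> \<S>" "T \<phi> \<in> U" by auto
      obtain e where e: "0 < e" "ball (T \<phi>) e \<subseteq> U" using U \<phi>(2) open_contains_ball by blast
      define \<delta> where "\<delta> = e / (M + 1)"
      have \<delta>: "0 < \<delta>" using e M(1) by (simp add: \<delta>_def)
      define V where "V = {\<psi> \<in> \<S>. seminorm m (\<lambda>x. \<psi> x - \<phi> x) < \<delta>}"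
      have "openin (schwartz_topology E q r p) V"
        unfolding schwartz_topology_def V_def
        by (rule topology_generated_by_Basis) (use \<phi>(1) \<delta> in blast)
      moreover have "\<phi> \<in> V"
        using \<phi>(1) \<delta> seminorm_le[of "\<lambda>x. \<phi> x - \<phi> x" 0 m] by (simp add: V_def)
      moreover have "V \<subseteq> {\<phi> \<in> \<S>. restrict T \<S> \<phi> \<in> U}"
      proof
        fix \<psi> assume "\<psi> \<in> V"
        then have \<psi>: "\<psi> \<in> \<S>" "seminorm m (\<lambda>x. \<psi> x - \<phi> x) < \<delta>" by (auto simp: V_def)
        have "cmod (T \<psi> - T \<phi>) = cmod (T (\<lambda>x. \<psi> x - \<phi> x))"
          by (simp add: bounded_functional_diff[OF T \<psi>(1) \<phi>(1)])
        also have "\<dots> \<le> M * seminorm m (\<lambda>x. \<psi> x - \<phi> x)"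
          by (rule M(2)[OF schwartz_diff[OF \<psi>(1) \<phi>(1)]])
        also have "\<dots> \<le> M * \<delta>" using \<psi>(2) M(1) by (intro mult_left_mono) auto
        also have "\<dots> < (M + 1) * \<delta>" using \<delta> by simp
        also have "\<dots> = e" using M(1) by (simp add: \<delta>_def)
        finally have "T \<psi> \<in> ball (T \<phi>) e" by (simp add: dist_norm norm_minus_commute)
        then show "\<psi> \<in> {\<phi> \<in> \<S>. restrict T \<S> \<phi> \<in> U}" using e(2) \<psi>(1) by auto
      qed
      ultimately show "\<exists>V. openin (schwartz_topology E q r p) V \<and> \<phi> \<in> V \<and> V \<subseteq> {\<phi> \<in> \<S>. restrict T \<S> \<phi> \<in> U}"
        by blast
    qed
  qed
qed

lemma multiplier_linear:
  assumes \<Lambda>: "\<And>\<phi> x. \<phi> \<in> \<S> \<Longrightarrow> ((\<lambda>j. a j * chebyshev j \<phi> x) has_sum \<Lambda> \<phi> x) UNIV"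
  shows "\<phi> \<in> \<S> \<Longrightarrow> \<psi> \<in> \<S> \<Longrightarrow> \<Lambda> (\<lambda>x. \<phi> x + \<psi> x) = (\<lambda>x. \<Lambda> \<phi> x + \<Lambda> \<psi> x)"
    and "\<phi> \<in> \<S> \<Longrightarrow> \<Lambda> (\<lambda>x. c * \<phi> x) = (\<lambda>x. c * \<Lambda> \<phi> x)"
proof -
  have cheb_nat: "chebyshev_nat n (\<lambda>x. c * \<phi> x + e * \<psi> x) = (\<lambda>x. c * chebyshev_nat n \<phi> x + e * chebyshev_nat n \<psi> x)"
    for n c e \<phi> \<psi>
  proof (induction n \<phi> rule: chebyshev_nat.induct)
    case (2 f)
    show ?case unfolding chebyshev_nat.simps sphere_sum_lincomb by (simp add: add_divide_distrib)
  next
    case (3 n f)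
    have "(c * X + e * Y) / s - (c * x + e * y) = c * (X / s - x) + e * (Y / s - y)" for X Y x y s :: complex
      by (simp add: add_divide_distrib right_diff_distrib)
    then show ?case unfolding chebyshev_nat.simps 3 sphere_sum_lincomb by (intro ext)
  qed simp
  have lin: "\<Lambda> (\<lambda>x. c * \<phi> x + e * \<psi> x) = (\<lambda>x. c * \<Lambda> \<phi> x + e * \<Lambda> \<psi> x)" if \<phi>: "\<phi> \<in> \<S>" and \<psi>: "\<psi> \<in> \<S>" for c e \<phi> \<psi>
  proof
    fix x
    have "((\<lambda>j. c * (a j * chebyshev j \<phi> x) + e * (a j * chebyshev j \<psi> x)) has_sum (c * \<Lambda> \<phi> x + e * \<Lambda> \<psi> x)) UNIV"
      by (intro has_sum_add has_sum_cmult_right \<Lambda> \<phi> \<psi>)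
    moreover have "((\<lambda>j. a j * chebyshev j (\<lambda>x. c * \<phi> x + e * \<psi> x) x) has_sum \<Lambda> (\<lambda>x. c * \<phi> x + e * \<psi> x) x) UNIV"
      by (rule \<Lambda>[OF schwartz_lincomb[OF \<phi> \<psi>]])
    moreover have "(\<lambda>j. a j * chebyshev j (\<lambda>x. c * \<phi> x + e * \<psi> x) x) =
        (\<lambda>j. c * (a j * chebyshev j \<phi> x) + e * (a j * chebyshev j \<psi> x))"
      unfolding chebyshev_def cheb_nat by (simp add: distrib_left mult.left_commute)
    ultimately show "\<Lambda> (\<lambda>x. c * \<phi> x + e * \<psi> x) x = c * \<Lambda> \<phi> x + e * \<Lambda> \<psi> x"
      by (simp add: has_sum_unique)
  qed
  show "\<phi> \<in> \<S> \<Longrightarrow> \<psi> \<in> \<S> \<Longrightarrow> \<Lambda> (\<lambda>x. \<phi> x + \<psi> x) = (\<lambda>x. \<Lambda> \<phi> x + \<Lambda> \<psi> x)"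
    using lin[of \<phi> \<psi> 1 1] by simp
  show "\<phi> \<in> \<S> \<Longrightarrow> \<Lambda> (\<lambda>x. c * \<phi> x) = (\<lambda>x. c * \<Lambda> \<phi> x)"
    using lin[of \<phi> \<phi> c 0] by simp
qed

text \<open>For fixed \<open>\<phi>\<close> the sequences \<open>j \<mapsto> T n (E j \<phi>)\<close> satisfy the hypotheses of
\<open>shift_product_annihilates_scaled\<close>. As \<open>E 0\<close> is the identity, the entry of index \<open>0\<close> is the value of the
functional at \<open>\<phi>\<close>.\<close>

lemma roe_annihilation:
  assumes a: "rapid \<eta> a" and even: "\<And>j. a (- j) = a j"
    and \<Lambda>: "\<And>\<phi> x. \<phi> \<in> \<S> \<Longrightarrow> ((\<lambda>j. a j * chebyshev j \<phi> x) has_sum \<Lambda> \<phi> x) UNIV" "\<And>\<phi>. \<phi> \<in> \<S> \<Longrightarrow> \<Lambda> \<phi> \<in> \<S>"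
      "\<exists>C>0. \<forall>\<phi>\<in>\<S>. seminorm m (\<Lambda> \<phi>) \<le> C * seminorm m \<phi>"
    and T: "\<And>n. bounded_functional m (T n)" "\<And>n \<phi>. \<phi> \<in> \<S> \<Longrightarrow> cmod (T n \<phi>) \<le> M * seminorm m \<phi>"
    and rec: "\<And>n \<phi>. \<phi> \<in> \<S> \<Longrightarrow> T (Suc n) (\<Lambda> \<phi>) = A * T n \<phi>" and A: "A \<noteq> 0"
    and le: "\<And>z. z \<in> closed_strip \<eta> \<Longrightarrow> cmod (symbol a z) \<le> cmod A"
    and cs: "\<And>z. z \<in> closed_strip \<eta> \<Longrightarrow> cmod (symbol a z) = cmod A \<Longrightarrow> symbol a z \<in> set cs"
    and \<phi>: "\<phi> \<in> \<S>" and M: "0 \<le> M"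
  shows "foldr (op_minus \<Lambda>) cs (T 0) \<phi> = 0"
proof -
  define t where "t = (\<lambda>U j. U (chebyshev j \<phi>) :: complex)"
  have step: "shift_minus a c (t U) = t (op_minus \<Lambda> c U)" if "bounded_functional m U" for U c
    using shift_operator_functional[OF that a even \<phi> \<Lambda>(1,2)]
    by (simp add: fun_eq_iff shift_minus_def t_def op_minus_def)
  have bf: "bounded_functional m (foldr (op_minus \<Lambda>) cs (T 0))" for cs
    by (induction cs) (auto intro!: T(1) bounded_functional_op_minus \<Lambda>(2,3) multiplier_linear[OF \<Lambda>(1)])
  have prod: "shift_product a cs (t (T 0)) = t (foldr (op_minus \<Lambda>) cs (T 0))" for cs
    by (induction cs) (simp_all add: step bf)
  have "shift_product a cs (t (T 0)) 0 = 0"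
  proof (rule shift_product_annihilates_scaled[where t = "\<lambda>n. t (T n)" and C = "M * seminorm m \<phi>" and s = "m + 2", OF a eta(2) A _ _ le cs])
    fix n j
    have "seminorm m (chebyshev j \<phi>) \<le> weight \<eta> (m + 2) j * seminorm m \<phi>"
      by (rule seminorm_le) (rule chebyshev_decay[OF \<phi>])
    from mult_left_mono[OF this M] T(2)[OF chebyshev_schwartz[OF \<phi>], of n j]
    show "cmod (t (T n) j) \<le> M * seminorm m \<phi> * weight \<eta> (m + 2) j"
      by (simp add: t_def mult_ac)
  next
    fix n
    have "shift_operator a (t (T (Suc n))) = (\<lambda>j. T (Suc n) (\<Lambda> (chebyshev j \<phi>)))"
      unfolding t_def by (rule shift_operator_functional[OF T(1) a even \<phi> \<Lambda>(1,2)])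
    then show "shift_operator a (t (T (Suc n))) = (\<lambda>j. A * t (T n) j)"
      by (simp add: t_def rec[OF chebyshev_schwartz[OF \<phi>]])
  qed
  then show ?thesis unfolding prod by (simp add: t_def)
qed

end

theorem theorem4p5:
  fixes E :: "'v \<Rightarrow> 'v \<Rightarrow> bool" and q :: nat and r :: 'v and p :: real
    and \<Lambda> :: "('v \<Rightarrow> complex) \<Rightarrow> ('v \<Rightarrow> complex)" and \<kappa> :: "complex \<Rightarrow> complex"
    and T :: "nat \<Rightarrow> ('v \<Rightarrow> complex) \<Rightarrow> complex" \<comment> \<open>\<open>T k\<close> is the distribution of index \<open>-k\<close>\<close>
    and A :: complex and m :: nat and M :: real
  assumes "2 \<le> q" and "homogeneous_tree E q"
    and "1 \<le> p" and "p < 2"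
    and "multiplier E q r p \<Lambda> \<kappa>"
    and "\<forall>z\<in>strip p. \<kappa> z \<noteq> 0"
    and "\<forall>k. T k \<in> tempered E q r p"
    and "A \<noteq> 0"
    and "\<forall>k\<ge>1. \<forall>\<phi>\<in>schwartz E q r p. T k (\<Lambda> \<phi>) = A * T (k - 1) \<phi>"
    and "0 < M"
    and "\<forall>k. \<forall>\<phi>\<in>schwartz E q r p. cmod (T k \<phi>) \<le> M * schwartz_seminorm E q r p m \<phi>"
  shows "(\<forall>j a.
            cmod A = (GREATEST s. s \<in> (\<lambda>z. cmod (\<kappa> z)) ` strip p) \<and>
            bij_betw a {1..j::nat} (\<kappa> ` strip p \<inter> {w. cmod w = cmod A}) \<longrightarrow>
            (\<exists>!\<tau>. \<tau> \<in> {1..j} \<rightarrow>\<^sub>E tempered E q r p \<and>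
                  (\<forall>\<phi>\<in>schwartz E q r p. T 0 \<phi> = (\<Sum>i=1..j. \<tau> i \<phi>)) \<and>
                  (\<forall>i\<in>{1..j}. \<forall>\<phi>\<in>schwartz E q r p. \<tau> i (\<Lambda> \<phi>) = a i * \<tau> i \<phi>))) \<and>
         ((GREATEST s. s \<in> (\<lambda>z. cmod (\<kappa> z)) ` strip p) < cmod A \<longrightarrow>
            (\<forall>\<phi>\<in>schwartz E q r p. T 0 \<phi> = 0))"
proof -
  interpret tree_schwartz_space E q r p
    by unfold_locales (use assms in auto)
  obtain b where b: "rapid \<eta> b" "\<And>j. b (- j) = b j"
    and \<kappa>: "\<And>z. z \<in> strip p \<Longrightarrow> \<kappa> z = symbol b (z * of_real (ln (real q)))"
    and \<Lambda>: "\<And>\<phi> x. \<phi> \<in> \<S> \<Longrightarrow> ((\<lambda>j. b j * chebyshev j \<phi> x) has_sum \<Lambda> \<phi> x) UNIV" "\<And>\<phi>. \<phi> \<in> \<S> \<Longrightarrow> \<Lambda> \<phi> \<in> \<S>"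
    and \<Lambda>_bdd: "\<And>m. \<exists>C>0. \<forall>\<phi>\<in>\<S>. seminorm m (\<Lambda> \<phi>) \<le> C * seminorm m \<phi>"
    using multiplier_series[OF assms(5)] by blast
  have T_bdd: "bounded_functional m (T n)" for n
    using assms(7,10,11) unfolding bounded_functional_def tempered_def by (auto intro!: exI[of _ M])
  have lnq: "ln (real q) \<noteq> 0" using assms(1) by simp
  have range: "\<kappa> ` strip p = symbol b ` closed_strip \<eta>"
  proof (intro equalityI subsetI)
    fix w assume "w \<in> symbol b ` closed_strip \<eta>"
    then obtain z where z: "z \<in> closed_strip \<eta>" "w = symbol b z" by blast
    have "z / of_real (ln (real q)) \<in> strip p" unfolding strip_iff using z(1) lnq by simp
    from imageI[OF this, of \<kappa>] \<kappa>[OF this] z(2) lnq show "w \<in> \<kappa> ` strip p" by simp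
  qed (auto simp: \<kappa> strip_iff)
  define G where "G = (GREATEST s. s \<in> (\<lambda>z. cmod (\<kappa> z)) ` strip p)"
  have G: "cmod (symbol b z) \<le> G" if "z \<in> closed_strip \<eta>" for z
  proof -
    have "0 \<in> closed_strip \<eta>" using eta(2) by (simp add: closed_strip_def)
    then have "symbol b ` closed_strip \<eta> \<noteq> {}" by blast
    then obtain w where w: "w \<in> symbol b ` closed_strip \<eta>" "\<And>v. v \<in> symbol b ` closed_strip \<eta> \<Longrightarrow> cmod v \<le> cmod w"
      using continuous_attains_sup[OF compact_symbol_image[OF b(1)] _ continuous_on_norm_id] by blast
    have "G = cmod w"
      unfolding G_def
    proof (rule Greatest_equality)
      show "cmod w \<in> (\<lambda>z. cmod (\<kappa> z)) ` strip p" using w(1) unfolding range [symmetric] by blast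
      show "s \<le> cmod w" if "s \<in> (\<lambda>z. cmod (\<kappa> z)) ` strip p" for s
        using that w(2) unfolding range [symmetric] by blast
    qed
    then show ?thesis using w(2) that by blast
  qed
  have kill: "foldr (op_minus \<Lambda>) cs (T 0) \<phi> = 0"
    if "G \<le> cmod A" "\<kappa> ` strip p \<inter> {w. cmod w = cmod A} \<subseteq> set cs" "\<phi> \<in> \<S>" for cs \<phi>
  proof (rule roe_annihilation[OF b \<Lambda> \<Lambda>_bdd T_bdd, where A = A and M = M])
    show "cmod (symbol b z) \<le> cmod A" if "z \<in> closed_strip \<eta>" for z
      using G[OF that] \<open>G \<le> cmod A\<close> by simp
    show "symbol b z \<in> set cs" if "z \<in> closed_strip \<eta>" "cmod (symbol b z) = cmod A" for z
      using that \<open>\<kappa> ` strip p \<inter> {w. cmod w = cmod A} \<subseteq> set cs\<close> unfolding range by blast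
    show "T (Suc n) (\<Lambda> \<phi>) = A * T n \<phi>" if "\<phi> \<in> \<S>" for n \<phi>
      using assms(9)[rule_format, of "Suc n" \<phi>] that by simp
    show "cmod (T n \<phi>) \<le> M * seminorm m \<phi>" if "\<phi> \<in> \<S>" for n \<phi>
      using assms(11) that by blast
    show "A \<noteq> 0" "0 \<le> M" "\<phi> \<in> \<S>" using assms(8,10) that(3) by auto
  qed
  have part_b: "T 0 \<phi> = 0" if "G < cmod A" "\<phi> \<in> \<S>" for \<phi>
  proof -
    have "\<kappa> ` strip p \<inter> {w. cmod w = cmod A} \<subseteq> set []"
    proof
      fix w assume "w \<in> \<kappa> ` strip p \<inter> {w. cmod w = cmod A}"
      then obtain z where "z \<in> closed_strip \<eta>" "w = symbol b z" "cmod w = cmod A" unfolding range by blast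
      then have "cmod w \<le> G" "cmod w = cmod A" using G[of z] by simp_all
      then show "w \<in> set []" using that(1) by simp
    qed
    from kill[OF _ this that(2)] that(1) show ?thesis by simp
  qed
  have part_a: "\<exists>!\<tau>. \<tau> \<in> {1..j} \<rightarrow>\<^sub>E tempered E q r p \<and>
                  (\<forall>\<phi>\<in>\<S>. T 0 \<phi> = (\<Sum>i=1..j. \<tau> i \<phi>)) \<and>
                  (\<forall>i\<in>{1..j}. \<forall>\<phi>\<in>\<S>. \<tau> i (\<Lambda> \<phi>) = a i * \<tau> i \<phi>)"
    if AG: "cmod A = G" and bij: "bij_betw a {1..j::nat} (\<kappa> ` strip p \<inter> {w. cmod w = cmod A})" for j a
  proof (rule ex_ex1I)
    have inj: "inj_on a {1..j}" using bij by (rule bij_betw_imp_inj_on)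
    obtain cs where cs: "set cs = a ` {1..j}" "distinct cs"
      using finite_distinct_list[of "a ` {1..j}"] by auto
    have vanish: "foldr (op_minus \<Lambda>) cs (T 0) \<phi> = 0" if "\<phi> \<in> \<S>" for \<phi>
      using kill[of cs \<phi>] that AG bij_betw_imp_surj_on[OF bij] cs(1) by simp
    have "\<exists>f. (\<forall>c\<in>set cs. f c \<in> Collect (bounded_functional m) \<and> (\<forall>\<phi>\<in>\<S>. f c (\<Lambda> \<phi>) = c * f c \<phi>)) \<and>
        (\<forall>\<phi>\<in>\<S>. T 0 \<phi> = (\<Sum>c\<in>set cs. f c \<phi>))"
    proof (rule eigenfunctional_decomposition[OF cs(2)])
      show "T 0 \<in> Collect (bounded_functional m)" using T_bdd by simp
      show "op_minus \<Lambda> c U \<in> Collect (bounded_functional m)" if "U \<in> Collect (bounded_functional m)" for c U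
      proof -
        have U: "bounded_functional m U" using that by simp
        show ?thesis
          unfolding mem_Collect_eq
          using U \<Lambda>(2) \<Lambda>_bdd multiplier_linear[OF \<Lambda>(1)]
          by (rule bounded_functional_op_minus)
      qed
      show "(\<lambda>\<phi>. c * U \<phi> + e * V \<phi>) \<in> Collect (bounded_functional m)"
        if "U \<in> Collect (bounded_functional m)" "V \<in> Collect (bounded_functional m)" for c e U V
        using that unfolding mem_Collect_eq by (rule bounded_functional_lincomb)
    qed (fact vanish \<Lambda>(2))+
    then obtain f where f0: "\<forall>c\<in>set cs. f c \<in> Collect (bounded_functional m) \<and> (\<forall>\<phi>\<in>\<S>. f c (\<Lambda> \<phi>) = c * f c \<phi>)"
      "\<forall>\<phi>\<in>\<S>. T 0 \<phi> = (\<Sum>c\<in>set cs. f c \<phi>)"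
      by blast
    have f: "\<And>c. c \<in> set cs \<Longrightarrow> bounded_functional m (f c)"
      "\<And>c \<phi>. c \<in> set cs \<Longrightarrow> \<phi> \<in> \<S> \<Longrightarrow> f c (\<Lambda> \<phi>) = c * f c \<phi>"
      "\<And>\<phi>. \<phi> \<in> \<S> \<Longrightarrow> T 0 \<phi> = (\<Sum>c\<in>set cs. f c \<phi>)"
      using f0 by simp_all
    define \<tau> where "\<tau> = (\<lambda>i\<in>{1..j}. restrict (f (a i)) \<S>)"
    show "\<exists>\<tau>. \<tau> \<in> {1..j} \<rightarrow>\<^sub>E tempered E q r p \<and>
                  (\<forall>\<phi>\<in>\<S>. T 0 \<phi> = (\<Sum>i=1..j. \<tau> i \<phi>)) \<and>
                  (\<forall>i\<in>{1..j}. \<forall>\<phi>\<in>\<S>. \<tau> i (\<Lambda> \<phi>) = a i * \<tau> i \<phi>)"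
    proof (intro exI[of _ \<tau>] conjI ballI)
      show "\<tau> \<in> {1..j} \<rightarrow>\<^sub>E tempered E q r p"
      proof -
        have "restrict (f (a i)) \<S> \<in> tempered E q r p" if "i \<in> {1..j}" for i
          using f(1)[of "a i"] cs(1) that by (intro bounded_functional_tempered) simp
        then show ?thesis unfolding \<tau>_def restrict_PiE_iff by blast
      qed
      show "T 0 \<phi> = (\<Sum>i=1..j. \<tau> i \<phi>)" if \<phi>: "\<phi> \<in> \<S>" for \<phi>
      proof -
        have "T 0 \<phi> = (\<Sum>i\<in>{1..j}. f (a i) \<phi>)"
          unfolding f(3)[OF \<phi>] cs(1) by (subst sum.reindex[OF inj]) simp
        then show ?thesis using \<phi> by (simp add: \<tau>_def)
      qed
      show "\<tau> i (\<Lambda> \<phi>) = a i * \<tau> i \<phi>" if "i \<in> {1..j}" "\<phi> \<in> \<S>" for i \<phi>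
        using that f(2)[of "a i" \<phi>] cs(1) \<Lambda>(2) by (simp add: \<tau>_def)
    qed
    fix \<tau> \<tau>'
    assume \<tau>: "\<tau> \<in> {1..j} \<rightarrow>\<^sub>E tempered E q r p \<and>
                  (\<forall>\<phi>\<in>\<S>. T 0 \<phi> = (\<Sum>i=1..j. \<tau> i \<phi>)) \<and>
                  (\<forall>i\<in>{1..j}. \<forall>\<phi>\<in>\<S>. \<tau> i (\<Lambda> \<phi>) = a i * \<tau> i \<phi>)"
      and \<tau>': "\<tau>' \<in> {1..j} \<rightarrow>\<^sub>E tempered E q r p \<and>
                  (\<forall>\<phi>\<in>\<S>. T 0 \<phi> = (\<Sum>i=1..j. \<tau>' i \<phi>)) \<and>
                  (\<forall>i\<in>{1..j}. \<forall>\<phi>\<in>\<S>. \<tau>' i (\<Lambda> \<phi>) = a i * \<tau>' i \<phi>)"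
    have "\<forall>i\<in>{1..j}. \<forall>\<phi>\<in>\<S>. \<tau> i \<phi> - \<tau>' i \<phi> = 0"
    proof (rule eigenfunctionals_independent[where \<Lambda> = \<Lambda> and a = a])
      show "\<tau> i (\<Lambda> \<phi>) - \<tau>' i (\<Lambda> \<phi>) = a i * (\<tau> i \<phi> - \<tau>' i \<phi>)" if "i \<in> {1..j}" "\<phi> \<in> \<S>" for i \<phi>
        using \<tau> \<tau>' that by (simp add: right_diff_distrib)
      show "(\<Sum>i\<in>{1..j}. \<tau> i \<phi> - \<tau>' i \<phi>) = 0" if "\<phi> \<in> \<S>" for \<phi>
        using \<tau> \<tau>' that by (simp add: sum_subtractf)
    qed (use inj \<Lambda>(2) in auto)
    then have eq: "\<tau> i \<phi> = \<tau>' i \<phi>" if "i \<in> {1..j}" "\<phi> \<in> \<S>" for i \<phi> using that by simp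
    show "\<tau> = \<tau>'"
    proof (rule PiE_ext)
      show "\<tau> \<in> {1..j} \<rightarrow>\<^sub>E tempered E q r p" "\<tau>' \<in> {1..j} \<rightarrow>\<^sub>E tempered E q r p"
        using \<tau> \<tau>' by blast+
      fix i assume i: "i \<in> {1..j}"
      then have "\<tau> i \<in> extensional \<S>" "\<tau>' i \<in> extensional \<S>"
        using \<tau> \<tau>' by (auto simp: tempered_def PiE_iff)
      then show "\<tau> i = \<tau>' i" using eq[OF i] by (rule extensionalityI)
    qed
  qed
  show ?thesis
  proof (intro conjI allI impI ballI)
    fix j a
    assume *: "cmod A = (GREATEST s. s \<in> (\<lambda>z. cmod (\<kappa> z)) ` strip p) \<and>
      bij_betw a {1..j::nat} (\<kappa> ` strip p \<inter> {w. cmod w = cmod A})"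
    show "\<exists>!\<tau>. \<tau> \<in> {1..j} \<rightarrow>\<^sub>E tempered E q r p \<and>
                  (\<forall>\<phi>\<in>\<S>. T 0 \<phi> = (\<Sum>i=1..j. \<tau> i \<phi>)) \<and>
                  (\<forall>i\<in>{1..j}. \<forall>\<phi>\<in>\<S>. \<tau> i (\<Lambda> \<phi>) = a i * \<tau> i \<phi>)"
    proof (rule part_a)
      show "cmod A = G" using * unfolding G_def by simp
      show "bij_betw a {1..j} (\<kappa> ` strip p \<inter> {w. cmod w = cmod A})" using * by (rule conjunct2)
    qed
  next
    fix \<phi>
    assume "(GREATEST s. s \<in> (\<lambda>z. cmod (\<kappa> z)) ` strip p) < cmod A" "\<phi> \<in> \<S>"
    then show "T 0 \<phi> = 0" by (intro part_b) (simp_all only: G_def)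
  qed
qed

end
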